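(* Let $a$ and $b$ be positive integers. Then there exist nonnegative integers $\alpha_{(a,b)}(i,j)$ ($1\le i\le a$, $1\le j\le b$), independent of $m$ and $n$, such that for all $m,n\in\mathbb{Z}_{\ge 0}$ \[ u_{(a,b)}(m,n)=\frac{1}{\gcd(a,b)}\sum_{\substack{1\le i\le a,\\ 1\le j\le b}}\alpha_{(a,b)}(i,j)\binom{m}{i}\binom{n}{j}. \]
   Context: Let $N^+=\mathbb{Z}_{\ge0}^2\setminus\{(0,0)\}$ and for $(a,b),(c,d)\in\mathbb{Z}^2$ put $\{(a,b),(c,d)\}=bc-ad$. Let $\mathfrak{g}=\bigoplus_{n\in N^+}\mathbb{Q}X_n$ be the $N^+$-graded Lie algebra over $\mathbb{Q}$ with $[X_n,X_{n'}]=\{n,n'\}X_{n+n'}$. Put $\deg(a,b)=a+b$, $\mathfrak{g}^{>l}=\bigoplus_{\deg n>l}\mathbb{Q}X_n$, $\mathfrak{g}^{\le l}=\mathfrak{g}/\mathfrak{g}^{>l}$ (nilpotent), $G^{\le l}=\exp(\mathfrak{g}^{\le l})$ with the Baker–Campbell–Hausdorff product, and $G=\varprojlim G^{\le l}$ (the structure group). For $g=\exp(X)\in G$ and $c\in\mathbb{Q}$, $g^c=\exp(cX)$. The dilogarithm element is $[a,b]:=\exp\big(\sum_{j\ge1}\frac{(-1)^{j+1}}{j^2}X_{j(a,b)}\big)$ for $(a,b)\in N^+$. Total order on $N^+$: $(a,b)\le(c,d)$ iff $\{(a,b),(c,d)\}<0$ or $(c,d)=k(a,b)$ for some rational $k\ge1$.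 A product $\prod_{j\in J}[a_j,b_j]^{u_j}$ over a countable totally ordered index set $J$ ($u_j\in\mathbb{Q}$) is called ordered if $(a_i,b_i)<(a_j,b_j)$ whenever $i<j$; infinite such products are interpreted in $G$ via the projections to the $G^{\le l}$. It is known that for $m,n\in\mathbb{Z}_{\ge0}$ the element $[0,1]^n[1,0]^m$ equals a unique ordered product $\prod_{(a,b)\in N^+}[a,b]^{u_{(a,b)}(m,n)}$ with $u_{(a,b)}(m,n)\in\mathbb{Q}$; this defines $u_{(a,b)}(m,n)$. *)

theory Defs
  imports Complex_Main "HOL-Library.Poly_Mapping" "HOL-Library.Product_Plus" "HOL-Algebra.Group"
begin

definition Nplus :: "(nat \<times> nat) set" where
  "Nplus = UNIV - {(0, 0)}"

definition form :: "nat \<times> nat \<Rightarrow> nat \<times> nat \<Rightarrow> int" where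
  "form p q = int (snd p) * int (fst q) - int (fst p) * int (snd q)"

definition ndeg :: "nat \<times> nat \<Rightarrow> nat" where
  "ndeg p = fst p + snd p"

text \<open>The Lie algebra with basis \<open>X\<^sub>n\<close>, \<open>n \<in> Nplus\<close>, consists of the finitely supported
  functions with support in \<open>Nplus\<close>; \<open>X\<^sub>n\<close> is \<open>Poly_Mapping.single n 1\<close>.\<close>

type_synonym lie = "nat \<times> nat \<Rightarrow>\<^sub>0 rat"

definition lie_carrier :: "lie set" where
  "lie_carrier = {X. Poly_Mapping.keys X \<subseteq> Nplus}"

definition lie_scale :: "rat \<Rightarrow> lie \<Rightarrow> lie" where
  "lie_scale c X = Poly_Mapping.map ((*) c) X"

definition lie_bracket :: "lie \<Rightarrow> lie \<Rightarrow> lie" where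
  "lie_bracket X Y =
    (\<Sum>p\<in>Poly_Mapping.keys X. \<Sum>q\<in>Poly_Mapping.keys Y.
      Poly_Mapping.single (p + q)
        (of_int (form p q) * Poly_Mapping.lookup X p * Poly_Mapping.lookup Y q))"

text \<open>The quotient by the ideal of elements of degree \<open>> l\<close> is represented by its unique
  representatives without components of degree \<open>> l\<close>; \<open>trunc l\<close> is the projection.\<close>

definition trunc :: "nat \<Rightarrow> lie \<Rightarrow> lie" where
  "trunc l X = (\<Sum>p\<in>{p \<in> Poly_Mapping.keys X. ndeg p \<le> l}.
      Poly_Mapping.single p (Poly_Mapping.lookup X p))"

definition quot_carrier :: "nat \<Rightarrow> lie set" where
  "quot_carrier l = trunc l ` lie_carrier"

definition quot_bracket :: "nat \<Rightarrow> lie \<Rightarrow> lie \<Rightarrow> lie" where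
  "quot_bracket l X Y = trunc l (lie_bracket X Y)"

text \<open>\<open>nested_bracket l [x\<^sub>1, \<dots>, x\<^sub>k] = [x\<^sub>1, [x\<^sub>2, \<dots> [x\<^bsub>k-1\<^esub>, x\<^sub>k] \<dots>]]\<close>\<close>

fun nested_bracket :: "nat \<Rightarrow> lie list \<Rightarrow> lie" where
  "nested_bracket l [] = 0"
| "nested_bracket l [x] = x"
| "nested_bracket l (x # y # xs) = quot_bracket l x (nested_bracket l (y # xs))"

text \<open>The Baker--Campbell--Hausdorff product \<open>log (exp X exp Y)\<close> in Dynkin's form
  \[ \sum_{k \ge 1} \frac{(-1)^{k-1}}{k} \sum_{r_i + s_i > 0}
     \frac{[X^{r_1} Y^{s_1} \cdots X^{r_k} Y^{s_k}]}
          {\bigl(\sum_i (r_i + s_i)\bigr) \prod_i r_i! \, s_i!}. \]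
  In the quotient by degree \<open>> l\<close> every bracket of more than \<open>l\<close> factors vanishes, so the sum
  is restricted to the finitely many terms with at most \<open>l\<close> factors.\<close>

definition word_length :: "(nat \<times> nat) list \<Rightarrow> nat" where
  "word_length rs = sum_list (map (\<lambda>(r, s). r + s) rs)"

definition bch_index :: "nat \<Rightarrow> (nat \<times> nat) list set" where
  "bch_index l = {rs. rs \<noteq> [] \<and> (\<forall>(r, s)\<in>set rs. r + s > 0) \<and> word_length rs \<le> l}"

definition bch :: "nat \<Rightarrow> lie \<Rightarrow> lie \<Rightarrow> lie" where
  "bch l X Y = (\<Sum>rs\<in>bch_index l.
      lie_scale ((-1) ^ (length rs - 1) /
          (of_nat (length rs) * of_nat (word_length rs) *
            prod_list (map (\<lambda>(r, s). fact r * fact s) rs)))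
        (nested_bracket l (concat (map (\<lambda>(r, s). replicate r X @ replicate s Y) rs))))"

lemma finite_bch_index: "finite (bch_index l)"
proof (rule finite_subset)
  have "length rs \<le> l \<and> set rs \<subseteq> {..l} \<times> {..l}" if "rs \<in> bch_index l" for rs
  proof -
    have *: "(\<forall>(r, s)\<in>set rs. r + s > 0) \<Longrightarrow>
      length rs \<le> word_length rs \<and> (\<forall>(r, s)\<in>set rs. r + s \<le> word_length rs)"
      by (induction rs) (fastforce simp: word_length_def)+
    show ?thesis using that * by (fastforce simp: bch_index_def)
  qed
  then show "bch_index l \<subseteq> {rs. set rs \<subseteq> {..l} \<times> {..l} \<and> length rs \<le> l}"
    by blast
  show "finite {rs. set rs \<subseteq> {..l} \<times> {..l} \<and> length rs \<le> l}"
    by (rule finite_lists_length_le) simp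
qed

text \<open>Group elements are written in exponential coordinates: \<open>exp X\<close> is represented by \<open>X\<close>.\<close>

definition quot_group :: "nat \<Rightarrow> lie monoid" where
  "quot_group l = \<lparr>carrier = quot_carrier l, mult = bch l, one = 0\<rparr>"

text \<open>The inverse limit: an element is the compatible family of its projections.\<close>

definition structure_group :: "(nat \<Rightarrow> lie) monoid" where
  "structure_group =
    \<lparr>carrier = {g. (\<forall>l. g l \<in> carrier (quot_group l)) \<and>
                    (\<forall>l l'. l \<le> l' \<longrightarrow> trunc l (g l') = g l)},
     mult = (\<lambda>g h l. g l \<otimes>\<^bsub>quot_group l\<^esub> h l),
     one = (\<lambda>l. \<one>\<^bsub>quot_group l\<^esub>)\<rparr>"

definition gpow :: "(nat \<Rightarrow> lie) \<Rightarrow> rat \<Rightarrow> nat \<Rightarrow> lie" where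
  "gpow g c = (\<lambda>l. lie_scale c (g l))"

definition dilog :: "nat \<times> nat \<Rightarrow> nat \<Rightarrow> lie" where
  "dilog p = (\<lambda>l. \<Sum>j\<in>{j. 1 \<le> j \<and> j * ndeg p \<le> l}.
      Poly_Mapping.single (j * fst p, j * snd p) ((-1) ^ (j + 1) / of_nat j ^ 2))"

definition nle :: "nat \<times> nat \<Rightarrow> nat \<times> nat \<Rightarrow> bool" where
  "nle p q \<longleftrightarrow> form p q < 0 \<or>
    (\<exists>k::rat. k \<ge> 1 \<and> of_nat (fst q) = k * of_nat (fst p) \<and> of_nat (snd q) = k * of_nat (snd p))"

definition nless :: "nat \<times> nat \<Rightarrow> nat \<times> nat \<Rightarrow> bool" where
  "nless p q \<longleftrightarrow> nle p q \<and> p \<noteq> q"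

definition increasing_list :: "(nat \<times> nat) set \<Rightarrow> (nat \<times> nat) list" where
  "increasing_list S = (THE ps. sorted_wrt nless ps \<and> set ps = S)"

text \<open>The ordered product of all \<open>[p]\<^bsup>u p\<^esup>\<close>, \<open>p \<in> Nplus\<close>: the factors with \<open>ndeg p > l\<close> are
  trivial in the quotient of level \<open>l\<close>, so each projection is a finite product.\<close>

definition ordered_product :: "(nat \<times> nat \<Rightarrow> rat) \<Rightarrow> nat \<Rightarrow> lie" where
  "ordered_product u = (\<lambda>l.
    foldr (\<lambda>p g. gpow (dilog p) (u p) l \<otimes>\<^bsub>quot_group l\<^esub> g)
      (increasing_list {p \<in> Nplus. ndeg p \<le> l}) \<one>\<^bsub>quot_group l\<^esub>)"

text \<open>The exponents form a function on \<open>Nplus\<close>; its extension to \<open>(0, 0)\<close> is normalised to 0 to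
  make it unique as a function on the whole type.\<close>

definition uexp :: "nat \<times> nat \<Rightarrow> nat \<Rightarrow> nat \<Rightarrow> rat" where
  "uexp p m n = (THE u. u (0, 0) = 0 \<and>
      gpow (dilog (0, 1)) (of_nat n) \<otimes>\<^bsub>structure_group\<^esub> gpow (dilog (1, 0)) (of_nat m)
        = ordered_product u) p"

end

theory Submission
  imports Defs "HOL-Computational_Algebra.Formal_Power_Series"
begin

text \<open>
  The Baker--Campbell--Hausdorff product is made accessible by the faithful action of \<open>X\<^sub>n\<close> on monomials by
  \<open>x\<^sup>m \<mapsto> {n, m} x\<^bsup>m + n\<^esup>\<close>, under which \<open>[p]\<^sup>u\<close> becomes \<open>x\<^sup>m \<mapsto> x\<^sup>m (1 + x\<^sup>p)\<^bsup>u {p, m}\<^esup>\<close>. In particular a product of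
  factors \<open>[p]\<^sup>u\<close> with \<open>u gcd(p)\<close> integral acts by integer matrices, and comparing matrix entries degree by degree
  shows that its ordered factorisation again has this integrality.

  For positivity, split \<open>[0,1]\<^sup>n [1,0]\<^sup>m\<close> into \<open>n + m\<close> labelled factors with exponents \<open>0\<close> or \<open>1\<close>, switched on by a
  subset \<open>U\<close> of the labels, and sort the resulting word by exchanging neighbours. Two factors of degree one are
  exchanged by the pentagon relation. If \<open>{q, p} = \<kappa> > 0\<close>, the homomorphism \<open>X\<^bsub>(a,b)\<^esub> \<mapsto> \<kappa>\<^sup>-\<^sup>1 X\<^bsub>ap + bq\<^esub>\<close> exchanges any
  other pair \<open>[q]\<^sup>v [p]\<^sup>u\<close> at the cost of factors \<open>[ap + bq]\<close> with exponents \<open>\<kappa>\<^sup>-\<^sup>1 u\<^bsub>(a,b)\<^esub>(\<kappa>u, \<kappa>v)\<close>; in a fixed truncation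
  only \<open>(a,b)\<close> of smaller degree occur, so induction applies. All exponents that arise are, as functions of
  \<open>U\<close>, nonnegative combinations of the indicators of \<open>S \<subseteq> U\<close>, since such functions are closed under products and
  binomial coefficients. The final coefficients of these indicators are the numbers \<open>\<alpha>(i, j)\<close>, divided by \<open>gcd(a, b)\<close>.
\<close>

section \<open>Power series evaluated at order-raising operators\<close>

text \<open>Nonnegative values of u would not make its coefficients in the basis of binomials
  nonnegative; hence exponents are functions of a label set U instead of numbers. When such a
  function depends only on the sizes of U \<inter> A and U \<inter> B, its coefficient at S is the
  Newton coefficient at the sizes of S \<inter> A and S \<inter> B. These sizes stay bounded by the
  coordinates of the lattice point, which confines i and j to i \<le> a, j \<le> b. The homomorphism
  of a general exchange divides by \<kappa>. Positivity survives this, integrality does not: it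
  comes from the integer matrices, and inversion over subsets carries it from values to
  coefficients. For p and q of degree one, ap + bq has degree a + b, so the general exchange would
  need the very exponents under study. Exponents 0 and 1 reduce this case to the pentagon relation,
  a binomial identity. As the group law is Dynkin's series, it is a theorem that the representation
  turns it into multiplication; the differential equation of log(e^(tX) e^(tY)) yields it.\<close>

definition fps_scale :: "real \<Rightarrow> 'a::real_algebra_1 fps \<Rightarrow> 'a fps" where
  "fps_scale c f = Abs_fps (\<lambda>n. c *\<^sub>R fps_nth f n)"

lemma fps_scale_nth [simp]: "fps_nth (fps_scale c f) n = c *\<^sub>R fps_nth f n"
  by (simp add: fps_scale_def)

definition raising :: "('a::real_algebra_1 fps \<Rightarrow> 'a fps) \<Rightarrow> bool" where
  "raising A \<longleftrightarrow> (\<forall>f g. A (f + g) = A f + A g) \<and> (\<forall>c f. A (fps_scale c f) = fps_scale c (A f)) \<and>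
     (\<forall>f n. (\<forall>i<n. fps_nth f i = 0) \<longrightarrow> (\<forall>i\<le>n. fps_nth (A f) i = 0))"

text \<open>The functional calculus c(A) g. For an order-raising A the series A^k g vanishes below
  degree k, so cutting the sum off at k \<le> n loses nothing in coefficient n.\<close>

definition op_eval :: "real fps \<Rightarrow> ('a::real_algebra_1 fps \<Rightarrow> 'a fps) \<Rightarrow> 'a fps \<Rightarrow> 'a fps" where
  "op_eval c A g = Abs_fps (\<lambda>n. \<Sum>k\<le>n. fps_nth c k *\<^sub>R fps_nth ((A ^^ k) g) n)"

lemma op_eval_nth: "fps_nth (op_eval c A g) n = (\<Sum>k\<le>n. fps_nth c k *\<^sub>R fps_nth ((A ^^ k) g) n)"
  by (simp add: op_eval_def)

context
  fixes A :: "'a::real_algebra_1 fps \<Rightarrow> 'a fps"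
  assumes A: "raising A"
begin

lemma raising_pow_add: "(A ^^ k) (f + g) = (A ^^ k) f + (A ^^ k) g"
  using A by (induction k) (auto simp: raising_def)

lemma raising_pow_scale: "(A ^^ k) (fps_scale c f) = fps_scale c ((A ^^ k) f)"
  using A by (induction k) (auto simp: raising_def)

lemma raising_pow_zero: "(A ^^ k) 0 = 0"
  using raising_pow_add[of k 0 0] by simp

lemma raising_pow_sum: "(A ^^ k) (sum f S) = (\<Sum>i\<in>S. (A ^^ k) (f i))"
  by (induction S rule: infinite_finite_induct) (auto simp: raising_pow_add raising_pow_zero)

lemma raising_pow_vanish:
  assumes "\<forall>i<m. fps_nth f i = 0" "n < m + k"
  shows "fps_nth ((A ^^ k) f) n = 0"
  using assms(2)
proof (induction k arbitrary: n)
  case 0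
  then show ?case using assms by simp
next
  case (Suc k)
  have "\<forall>i<m + k. fps_nth ((A ^^ k) f) i = 0"
    using Suc.IH by blast
  then have "\<forall>i\<le>m + k. fps_nth (A ((A ^^ k) f)) i = 0"
    using A unfolding raising_def by blast
  then show ?case using Suc.prems by simp
qed

lemma raising_pow_nth: "n < k \<Longrightarrow> fps_nth ((A ^^ k) f) n = 0"
  using raising_pow_vanish[of 0 f n k] by simp

lemma op_eval_nth_ge:
  assumes "n \<le> M"
  shows "fps_nth (op_eval c A g) n = (\<Sum>k\<le>M. fps_nth c k *\<^sub>R fps_nth ((A ^^ k) g) n)"
  unfolding op_eval_nth by (rule sum.mono_neutral_left) (use assms in \<open>auto simp: raising_pow_nth\<close>)

lemma raising_pow_cong:
  assumes "\<forall>i\<le>m. fps_nth f i = fps_nth g i"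
  shows "fps_nth ((A ^^ k) f) m = fps_nth ((A ^^ k) g) m"
proof -
  have "fps_nth ((A ^^ k) (f - g)) m = 0"
    by (rule raising_pow_vanish[of "Suc m"]) (use assms in auto)
  moreover have "(A ^^ k) f = (A ^^ k) (f - g) + (A ^^ k) g"
    by (simp flip: raising_pow_add)
  ultimately show ?thesis by simp
qed

lemma raising_pow_op_eval:
  "fps_nth ((A ^^ i) (op_eval d A g)) m = (\<Sum>j\<le>m. fps_nth d j *\<^sub>R fps_nth ((A ^^ (i + j)) g) m)"
proof -
  have "fps_nth ((A ^^ i) (op_eval d A g)) m =
      fps_nth ((A ^^ i) (\<Sum>j\<le>m. fps_scale (fps_nth d j) ((A ^^ j) g))) m"
    by (rule raising_pow_cong) (auto simp: op_eval_nth_ge fps_sum_nth)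
  then show ?thesis
    by (simp add: raising_pow_sum raising_pow_scale fps_sum_nth funpow_add)
qed

text \<open>Both sides collect c_i d_j A^(i+j) g. Terms with i + j > m vanish in coefficient m, so
  the triangle of the Cauchy product may be completed to a square.\<close>

lemma op_eval_mult: "op_eval (c * d) A g = op_eval c A (op_eval d A g)"
proof (rule fps_ext)
  fix m
  let ?a = "\<lambda>k. fps_nth ((A ^^ k) g) m"
  have "fps_nth (op_eval (c * d) A g) m =
      (\<Sum>k\<le>m. \<Sum>i\<le>k. (fps_nth c i * fps_nth d (k - i)) *\<^sub>R ?a k)"
    by (simp add: op_eval_nth fps_mult_nth scaleR_left.sum atMost_atLeast0)
  also have "\<dots> = (\<Sum>k\<le>m. \<Sum>i\<le>k. (fps_nth c i * fps_nth d (k - i)) *\<^sub>R ?a (i + (k - i)))"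
    by (intro sum.cong) auto
  also have "\<dots> = (\<Sum>(i, j)\<in>{(i, j). i + j \<le> m}. (fps_nth c i * fps_nth d j) *\<^sub>R ?a (i + j))"
    by (rule sum.triangle_reindex_eq[symmetric])
  also have "\<dots> = (\<Sum>(i, j)\<in>{..m} \<times> {..m}. (fps_nth c i * fps_nth d j) *\<^sub>R ?a (i + j))"
    by (rule sum.mono_neutral_left) (auto, meson raising_pow_nth not_le)
  also have "\<dots> = (\<Sum>i\<le>m. \<Sum>j\<le>m. (fps_nth c i * fps_nth d j) *\<^sub>R ?a (i + j))"
    by (rule sum.cartesian_product[symmetric])
  also have "\<dots> = fps_nth (op_eval c A (op_eval d A g)) m"
    by (simp add: op_eval_nth raising_pow_op_eval scaleR_right.sum)
  finally show "fps_nth (op_eval (c * d) A g) m = fps_nth (op_eval c A (op_eval d A g)) m" .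
qed

lemma op_eval_1: "op_eval 1 A g = g"
  by (rule fps_ext) (simp add: op_eval_nth if_distrib[of "\<lambda>x. x *\<^sub>R _"] fps_one_nth sum.delta' cong: if_cong)

lemma op_eval_X: "op_eval fps_X A g = A g"
proof (rule fps_ext)
  fix n
  have "fps_nth (op_eval fps_X A g) n = (\<Sum>k\<le>Suc n. (if k = 1 then fps_nth (A g) n else 0))"
    unfolding op_eval_nth_ge[of n "Suc n", OF le_SucI[OF order_refl]]
    by (rule sum.cong) (auto simp: fps_X_def)
  then show "fps_nth (op_eval fps_X A g) n = fps_nth (A g) n" by simp
qed

lemma op_eval_add: "op_eval (c + d) A g = op_eval c A g + op_eval d A g"
  by (rule fps_ext) (simp add: op_eval_nth scaleR_left_distrib sum.distrib)

lemma op_eval_diff: "op_eval (c - d) A g = op_eval c A g - op_eval d A g"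
  by (rule fps_ext) (simp add: op_eval_nth scaleR_left_diff_distrib sum_subtractf)

lemma op_eval_pow: "(op_eval d A ^^ k) g = op_eval (d ^ k) A g"
  by (induction k) (simp_all add: op_eval_1 op_eval_mult)

text \<open>Without a constant term, d^k vanishes below degree k; this makes the double sum
  triangular and identifies its inner sum with a coefficient of c o d.\<close>

lemma op_eval_compose:
  assumes "fps_nth d 0 = 0"
  shows "op_eval c (op_eval d A) g = op_eval (c oo d) A g"
proof (rule fps_ext)
  fix m
  have "fps_nth (op_eval c (op_eval d A) g) m =
      (\<Sum>k\<le>m. \<Sum>n\<le>m. (fps_nth c k * fps_nth (d ^ k) n) *\<^sub>R fps_nth ((A ^^ n) g) m)"
    by (simp add: op_eval_nth op_eval_pow scaleR_right.sum)
  also have "\<dots> = (\<Sum>n\<le>m. \<Sum>k\<le>m. (fps_nth c k * fps_nth (d ^ k) n) *\<^sub>R fps_nth ((A ^^ n) g) m)"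
    by (rule sum.swap)
  also have "\<dots> = (\<Sum>n\<le>m. \<Sum>k\<le>n. (fps_nth c k * fps_nth (d ^ k) n) *\<^sub>R fps_nth ((A ^^ n) g) m)"
    by (intro sum.cong refl sum.mono_neutral_right)
       (auto simp: startsby_zero_power_prefix[OF assms])
  also have "\<dots> = fps_nth (op_eval (c oo d) A g) m"
    by (simp add: op_eval_nth fps_compose_nth scaleR_left.sum atMost_atLeast0)
  finally show "fps_nth (op_eval c (op_eval d A) g) m = fps_nth (op_eval (c oo d) A g) m" .
qed

end

section \<open>The logarithm of a product of exponentials\<close>

lemma fps_scale_simps:
  "fps_scale c (f + g) = fps_scale c f + fps_scale c g"
  "fps_scale c (f - g) = fps_scale c f - fps_scale c g"
  "fps_scale (c + d) f = fps_scale c f + fps_scale d f"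
  "fps_scale c f * g = fps_scale c (f * g)"
  "f * fps_scale c g = fps_scale c (f * g)"
  "fps_scale 1 f = f"
  "fps_scale 0 f = 0"
  by (rule fps_ext; simp add: fps_mult_nth scaleR_right.sum algebra_simps)+

section \<open>Adjoint action and the exponential of a noncommutative series\<close>

definition fps_ad :: "'a::real_algebra_1 fps \<Rightarrow> 'a fps \<Rightarrow> 'a fps" where
  "fps_ad f g = f * g - g * f"

lemma raising_mult:
  assumes "fps_nth f 0 = 0"
  shows "raising ((*) f)"
proof -
  have "fps_nth (f * g) i = 0" if "\<forall>i<n. fps_nth g i = 0" "i \<le> n" for g n i
    unfolding fps_mult_nth
  proof (rule sum.neutral, rule ballI)
    fix j assume "j \<in> {0..i}"
    then show "fps_nth f j * fps_nth g (i - j) = 0"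
      using that assms by (cases "j = 0") auto
  qed
  then show ?thesis
    unfolding raising_def by (auto simp: algebra_simps fps_scale_simps)
qed

lemma raising_ad:
  assumes "fps_nth f 0 = 0"
  shows "raising (fps_ad f)"
proof -
  have "fps_nth (g * f) i = 0" if "\<forall>i<n. fps_nth g i = 0" "i \<le> n" for g n i
    unfolding fps_mult_nth
  proof (rule sum.neutral, rule ballI)
    fix j assume "j \<in> {0..i}"
    then show "fps_nth g j * fps_nth f (i - j) = 0"
      using that assms by (cases "j = i") auto
  qed
  then show ?thesis
    using raising_mult[OF assms]
    unfolding raising_def fps_ad_def by (auto simp: algebra_simps fps_scale_simps)
qed

text \<open>This is e^f for f without constant term over a noncommutative algebra; left
  multiplication by such an f is order-raising.\<close>

definition fps_nexp :: "'a::real_algebra_1 fps \<Rightarrow> 'a fps" where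
  "fps_nexp f = op_eval (fps_exp 1) ((*) f) 1"

lemma mult_pow_eq: "((*) f ^^ k) g = f ^ k * (g::'a::monoid_mult)"
  by (induction k) (simp_all add: mult.assoc)

lemma op_eval_mult_op_eval:
  assumes "raising A" "raising B"
  shows "fps_nth (op_eval c A g * op_eval d B h) m =
    (\<Sum>k\<le>m. \<Sum>j\<le>m. (fps_nth c k * fps_nth d j) *\<^sub>R fps_nth ((A ^^ k) g * (B ^^ j) h) m)"
proof -
  have "fps_nth (op_eval c A g * op_eval d B h) m =
     (\<Sum>i=0..m. (\<Sum>k\<le>m. fps_nth c k *\<^sub>R fps_nth ((A ^^ k) g) i) *
        (\<Sum>j\<le>m. fps_nth d j *\<^sub>R fps_nth ((B ^^ j) h) (m - i)))"
    unfolding fps_mult_nth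
    by (intro sum.cong refl) (simp add: op_eval_nth_ge[OF assms(1), of _ m] op_eval_nth_ge[OF assms(2), of _ m])
  also have "\<dots> = (\<Sum>i=0..m. \<Sum>k\<le>m. \<Sum>j\<le>m. (fps_nth c k * fps_nth d j) *\<^sub>R
      (fps_nth ((A ^^ k) g) i * fps_nth ((B ^^ j) h) (m - i)))"
    by (simp add: sum_product mult.commute)
  also have "\<dots> = (\<Sum>k\<le>m. \<Sum>i=0..m. \<Sum>j\<le>m. (fps_nth c k * fps_nth d j) *\<^sub>R
      (fps_nth ((A ^^ k) g) i * fps_nth ((B ^^ j) h) (m - i)))"
    by (rule sum.swap)
  also have "\<dots> = (\<Sum>k\<le>m. \<Sum>j\<le>m. \<Sum>i=0..m. (fps_nth c k * fps_nth d j) *\<^sub>R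
      (fps_nth ((A ^^ k) g) i * fps_nth ((B ^^ j) h) (m - i)))"
    by (intro sum.cong refl sum.swap)
  also have "\<dots> = (\<Sum>k\<le>m. \<Sum>j\<le>m. (fps_nth c k * fps_nth d j) *\<^sub>R fps_nth ((A ^^ k) g * (B ^^ j) h) m)"
    by (simp add: fps_mult_nth scaleR_right.sum)
  finally show ?thesis .
qed

lemma op_eval_left_mult:
  assumes "fps_nth f 0 = 0"
  shows "op_eval c ((*) f) 1 * g = op_eval c ((*) f) g"
proof (rule fps_ext)
  fix m
  have "fps_nth (op_eval c ((*) f) 1 * op_eval 1 ((*) f) g) m =
      (\<Sum>k\<le>m. \<Sum>j\<le>m. (if j = 0 then fps_nth c k *\<^sub>R fps_nth (f ^ k * g) m else 0))"
    unfolding op_eval_mult_op_eval[OF raising_mult[OF assms] raising_mult[OF assms]]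
    by (intro sum.cong) (auto simp: mult_pow_eq)
  then show "fps_nth (op_eval c ((*) f) 1 * g) m = fps_nth (op_eval c ((*) f) g) m"
    by (simp add: op_eval_1 raising_mult assms op_eval_nth mult_pow_eq)
qed

lemma fps_nexp_mult_nth:
  assumes "fps_nth f 0 = 0"
  shows "fps_nth (fps_nexp f * g) m = (\<Sum>n\<le>m. (1 / fact n) *\<^sub>R fps_nth (f ^ n * g) m)"
  by (simp add: fps_nexp_def op_eval_left_mult assms op_eval_nth mult_pow_eq)

lemma fps_nexp_nth:
  assumes "fps_nth f 0 = 0"
  shows "fps_nth (fps_nexp f) m = (\<Sum>n\<le>m. (1 / fact n) *\<^sub>R fps_nth (f ^ n) m)"
  using fps_nexp_mult_nth[OF assms, of 1] by simp

lemma fps_nexp_nth_0: "fps_nth (fps_nexp f) 0 = 1"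
  by (simp add: fps_nexp_def op_eval_nth)

lemma fps_ad_step: "f * (fps_ad f ^^ k) g = (fps_ad f ^^ Suc k) g + (fps_ad f ^^ k) g * f"
  by (simp add: fps_ad_def)

text \<open>Left multiplication by f is the sum of two commuting operators, ad f and right
  multiplication by f; this is the binomial theorem for that sum, applied to g.\<close>

lemma power_mult_ad:
  "f ^ n * g = (\<Sum>k\<le>n. fps_scale (real (n choose k)) ((fps_ad f ^^ k) g * f ^ (n - k)))"
proof (induction n)
  case 0
  show ?case by (simp add: fps_scale_simps)
next
  case (Suc n)
  let ?a = "\<lambda>k. (fps_ad f ^^ k) g"
  have "f ^ Suc n * g = f * (f ^ n * g)" by (simp add: mult.assoc)
  also have "\<dots> = (\<Sum>k\<le>n. fps_scale (real (n choose k)) (f * ?a k * f ^ (n - k)))"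
    by (simp add: Suc.IH sum_distrib_left fps_scale_simps mult.assoc)
  also have "\<dots> = (\<Sum>k\<le>n. fps_scale (real (n choose k)) (?a (Suc k) * f ^ (n - k))) +
      (\<Sum>k\<le>n. fps_scale (real (n choose k)) (?a k * f ^ (Suc n - k)))"
    unfolding fps_ad_step by (simp add: ring_distribs fps_scale_simps sum.distrib mult.assoc Suc_diff_le)
  also have "(\<Sum>k\<le>n. fps_scale (real (n choose k)) (?a k * f ^ (Suc n - k))) =
      (\<Sum>k\<le>Suc n. fps_scale (real (n choose k)) (?a k * f ^ (Suc n - k)))"
    by (simp add: fps_scale_simps binomial_eq_0)
  also have "\<dots> = g * f ^ Suc n + (\<Sum>k\<le>n. fps_scale (real (n choose Suc k)) (?a (Suc k) * f ^ (n - k)))"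
    by (subst sum.atMost_Suc_shift) (simp add: fps_scale_simps)
  also have "(\<Sum>k\<le>n. fps_scale (real (n choose k)) (?a (Suc k) * f ^ (n - k))) +
      (g * f ^ Suc n + (\<Sum>k\<le>n. fps_scale (real (n choose Suc k)) (?a (Suc k) * f ^ (n - k)))) =
      (\<Sum>k\<le>Suc n. fps_scale (real (Suc n choose k)) (?a k * f ^ (Suc n - k)))"
    by (subst sum.atMost_Suc_shift) (simp add: fps_scale_simps sum.distrib)
  finally show ?case .
qed

text \<open>In (f^n)' = \<Sum> f^i f' f^(n-1-i), moving the powers f^i to the right of f' collects
  \<Sum> (i choose k) = (n choose k+1). The induction does this one factor at a time.\<close>

lemma deriv_power_ad:
  "fps_deriv (f ^ n) =
    (\<Sum>k<n. fps_scale (real (n choose Suc k)) ((fps_ad f ^^ k) (fps_deriv f) * f ^ (n - Suc k)))"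
proof (induction n)
  case 0
  show ?case by simp
next
  case (Suc n)
  let ?a = "\<lambda>k. (fps_ad f ^^ k) (fps_deriv f)"
  have "fps_deriv (f ^ Suc n) = f * fps_deriv (f ^ n) + fps_deriv f * f ^ n" by simp
  also have "f * fps_deriv (f ^ n) = (\<Sum>k<n. fps_scale (real (n choose Suc k)) (f * ?a k * f ^ (n - Suc k)))"
    by (simp only: Suc.IH sum_distrib_left fps_scale_simps mult.assoc)
  also have "\<dots> = (\<Sum>k<n. fps_scale (real (n choose Suc k)) (?a (Suc k) * f ^ (n - Suc k))) +
      (\<Sum>k<n. fps_scale (real (n choose Suc k)) (?a k * f ^ Suc (n - Suc k)))"
    unfolding fps_ad_step by (simp add: ring_distribs fps_scale_simps sum.distrib mult.assoc)
  also have "(\<Sum>k<n. fps_scale (real (n choose Suc k)) (?a k * f ^ Suc (n - Suc k))) =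
      (\<Sum>k<Suc n. fps_scale (real (n choose Suc k)) (?a k * f ^ (Suc n - Suc k)))"
    by (simp add: fps_scale_simps Suc_diff_Suc binomial_eq_0 del: power_Suc)
  also have "(\<Sum>k<n. fps_scale (real (n choose Suc k)) (?a (Suc k) * f ^ (n - Suc k))) +
      (\<Sum>k<Suc n. fps_scale (real (n choose Suc k)) (?a k * f ^ (Suc n - Suc k))) + fps_deriv f * f ^ n =
      (\<Sum>k<Suc n. fps_scale (real (n choose k)) (?a k * f ^ (Suc n - Suc k))) +
      (\<Sum>k<Suc n. fps_scale (real (n choose Suc k)) (?a k * f ^ (Suc n - Suc k)))"
    by (subst (2) sum.lessThan_Suc_shift) (simp add: fps_scale_simps)
  also have "\<dots> = (\<Sum>k<Suc n. fps_scale (real (Suc n choose Suc k)) (?a k * f ^ (Suc n - Suc k)))"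
    by (simp add: fps_scale_simps sum.distrib)
  finally show ?case .
qed

lemma triangle_to_square:
  fixes F :: "nat \<Rightarrow> nat \<Rightarrow> 'b::comm_monoid_add"
  assumes "\<And>k j. k + j > m \<Longrightarrow> F k j = 0"
  shows "(\<Sum>n\<le>m. \<Sum>k\<le>n. F k (n - k)) = (\<Sum>k\<le>m. \<Sum>j\<le>m. F k j)"
proof -
  have "(\<Sum>n\<le>m. \<Sum>k\<le>n. F k (n - k)) = (\<Sum>(k, j)\<in>{(i, j). i + j \<le> m}. F k j)"
    by (rule sum.triangle_reindex_eq[symmetric])
  also have "\<dots> = (\<Sum>(k, j)\<in>{..m} \<times> {..m}. F k j)"
    by (rule sum.mono_neutral_left) (auto, meson assms not_le)
  finally show ?thesis by (simp add: sum.cartesian_product)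
qed

lemma ad_pow_mult_power_nth:
  assumes "fps_nth f 0 = 0" "m < k + j"
  shows "fps_nth ((fps_ad f ^^ k) g * f ^ j) m = 0"
  unfolding fps_mult_nth
proof (rule sum.neutral, rule ballI)
  fix i assume "i \<in> {0..m}"
  then have "i < k \<or> m - i < j" using assms by auto
  then show "fps_nth ((fps_ad f ^^ k) g) i * fps_nth (f ^ j) (m - i) = 0"
    using raising_pow_nth[OF raising_ad[OF assms(1)]] raising_pow_nth[OF raising_mult[OF assms(1)], of "m - i" j 1]
    by (auto simp: mult_pow_eq)
qed

text \<open>This is e^f g e^(-f) = e^(ad f) g without the inverse. Since (n choose k)/n! = 1/(k!
  (n-k)!), the double sum splits into a product of two exponentials.\<close>

lemma fps_nexp_conj:
  assumes "fps_nth f 0 = 0"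
  shows "fps_nexp f * g = op_eval (fps_exp 1) (fps_ad f) g * fps_nexp f"
proof (rule fps_ext)
  fix m
  have "fps_nth (fps_nexp f * g) m = (\<Sum>n\<le>m. \<Sum>k\<le>n. (real (n choose k) / fact n) *\<^sub>R
       fps_nth ((fps_ad f ^^ k) g * f ^ (n - k)) m)"
    unfolding fps_nexp_mult_nth[OF assms] power_mult_ad
    by (simp add: fps_sum_nth scaleR_right.sum)
  also have "\<dots> = (\<Sum>n\<le>m. \<Sum>k\<le>n. (1 / (fact k * fact (n - k))) *\<^sub>R
       fps_nth ((fps_ad f ^^ k) g * f ^ (n - k)) m)"
    by (intro sum.cong refl) (simp add: binomial_fact)
  also have "\<dots> = (\<Sum>k\<le>m. \<Sum>j\<le>m. (1 / (fact k * fact j)) *\<^sub>R fps_nth ((fps_ad f ^^ k) g * f ^ j) m)"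
    by (rule triangle_to_square) (simp add: ad_pow_mult_power_nth assms)
  also have "\<dots> = fps_nth (op_eval (fps_exp 1) (fps_ad f) g * fps_nexp f) m"
    unfolding fps_nexp_def op_eval_mult_op_eval[OF raising_ad[OF assms] raising_mult[OF assms]]
    by (simp add: mult_pow_eq)
  finally show "fps_nth (fps_nexp f * g) m = fps_nth (op_eval (fps_exp 1) (fps_ad f) g * fps_nexp f) m" .
qed

text \<open>The series (e^x - 1)/x.\<close>

definition fps_exp_quotient :: "real fps" where
  "fps_exp_quotient = Abs_fps (\<lambda>k. 1 / fact (Suc k))"

text \<open>The derivative of the exponential map: (e^f)' e^(-f) is (e^z - 1)/z at z = ad f, applied
  to f'.\<close>

lemma deriv_fps_nexp:
  assumes "fps_nth f 0 = 0"
  shows "fps_deriv (fps_nexp f) = op_eval fps_exp_quotient (fps_ad f) (fps_deriv f) * fps_nexp f"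
proof (rule fps_ext)
  fix m
  let ?a = "\<lambda>k. (fps_ad f ^^ k) (fps_deriv f)"
  have "fps_nth (fps_deriv (fps_nexp f)) m = (\<Sum>n\<le>Suc m. (1 / fact n) *\<^sub>R fps_nth (fps_deriv (f ^ n)) m)"
    by (simp only: fps_deriv_nth fps_nexp_nth[OF assms] sum_distrib_left mult_scaleR_right Suc_eq_plus1)
  also have "\<dots> = (\<Sum>n\<le>m. (1 / fact (Suc n)) *\<^sub>R fps_nth (fps_deriv (f ^ Suc n)) m)"
    by (subst sum.atMost_Suc_shift) (simp del: power_Suc fact_Suc)
  also have "\<dots> = (\<Sum>n\<le>m. \<Sum>k\<le>n. (real (Suc n choose Suc k) / fact (Suc n)) *\<^sub>R
       fps_nth (?a k * f ^ (n - k)) m)"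
    unfolding deriv_power_ad lessThan_Suc_atMost
    by (simp add: fps_sum_nth scaleR_right.sum del: fact_Suc binomial_Suc_Suc)
  also have "\<dots> = (\<Sum>n\<le>m. \<Sum>k\<le>n. (1 / (fact (Suc k) * fact (n - k))) *\<^sub>R
       fps_nth (?a k * f ^ (n - k)) m)"
    by (intro sum.cong refl) (simp add: binomial_fact del: fact_Suc binomial_Suc_Suc)
  also have "\<dots> = (\<Sum>k\<le>m. \<Sum>j\<le>m. (1 / (fact (Suc k) * fact j)) *\<^sub>R fps_nth (?a k * f ^ j) m)"
    by (rule triangle_to_square) (simp add: ad_pow_mult_power_nth assms)
  also have "\<dots> = fps_nth (op_eval fps_exp_quotient (fps_ad f) (fps_deriv f) * fps_nexp f) m"
    unfolding fps_nexp_def op_eval_mult_op_eval[OF raising_ad[OF assms] raising_mult[OF assms]]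
    by (simp add: mult_pow_eq fps_exp_quotient_def del: fact_Suc)
  finally show "fps_nth (fps_deriv (fps_nexp f)) m =
    fps_nth (op_eval fps_exp_quotient (fps_ad f) (fps_deriv f) * fps_nexp f) m" .
qed

lemma fps_mult_right_cancel_unit:
  fixes f g e :: "'a::ring_1 fps"
  assumes "f * e = g * e" "fps_nth e 0 = 1"
  shows "f = g"
proof (rule fps_ext)
  fix n
  show "fps_nth f n = fps_nth g n"
  proof (induction n rule: less_induct)
    case (less n)
    have "(\<Sum>i=0..n. fps_nth f i * fps_nth e (n - i)) = (\<Sum>i=0..n. fps_nth g i * fps_nth e (n - i))"
      using assms(1) by (metis fps_mult_nth)
    moreover have "{0..n} = insert n {0..<n}" by auto
    moreover have "(\<Sum>i=0..<n. fps_nth f i * fps_nth e (n - i)) = (\<Sum>i=0..<n. fps_nth g i * fps_nth e (n - i))"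
      by (intro sum.cong) (use less in auto)
    ultimately show ?case using assms(2) by simp
  qed
qed

text \<open>The series ln(1 + x)/x.\<close>

definition fps_ln_quotient :: "real fps" where
  "fps_ln_quotient = Abs_fps (\<lambda>k. (-1) ^ k / real (Suc k))"

lemma fps_exp_minus_1_compose_ln: "(fps_exp 1 - 1) oo fps_ln (1::real) = fps_X"
  using fps_ln_fps_exp_inv[of "1::real"] fps_inv_right[of "fps_exp (1::real) - 1"] by simp

lemma fps_ln_compose_exp_minus_1: "fps_ln (1::real) oo (fps_exp 1 - 1) = fps_X"
  using fps_ln_fps_exp_inv[of "1::real"] fps_inv[of "fps_exp (1::real) - 1"] by simp

text \<open>Substituting y = e^x - 1 turns ln(1 + y)/y into x/(e^x - 1), the reciprocal of
  \<open>fps_exp_quotient\<close>.\<close>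

lemma ln_quotient_mult_exp_quotient:
  "(fps_ln_quotient oo (fps_exp 1 - 1)) * fps_exp_quotient = 1"
proof -
  let ?e = "fps_exp (1::real) - 1"
  have e: "?e = fps_X * fps_exp_quotient"
    by (rule fps_ext) (simp add: fps_exp_quotient_def fact_reduce)
  have "fps_ln 1 = fps_X * fps_ln_quotient"
    by (rule fps_ext) (auto simp: fps_ln_nth fps_ln_quotient_def)
  then have "fps_X = (fps_X * fps_ln_quotient) oo ?e"
    using fps_ln_compose_exp_minus_1 by simp
  also have "\<dots> = ?e * (fps_ln_quotient oo ?e)"
    by (subst fps_compose_mult_distrib) auto
  also have "\<dots> = fps_X * ((fps_ln_quotient oo ?e) * fps_exp_quotient)"
    by (subst (1) e) (simp add: mult_ac)
  finally have "fps_X * ((fps_ln_quotient oo ?e) * fps_exp_quotient) = fps_X * 1"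
    by simp
  then show ?thesis by (simp only: mult_cancel_left fps_X_neq_zero) auto
qed

section \<open>The differential equation of log(e^(tX) e^(tY))\<close>

context
  fixes X Y :: "'a::real_algebra_1"
begin

text \<open>The operator e^(ad tX) e^(ad tY) - 1, with \<open>fps_X\<close> in the role of t. Its
  terms (ad X)^r (ad Y)^s, (r, s) \<noteq> (0, 0), are the blocks of Dynkin's formula.\<close>

definition bch_block :: "'a fps \<Rightarrow> 'a fps" where
  "bch_block g = op_eval (fps_exp 1) (fps_ad (fps_const X * fps_X))
     (op_eval (fps_exp 1) (fps_ad (fps_const Y * fps_X)) g) - g"

text \<open>This is E' E^(-1) for E = e^(tX) e^(tY).\<close>

definition bch_seed :: "'a fps" where
  "bch_seed = op_eval (fps_exp 1) (fps_ad (fps_const X * fps_X)) (fps_const Y) + fps_const X"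

lemma deriv_fps_nexp_linear:
  "fps_deriv (fps_nexp (fps_const X * fps_X)) = fps_const X * fps_nexp (fps_const X * fps_X)"
proof -
  have 0: "fps_ad (fps_const X * fps_X) (fps_const X) = 0"
    by (rule fps_ext) (simp add: fps_ad_def mult.assoc)
  have z: "(fps_ad (fps_const X * fps_X) ^^ k) (fps_const X) = 0" if "k > 0" for k
    using that
  proof (induction k)
    case (Suc k)
    then show ?case by (cases "k = 0") (auto simp: 0, simp add: fps_ad_def)
  qed simp
  have "op_eval fps_exp_quotient (fps_ad (fps_const X * fps_X)) (fps_const X) = fps_const X"
  proof (rule fps_ext)
    fix n
    have "fps_nth (op_eval fps_exp_quotient (fps_ad (fps_const X * fps_X)) (fps_const X)) n =
      (\<Sum>k\<le>n. if k = 0 then fps_nth (fps_const X) n else 0)"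
      unfolding op_eval_nth by (intro sum.cong) (auto simp: z fps_exp_quotient_def)
    then show "fps_nth (op_eval fps_exp_quotient (fps_ad (fps_const X * fps_X)) (fps_const X)) n =
      fps_nth (fps_const X) n" by simp
  qed
  moreover have "fps_deriv (fps_const X * fps_X) = fps_const X" by simp
  ultimately show ?thesis by (subst deriv_fps_nexp) simp_all
qed

end

text \<open>For E = e^W, conjugation gives e^(ad W) = e^(ad tX) e^(ad tY), and differentiation shows
  that (e^z - 1)/z at z = ad W sends W' to \<open>bch_seed\<close>. Its inverse z/(e^z - 1), written
  as ln(1 + y)/y at y = e^z - 1, involves ad W only through the block operator, which is known
  explicitly. So W' is obtained without knowing W.\<close>

lemma log_exp_product:
  fixes X Y :: "'a::real_algebra_1"
  obtains W where "fps_nth W 0 = 0"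
    "fps_nexp W = fps_nexp (fps_const X * fps_X) * fps_nexp (fps_const Y * fps_X)"
    "fps_deriv W = op_eval fps_ln_quotient (bch_block X Y) (bch_seed X Y)"
proof -
  let ?x = "fps_const X * fps_X" and ?y = "fps_const Y * fps_X"
  define E where "E = fps_nexp ?x * fps_nexp ?y"
  have E0: "fps_nth E 0 = 1" by (simp add: E_def fps_nexp_nth_0)
  then have E1: "fps_nth (E - 1) 0 = 0" by simp
  define W where "W = op_eval (fps_ln 1) ((*) (E - 1)) 1"
  have W0: "fps_nth W 0 = 0" by (simp add: W_def op_eval_nth)
  have "(*) W = op_eval (fps_ln 1) ((*) (E - 1))"
    by (rule ext) (simp only: W_def op_eval_left_mult[OF E1])
  then have "fps_nexp W = op_eval (fps_exp 1 oo fps_ln 1) ((*) (E - 1)) 1"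
    by (simp add: fps_nexp_def op_eval_compose[OF raising_mult[OF E1]])
  also have "fps_exp 1 oo fps_ln 1 = 1 + (fps_X :: real fps)"
    using fps_exp_minus_1_compose_ln by (simp add: fps_compose_sub_distrib algebra_simps)
  also have "op_eval \<dots> ((*) (E - 1)) 1 = E"
    using raising_mult[OF E1] by (simp add: op_eval_add op_eval_1 op_eval_X)
  finally have WE: "fps_nexp W = E" .
  have "fps_deriv E = bch_seed X Y * E"
  proof -
    have "fps_deriv E = fps_nexp ?x * fps_const Y * fps_nexp ?y + fps_const X * E"
      by (simp add: E_def deriv_fps_nexp_linear mult.assoc)
    also have "fps_nexp ?x * fps_const Y = op_eval (fps_exp 1) (fps_ad ?x) (fps_const Y) * fps_nexp ?x"
      by (rule fps_nexp_conj) simp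
    finally show ?thesis by (simp add: E_def bch_seed_def algebra_simps)
  qed
  then have "op_eval fps_exp_quotient (fps_ad W) (fps_deriv W) * E = bch_seed X Y * E"
    using deriv_fps_nexp[OF W0] WE by simp
  then have seed: "op_eval fps_exp_quotient (fps_ad W) (fps_deriv W) = bch_seed X Y"
    using E0 by (rule fps_mult_right_cancel_unit)
  have block: "op_eval (fps_exp 1 - 1) (fps_ad W) = bch_block X Y"
  proof
    fix g
    have "op_eval (fps_exp 1) (fps_ad W) g * E = E * g"
      using fps_nexp_conj[OF W0, of g] WE by simp
    also have "\<dots> = fps_nexp ?x * (op_eval (fps_exp 1) (fps_ad ?y) g * fps_nexp ?y)"
      using fps_nexp_conj[of ?y g] by (simp add: E_def mult.assoc)
    also have "\<dots> = op_eval (fps_exp 1) (fps_ad ?x) (op_eval (fps_exp 1) (fps_ad ?y) g) * E"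
      using fps_nexp_conj[of ?x "op_eval (fps_exp 1) (fps_ad ?y) g"]
      by (simp add: E_def mult.assoc[symmetric])
    finally have "op_eval (fps_exp 1) (fps_ad W) g =
        op_eval (fps_exp 1) (fps_ad ?x) (op_eval (fps_exp 1) (fps_ad ?y) g)"
      using E0 by (rule fps_mult_right_cancel_unit)
    then show "op_eval (fps_exp 1 - 1) (fps_ad W) g = bch_block X Y g"
      by (simp add: op_eval_diff op_eval_1 raising_ad W0 bch_block_def)
  qed
  have "op_eval fps_ln_quotient (bch_block X Y) (bch_seed X Y) =
      op_eval ((fps_ln_quotient oo (fps_exp 1 - 1)) * fps_exp_quotient) (fps_ad W) (fps_deriv W)"
    by (simp add: op_eval_mult raising_ad W0 seed op_eval_compose flip: block)
  also have "\<dots> = fps_deriv W"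
    by (simp add: ln_quotient_mult_exp_quotient op_eval_1 raising_ad W0)
  finally show ?thesis using that W0 WE E_def by metis
qed

section \<open>Dynkin's form of the Baker--Campbell--Hausdorff formula\<close>

definition commutator :: "'a::ring \<Rightarrow> 'a \<Rightarrow> 'a" where
  "commutator x y = x * y - y * x"

fun nested_commutator :: "'a::ring list \<Rightarrow> 'a" where
  "nested_commutator [] = 0"
| "nested_commutator [x] = x"
| "nested_commutator (x # y # xs) = commutator x (nested_commutator (y # xs))"

definition bch_word :: "'a \<Rightarrow> 'a \<Rightarrow> (nat \<times> nat) list \<Rightarrow> 'a list" where
  "bch_word X Y rs = concat (map (\<lambda>(r, s). replicate r X @ replicate s Y) rs)"

definition fact_weight :: "(nat \<times> nat) list \<Rightarrow> 'a::field_char_0" where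
  "fact_weight rs = prod_list (map (\<lambda>(r, s). fact r * fact s) rs)"

definition bch_coeff :: "(nat \<times> nat) list \<Rightarrow> 'a::field_char_0" where
  "bch_coeff rs = (-1) ^ (length rs - 1) / (of_nat (length rs) * of_nat (word_length rs) * fact_weight rs)"

definition nilpotent_bch :: "nat \<Rightarrow> 'a \<Rightarrow> 'a \<Rightarrow> 'a::real_algebra_1" where
  "nilpotent_bch l X Y = (\<Sum>rs\<in>bch_index l. bch_coeff rs *\<^sub>R nested_commutator (bch_word X Y rs))"

definition nilpotent_exp :: "nat \<Rightarrow> 'a \<Rightarrow> 'a::real_algebra_1" where
  "nilpotent_exp l z = (\<Sum>i\<le>l. (1 / fact i) *\<^sub>R z ^ i)"

definition index_lists :: "nat \<Rightarrow> nat \<Rightarrow> (nat \<times> nat) list set" where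
  "index_lists k n = {rs. length rs = k \<and> (\<forall>(r, s)\<in>set rs. r + s > 0) \<and> word_length rs = n}"

lemma commutator_pow_scale: "(commutator X ^^ k) (c *\<^sub>R y) = c *\<^sub>R (commutator X ^^ k) (y::'a::real_algebra_1)"
  by (induction k) (simp_all add: commutator_def scaleR_right_diff_distrib)

lemma commutator_pow_sum: "(commutator X ^^ k) (sum f S) = (\<Sum>i\<in>S. (commutator X ^^ k) (f i))"
  by (induction k) (simp_all add: commutator_def sum_distrib_left sum_distrib_right sum_subtractf)

lemma nested_commutator_replicate:
  "w \<noteq> [] \<Longrightarrow> nested_commutator (replicate r x @ w) = (commutator x ^^ r) (nested_commutator w)"
proof (induction r)
  case (Suc r)
  then obtain z zs where "replicate r x @ w = z # zs" by (cases "replicate r x @ w") auto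
  with Suc show ?case by simp
qed simp

lemma nested_commutator_replicate_zero: "s \<ge> 2 \<Longrightarrow> nested_commutator (replicate s x) = 0"
proof (induction s)
  case (Suc s)
  then show ?case
    by (cases s rule: nat.exhaust; cases "s = 1") (auto simp: commutator_def numeral_2_eq_2)
qed simp

lemma fps_ad_linear_pow_nth:
  "fps_nth ((fps_ad (fps_const X * fps_X) ^^ r) g) n =
    (if r \<le> n then (commutator X ^^ r) (fps_nth g (n - r)) else 0)"
proof (induction r arbitrary: n)
  case (Suc r)
  have step: "fps_nth (fps_ad (fps_const X * fps_X) h) m =
      (if m = 0 then 0 else commutator X (fps_nth h (m - 1)))" for h m
    by (simp add: fps_ad_def commutator_def mult.assoc fps_mult_fps_X_commute[symmetric])
       (simp add: mult.assoc[symmetric])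
  have "commutator X 0 = 0" by (simp add: commutator_def)
  then show ?case using Suc.IH[of "n - 1"] by (cases n) (auto simp: step)
qed simp

lemma op_eval_exp_linear_nth:
  "fps_nth (op_eval (fps_exp 1) (fps_ad (fps_const X * fps_X)) g) n =
    (\<Sum>r\<le>n. (1 / fact r) *\<^sub>R (commutator X ^^ r) (fps_nth g (n - r)))"
  by (simp add: op_eval_nth fps_ad_linear_pow_nth)

lemma bch_block_nth:
  "fps_nth (bch_block X Y g) n = (\<Sum>(r, s)\<in>{(r, s). 0 < r + s \<and> r + s \<le> n}.
     (1 / (fact r * fact s)) *\<^sub>R (commutator X ^^ r) ((commutator Y ^^ s) (fps_nth g (n - r - s))))"
proof -
  let ?T = "\<lambda>r s. (1 / (fact r * fact s)) *\<^sub>R (commutator X ^^ r) ((commutator Y ^^ s) (fps_nth g (n - r - s)))"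
  have fin: "finite {(r, s). r + s \<le> n}"
    by (rule finite_subset[of _ "{..n} \<times> {..n}"]) auto
  have "fps_nth (bch_block X Y g) n = (\<Sum>r\<le>n. \<Sum>s\<le>n - r. ?T r s) - fps_nth g n"
    by (simp add: bch_block_def op_eval_exp_linear_nth commutator_pow_sum commutator_pow_scale
        scaleR_right.sum)
  also have "(\<Sum>r\<le>n. \<Sum>s\<le>n - r. ?T r s) = (\<Sum>(r, s)\<in>(SIGMA r:{..n}. {..n - r}). ?T r s)"
    by (rule sum.Sigma) auto
  also have "(SIGMA r:{..n}. {..n - r}) = {(r, s). r + s \<le> n}" by auto
  also have "{(r, s). r + s \<le> n} = insert (0, 0) {(r, s). 0 < r + s \<and> r + s \<le> n}" by auto
  also have "(\<Sum>(r, s)\<in>\<dots>. ?T r s) = fps_nth g n +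
      (\<Sum>(r, s)\<in>{(r, s). 0 < r + s \<and> r + s \<le> n}. ?T r s)"
    by (subst sum.insert) (auto intro: finite_subset[OF _ fin])
  finally show ?thesis by simp
qed

lemma word_length_Cons [simp]: "word_length ((r, s) # rs) = r + s + word_length rs"
  by (simp add: word_length_def)

lemma word_length_Nil [simp]: "word_length [] = 0"
  by (simp add: word_length_def)

lemma fact_weight_Cons [simp]: "fact_weight ((r, s) # rs) = fact r * fact s * fact_weight rs"
  by (simp add: fact_weight_def)

lemma fact_weight_Nil [simp]: "fact_weight [] = 1"
  by (simp add: fact_weight_def)

lemma bch_word_Cons: "bch_word X Y ((r, s) # rs) = replicate r X @ replicate s Y @ bch_word X Y rs"
  by (simp add: bch_word_def)

lemma bch_word_Nil [simp]: "bch_word X Y [] = []"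
  by (simp add: bch_word_def)

lemma length_bch_word: "length (bch_word X Y rs) = word_length rs"
  by (induction rs) (auto simp: bch_word_Cons)

lemma nested_commutator_bch_word_Cons:
  assumes "word_length rs > 0"
  shows "nested_commutator (bch_word X Y ((r, s) # rs)) =
    (commutator X ^^ r) ((commutator Y ^^ s) (nested_commutator (bch_word X Y rs)))"
proof -
  have "bch_word X Y rs \<noteq> []" using assms length_bch_word[of X Y rs] by auto
  then show ?thesis by (simp add: bch_word_Cons nested_commutator_replicate)
qed

lemma finite_index_lists: "finite (index_lists k n)"
proof (rule finite_subset)
  show "index_lists k n \<subseteq> insert [] (bch_index n)"
    by (auto simp: index_lists_def bch_index_def)
qed (simp add: finite_bch_index)

lemma index_lists_Suc:
  "index_lists (Suc (Suc k)) (Suc n) = (\<lambda>((r, s), rs). (r, s) # rs) `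
    (SIGMA (r, s):{(r, s). 0 < r + s \<and> r + s \<le> n}. index_lists (Suc k) (Suc (n - r - s)))"
  (is "?L = ?R")
proof
  show "?R \<subseteq> ?L" by (auto simp: index_lists_def)
  show "?L \<subseteq> ?R"
  proof
    fix rs assume rs: "rs \<in> ?L"
    then obtain r s r' s' rs'' where eq: "rs = (r, s) # (r', s') # rs''"
      by (auto simp: index_lists_def length_Suc_conv)
    then have "((r, s), (r', s') # rs'') \<in>
      (SIGMA (r, s):{(r, s). 0 < r + s \<and> r + s \<le> n}. index_lists (Suc k) (Suc (n - r - s)))"
      using rs by (auto simp: index_lists_def)
    then show "rs \<in> ?R" using eq by force
  qed
qed

text \<open>Among the words X^r Y^s of one block, all but X^n Y and the single letter X have
  vanishing nested commutator, and these two are the terms of the seed. Coefficient n belongs to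
  words of length n + 1 because E' E^(-1) is a derivative.\<close>

lemma bch_seed_nth:
  "fps_nth (bch_seed X Y) n = (\<Sum>rs\<in>index_lists (Suc 0) (Suc n).
     (1 / fact_weight rs) *\<^sub>R nested_commutator (bch_word X Y rs))"
proof -
  let ?T = "\<lambda>rs. (1 / fact_weight rs) *\<^sub>R nested_commutator (bch_word X Y rs)"
  have I: "index_lists (Suc 0) (Suc n) = (\<lambda>r. [(r, Suc n - r)]) ` {..Suc n}"
    by (auto simp: index_lists_def length_Suc_conv image_iff)
  have "sum ?T (index_lists (Suc 0) (Suc n)) = (\<Sum>r\<le>Suc n. ?T [(r, Suc n - r)])"
    unfolding I by (subst sum.reindex) (auto simp: inj_on_def)
  also have "\<dots> = (\<Sum>r<n. ?T [(r, Suc n - r)]) + ?T [(n, 1)] + ?T [(Suc n, 0)]"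
    by (simp add: lessThan_Suc_atMost[symmetric])
  also have "(\<Sum>r<n. ?T [(r, Suc n - r)]) = 0"
  proof (rule sum.neutral, rule ballI)
    fix r assume r: "r \<in> {..<n}"
    have "(commutator X ^^ r) (0::'a) = 0"
      using commutator_pow_scale[of r X 0 0] by simp
    moreover have "nested_commutator (bch_word X Y [(r, Suc n - r)]) =
      (commutator X ^^ r) (nested_commutator (replicate (Suc n - r) Y))"
      unfolding bch_word_Cons using r by (subst nested_commutator_replicate) auto
    ultimately show "?T [(r, Suc n - r)] = 0"
      using r nested_commutator_replicate_zero[of "Suc n - r" Y] by simp
  qed
  also have "?T [(n, 1)] = (1 / fact n) *\<^sub>R (commutator X ^^ n) Y"
    by (simp add: bch_word_Cons nested_commutator_replicate)
  also have "?T [(Suc n, 0)] = (if n = 0 then X else 0)"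
    using nested_commutator_replicate_zero[of "Suc n" X]
    by (auto simp: bch_word_Cons simp del: replicate_Suc nested_commutator.simps) (simp add: numeral_2_eq_2)+
  also have "0 + (1 / fact n) *\<^sub>R (commutator X ^^ n) Y + (if n = 0 then X else 0) =
    fps_nth (bch_seed X Y) n"
  proof -
    have "(commutator X ^^ r) (if n - r = 0 then Y else 0) = (if r = n then (commutator X ^^ n) Y else 0)"
      if "r \<le> n" for r
      using that commutator_pow_scale[of r X 0 0] by auto
    then have "(\<Sum>r\<le>n. (1 / fact r) *\<^sub>R (commutator X ^^ r) (if n - r = 0 then Y else 0)) =
       (\<Sum>r\<le>n. if r = n then (1 / fact n) *\<^sub>R (commutator X ^^ n) Y else 0)"
      by (intro sum.cong) auto
    then show ?thesis
      by (simp add: bch_seed_def op_eval_exp_linear_nth)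
  qed
  finally show ?thesis ..
qed

text \<open>Each application of the block operator prepends one pair (r, s) to the word; the seed
  supplies the last pair.\<close>

lemma bch_block_pow_seed_nth:
  "fps_nth ((bch_block X Y ^^ k) (bch_seed X Y)) n = (\<Sum>rs\<in>index_lists (Suc k) (Suc n).
     (1 / fact_weight rs) *\<^sub>R nested_commutator (bch_word X Y rs))"
proof (induction k arbitrary: n)
  case 0
  show ?case by (simp add: bch_seed_nth)
next
  case (Suc k)
  let ?T = "\<lambda>rs. (1 / fact_weight rs) *\<^sub>R nested_commutator (bch_word X Y rs)"
  let ?P = "{(r, s). 0 < r + s \<and> r + s \<le> n}"
  have fin: "finite ?P"
    by (rule finite_subset[of _ "{..n} \<times> {..n}"]) auto
  have "fps_nth ((bch_block X Y ^^ Suc k) (bch_seed X Y)) n =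
     (\<Sum>(r, s)\<in>?P. \<Sum>rs\<in>index_lists (Suc k) (Suc (n - r - s)). ?T ((r, s) # rs))"
    unfolding funpow.simps o_apply bch_block_nth Suc.IH
    by (intro sum.cong refl)
       (auto simp: commutator_pow_sum commutator_pow_scale scaleR_right.sum nested_commutator_bch_word_Cons
         index_lists_def intro!: sum.cong)
  also have "\<dots> = (\<Sum>p\<in>?P. \<Sum>rs\<in>index_lists (Suc k) (Suc (n - fst p - snd p)). ?T (p # rs))"
    by (intro sum.cong) auto
  also have "\<dots> = (\<Sum>(p, rs)\<in>(SIGMA p:?P. index_lists (Suc k) (Suc (n - fst p - snd p))). ?T (p # rs))"
    using fin finite_index_lists by (subst sum.Sigma) auto
  also have "\<dots> = (\<Sum>rs\<in>index_lists (Suc (Suc k)) (Suc n). ?T rs)"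
    unfolding index_lists_Suc
    by (subst sum.reindex) (auto simp: inj_on_def case_prod_unfold)
  finally show ?case .
qed

lemma length_le_word_length: "\<forall>(r, s)\<in>set rs. r + s > 0 \<Longrightarrow> length rs \<le> word_length rs"
  by (induction rs) auto

section \<open>Evaluation at t = 1 in a nilpotent algebra\<close>

locale nilpotent_filtration =
  fixes J :: "nat \<Rightarrow> 'a::real_algebra_1 set" and l :: nat
  assumes J_zero: "0 \<in> J i"
    and J_add: "x \<in> J i \<Longrightarrow> y \<in> J i \<Longrightarrow> x + y \<in> J i"
    and J_scale: "x \<in> J i \<Longrightarrow> c *\<^sub>R x \<in> J i"
    and J_mult: "i > 0 \<Longrightarrow> j > 0 \<Longrightarrow> x \<in> J i \<Longrightarrow> y \<in> J j \<Longrightarrow> x * y \<in> J (i + j)"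
    and J_anti: "x \<in> J (Suc i) \<Longrightarrow> x \<in> J i"
    and J_top: "i > l \<Longrightarrow> x \<in> J i \<Longrightarrow> x = 0"
begin

lemma J_sum: "(\<And>x. x \<in> S \<Longrightarrow> f x \<in> J i) \<Longrightarrow> sum f S \<in> J i"
  by (induction S rule: infinite_finite_induct) (auto intro: J_zero J_add)

lemma J_minus: "x \<in> J i \<Longrightarrow> - x \<in> J i"
  using J_scale[of x i "-1"] by simp

lemma J_diff: "x \<in> J i \<Longrightarrow> y \<in> J i \<Longrightarrow> x - y \<in> J i"
  using J_add[of x i "- y"] J_minus by simp

lemma nested_commutator_J:
  "set ws \<subseteq> J 1 \<Longrightarrow> ws \<noteq> [] \<Longrightarrow> nested_commutator ws \<in> J (length ws)"
proof (induction ws rule: nested_commutator.induct)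
  case (3 x y xs)
  then have n: "nested_commutator (y # xs) \<in> J (length (y # xs))" "x \<in> J 1" by auto
  have "x * nested_commutator (y # xs) \<in> J (1 + length (y # xs))"
    by (rule J_mult[OF _ _ n(2) n(1)]) simp_all
  moreover have "nested_commutator (y # xs) * x \<in> J (length (y # xs) + 1)"
    by (rule J_mult[OF _ _ n(1) n(2)]) simp_all
  ultimately show ?case by (simp add: commutator_def J_diff)
qed auto

text \<open>The coefficient of t^n lies in \<open>J n\<close>, hence vanishes for n > l. Such series
  can be evaluated at t = 1 by a sum up to l, and this evaluation is multiplicative.\<close>

definition homogeneous :: "'a fps \<Rightarrow> bool" where
  "homogeneous f \<longleftrightarrow> fps_nth f 0 = 0 \<and> (\<forall>n>0. fps_nth f n \<in> J n)"

lemma homogeneous_nth: "homogeneous f \<Longrightarrow> n > l \<Longrightarrow> fps_nth f n = 0"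
  unfolding homogeneous_def using J_top by (cases n) auto

lemma homogeneous_mult:
  assumes "homogeneous f" "homogeneous g"
  shows "homogeneous (f * g)"
proof -
  have "fps_nth f i * fps_nth g (n - i) \<in> J n" if "i \<le> n" for i n
  proof (cases "i = 0 \<or> i = n")
    case True
    then show ?thesis using assms by (auto simp: homogeneous_def J_zero)
  next
    case False
    then have "fps_nth f i * fps_nth g (n - i) \<in> J (i + (n - i))"
      using assms that by (intro J_mult) (auto simp: homogeneous_def)
    then show ?thesis using that by simp
  qed
  then show ?thesis
    using assms unfolding homogeneous_def by (auto simp: fps_mult_nth intro!: J_sum)
qed

lemma homogeneous_power: "homogeneous f \<Longrightarrow> i > 0 \<Longrightarrow> homogeneous (f ^ i)"
proof (induction i)
  case (Suc i)
  then show ?case by (cases "i = 0") (auto intro: homogeneous_mult)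
qed simp

lemma eval_mult:
  fixes f g :: "'a fps"
  assumes "\<And>n. n > l \<Longrightarrow> fps_nth f n = 0" "\<And>n. n > l \<Longrightarrow> fps_nth g n = 0"
    "\<And>n. n > l \<Longrightarrow> fps_nth (f * g) n = 0"
  shows "(\<Sum>n\<le>l. fps_nth (f * g) n) = (\<Sum>n\<le>l. fps_nth f n) * (\<Sum>n\<le>l. fps_nth g n)"
proof -
  let ?m = "l + l"
  have "(\<Sum>n\<le>l. fps_nth f n) * (\<Sum>n\<le>l. fps_nth g n) =
      (\<Sum>(i, j)\<in>{..l} \<times> {..l}. fps_nth f i * fps_nth g j)"
    by (simp add: sum_product sum.cartesian_product)
  also have "\<dots> = (\<Sum>(i, j)\<in>{(i, j). i + j \<le> ?m}. fps_nth f i * fps_nth g j)"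
  proof (rule sum.mono_neutral_left)
    show "finite {(i, j). i + j \<le> ?m}"
      by (rule finite_subset[of _ "{..?m} \<times> {..?m}"]) auto
  qed (auto, metis assms(1) mult_zero_left not_le, metis assms(2) mult_zero_right not_le)
  also have "\<dots> = (\<Sum>n\<le>?m. \<Sum>i\<le>n. fps_nth f i * fps_nth g (n - i))"
    by (rule sum.triangle_reindex_eq)
  also have "\<dots> = (\<Sum>n\<le>?m. fps_nth (f * g) n)"
    by (simp add: fps_mult_nth atMost_atLeast0)
  also have "\<dots> = (\<Sum>n\<le>l. fps_nth (f * g) n)"
    by (rule sum.mono_neutral_right) (auto simp: assms(3))
  finally show ?thesis ..
qed

lemma eval_power:
  assumes "homogeneous f"
  shows "(\<Sum>n\<le>l. fps_nth (f ^ i) n) = (\<Sum>n\<le>l. fps_nth f n) ^ i"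
proof (induction i)
  case 0
  have "(\<Sum>n\<le>l. fps_nth 1 n) = (\<Sum>n\<le>l. if n = 0 then 1 else (0::'a))"
    by (intro sum.cong) auto
  then show ?case by simp
next
  case (Suc i)
  show ?case
  proof (cases "i = 0")
    case False
    then have "homogeneous (f ^ i)" "homogeneous (f ^ Suc i)"
      using assms by (auto intro!: homogeneous_power simp del: power_Suc)
    then have "(\<Sum>n\<le>l. fps_nth (f * f ^ i) n) = (\<Sum>n\<le>l. fps_nth f n) * (\<Sum>n\<le>l. fps_nth (f ^ i) n)"
      using assms by (intro eval_mult) (auto intro: homogeneous_nth)
    then show ?thesis using Suc by simp
  qed simp
qed

lemma eval_fps_nexp:
  assumes "homogeneous f"
  shows "(\<Sum>n\<le>l. fps_nth (fps_nexp f) n) = nilpotent_exp l (\<Sum>n\<le>l. fps_nth f n)"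
proof -
  have 0: "fps_nth f 0 = 0" using assms by (simp add: homogeneous_def)
  have "(\<Sum>n\<le>l. fps_nth (fps_nexp f) n) = (\<Sum>n\<le>l. \<Sum>i\<le>l. (1 / fact i) *\<^sub>R fps_nth (f ^ i) n)"
    by (intro sum.cong refl)
       (simp add: fps_nexp_def op_eval_nth_ge[OF raising_mult[OF 0], of _ l] mult_pow_eq)
  also have "\<dots> = (\<Sum>i\<le>l. \<Sum>n\<le>l. (1 / fact i) *\<^sub>R fps_nth (f ^ i) n)"
    by (rule sum.swap)
  also have "\<dots> = nilpotent_exp l (\<Sum>n\<le>l. fps_nth f n)"
    by (simp add: nilpotent_exp_def eval_power[OF assms, symmetric] scaleR_right.sum)
  finally show ?thesis .
qed

lemma fps_nexp_nth_top:
  assumes "homogeneous f" "n > l"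
  shows "fps_nth (fps_nexp f) n = 0"
proof -
  have "fps_nth (f ^ i) n = 0" for i
    using homogeneous_nth[OF homogeneous_power[OF assms(1)], of i n] assms(2) by (cases "i = 0") auto
  moreover have "fps_nth f 0 = 0" using assms by (simp add: homogeneous_def)
  ultimately show ?thesis by (simp add: fps_nexp_nth)
qed

lemma homogeneous_linear: "X \<in> J 1 \<Longrightarrow> homogeneous (fps_const X * fps_X)"
  by (auto simp: homogeneous_def fps_X_def J_zero)

lemma eval_linear: "X \<in> J 1 \<Longrightarrow> (\<Sum>n\<le>l. fps_nth (fps_const X * fps_X) n) = X"
proof -
  assume X: "X \<in> J 1"
  have "(\<Sum>n\<le>l. fps_nth (fps_const X * fps_X) n) = (\<Sum>n\<le>l. if n = 1 then X else 0)"
    by (intro sum.cong) (auto simp: fps_X_def)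
  also have "\<dots> = X" using J_top[OF _ X] by (cases "l = 0") auto
  finally show ?thesis .
qed

text \<open>If x - y lies in \<open>J (n+1)\<close>, then x^i - y^i lies in \<open>J (n+2)\<close>
  for all i \<ge> 2. Equal exponentials therefore push x - y one step deeper, and finally beyond
  l.\<close>

lemma nilpotent_exp_inj:
  assumes x: "x \<in> J 1" and y: "y \<in> J 1" and eq: "nilpotent_exp l x = nilpotent_exp l y"
  shows "x = y"
proof -
  have pow: "y ^ Suc i \<in> J 1" for i
  proof (induction i)
    case (Suc i)
    then have "y * y ^ Suc i \<in> J (1 + 1)" using y by (intro J_mult) auto
    then show ?case using J_anti by simp
  qed (use y in simp)
  have "x - y \<in> J (Suc n)" for n
  proof (induction n)
    case 0
    show ?case using x y J_diff by simp
  next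
    case (Suc n)
    have step: "x ^ Suc (Suc i) - y ^ Suc (Suc i) \<in> J (Suc (Suc n)) \<and> x ^ Suc i - y ^ Suc i \<in> J (Suc n)" for i
    proof (induction i)
      case 0
      have "x * (x - y) \<in> J (1 + Suc n)" "(x - y) * y \<in> J (Suc n + 1)"
        using Suc x y by (auto intro!: J_mult simp del: One_nat_def add_Suc add_Suc_right)
      then have "x * (x - y) + (x - y) * y \<in> J (Suc (Suc n))" using J_add by simp
      then show ?case using Suc by (simp add: algebra_simps)
    next
      case (Suc i)
      have "x * (x ^ Suc (Suc i) - y ^ Suc (Suc i)) \<in> J (1 + Suc n)"
        "(x - y) * y ^ Suc (Suc i) \<in> J (Suc n + 1)"
        using Suc x \<open>x - y \<in> J (Suc n)\<close> pow[of "Suc i"] J_anti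
        by (auto intro!: J_mult simp del: One_nat_def add_Suc add_Suc_right power_Suc)
      then have "x * (x ^ Suc (Suc i) - y ^ Suc (Suc i)) + (x - y) * y ^ Suc (Suc i) \<in> J (Suc (Suc n))"
        using J_add by simp
      moreover have "x * (x ^ Suc (Suc i) - y ^ Suc (Suc i)) + (x - y) * y ^ Suc (Suc i) =
        x ^ Suc (Suc (Suc i)) - y ^ Suc (Suc (Suc i))"
        by (simp add: algebra_simps)
      ultimately show ?case using Suc J_anti by simp
    qed
    show ?case
    proof (cases "l = 0")
      case True
      then show ?thesis using J_top[of 1 x] J_top[of 1 y] x y J_zero by simp
    next
      case False
      then obtain l' where l: "l = Suc l'" by (cases l) auto
      let ?e = "\<lambda>z. \<Sum>i<l'. (1 / fact (Suc (Suc i))) *\<^sub>R z ^ Suc (Suc i)"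
      have "nilpotent_exp l z = 1 + z + ?e z" for z :: 'a
        unfolding nilpotent_exp_def l lessThan_Suc_atMost[symmetric]
        by (simp add: sum.lessThan_Suc_shift del: sum.lessThan_Suc power_Suc fact_Suc)
      then have "x - y = - (?e x - ?e y)" using eq by (simp add: algebra_simps)
      also have "\<dots> = - (\<Sum>i<l'. (1 / fact (Suc (Suc i))) *\<^sub>R (x ^ Suc (Suc i) - y ^ Suc (Suc i)))"
        by (simp add: sum_subtractf scaleR_right_diff_distrib)
      also have "\<dots> \<in> J (Suc (Suc n))"
        using step by (intro J_minus J_sum J_scale) blast
      finally show ?thesis .
    qed
  qed
  from this[of l] show ?thesis using J_top[of "Suc l" "x - y"] by simp
qed

text \<open>The identity e^W = e^(tX) e^(tY) is evaluated at t = 1. The coefficient of t^n in W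
  consists of brackets of n factors, so W is homogeneous and W(1) is the truncated Dynkin
  sum.\<close>

theorem exp_bch:
  assumes X: "X \<in> J 1" and Y: "Y \<in> J 1"
  shows "nilpotent_exp l (nilpotent_bch l X Y) = nilpotent_exp l X * nilpotent_exp l Y"
proof -
  let ?T = "\<lambda>rs. bch_coeff rs *\<^sub>R nested_commutator (bch_word X Y rs)"
  obtain W where W0: "fps_nth W 0 = 0"
    and WE: "fps_nexp W = fps_nexp (fps_const X * fps_X) * fps_nexp (fps_const Y * fps_X)"
    and dW: "fps_deriv W = op_eval fps_ln_quotient (bch_block X Y) (bch_seed X Y)"
    by (rule log_exp_product)
  \<comment> \<open>Coefficient n of W' is (n + 1) times coefficient n + 1 of W, whence the factor
    \<open>word_length rs\<close> in Dynkin's denominator; the sign and the factor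
    \<open>length rs\<close> come from (-1)^k/(k + 1) in ln(1 + y)/y.\<close>
  have W_nth: "fps_nth W (Suc n) = (\<Sum>k\<le>n. \<Sum>rs\<in>index_lists (Suc k) (Suc n). ?T rs)" for n
  proof -
    have "real (Suc n) *\<^sub>R fps_nth W (Suc n) = fps_nth (fps_deriv W) n"
      by (simp add: scaleR_conv_of_real)
    also have "\<dots> = (\<Sum>k\<le>n. ((-1) ^ k / real (Suc k)) *\<^sub>R (\<Sum>rs\<in>index_lists (Suc k) (Suc n).
       (1 / fact_weight rs) *\<^sub>R nested_commutator (bch_word X Y rs)))"
      by (simp add: dW op_eval_nth bch_block_pow_seed_nth fps_ln_quotient_def)
    also have "\<dots> = real (Suc n) *\<^sub>R (\<Sum>k\<le>n. \<Sum>rs\<in>index_lists (Suc k) (Suc n). ?T rs)"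
      by (auto simp: scaleR_right.sum index_lists_def bch_coeff_def simp del: of_nat_Suc intro!: sum.cong)
    finally show ?thesis by (simp del: of_nat_Suc)
  qed
  have W_J: "fps_nth W n \<in> J n" if "n > 0" for n
  proof -
    have "nested_commutator (bch_word X Y rs) \<in> J n" if "rs \<in> index_lists (Suc k) n" for rs k
    proof -
      have len: "length (bch_word X Y rs) = n" using that by (simp add: length_bch_word index_lists_def)
      then have "bch_word X Y rs \<noteq> []" using \<open>n > 0\<close> by auto
      moreover have "set (bch_word X Y rs) \<subseteq> J 1" using X Y by (auto simp: bch_word_def)
      ultimately show ?thesis using nested_commutator_J[of "bch_word X Y rs"] len by simp
    qed
    then show ?thesis using that by (cases n) (auto simp: W_nth intro!: J_sum J_scale)
  qed
  then have hW: "homogeneous W" using W0 by (simp add: homogeneous_def)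
  have "(\<Sum>n\<le>l. fps_nth W n) = nilpotent_bch l X Y"
  proof -
    have idx: "bch_index l = (\<Union>n\<in>{1..l}. \<Union>k<n. index_lists (Suc k) n)" (is "?L = ?R")
    proof
      show "?L \<subseteq> ?R"
      proof
        fix rs assume rs: "rs \<in> ?L"
        then have "length rs \<le> word_length rs" "length rs > 0"
          by (auto simp: bch_index_def intro!: length_le_word_length)
        then have "length rs - 1 < word_length rs" "word_length rs \<ge> 1"
          "rs \<in> index_lists (Suc (length rs - 1)) (word_length rs)"
          using rs by (auto simp: bch_index_def index_lists_def simp del: length_greater_0_conv)
        moreover have "word_length rs \<le> l" using rs by (simp add: bch_index_def)
        ultimately have "rs \<in> index_lists (Suc (length rs - 1)) (word_length rs)"
          "length rs - 1 < word_length rs" "word_length rs \<in> {1..l}" by auto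
        then show "rs \<in> ?R" by blast
      qed
      show "?R \<subseteq> ?L" by (auto simp: bch_index_def index_lists_def)
    qed
    have "nilpotent_bch l X Y = (\<Sum>n\<in>{1..l}. sum ?T (\<Union>k<n. index_lists (Suc k) n))"
      unfolding nilpotent_bch_def idx
      by (rule sum.UNION_disjoint) (auto simp: finite_index_lists, (auto simp: index_lists_def))
    also have "\<dots> = (\<Sum>n\<in>{1..l}. \<Sum>k<n. sum ?T (index_lists (Suc k) n))"
      by (intro sum.cong refl sum.UNION_disjoint) (auto simp: finite_index_lists, (auto simp: index_lists_def))
    also have "\<dots> = (\<Sum>n\<in>{1..l}. fps_nth W n)"
    proof (rule sum.cong)
      fix n assume "n \<in> {1..l}"
      then show "(\<Sum>k<n. sum ?T (index_lists (Suc k) n)) = fps_nth W n"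
        by (cases n) (auto simp: W_nth lessThan_Suc_atMost)
    qed simp
    also have "\<dots> = (\<Sum>n\<le>l. fps_nth W n)"
      by (rule sum.mono_neutral_left) (auto simp: W0 not_le)
    finally show ?thesis ..
  qed
  then have "nilpotent_exp l (nilpotent_bch l X Y) = (\<Sum>n\<le>l. fps_nth (fps_nexp W) n)"
    using eval_fps_nexp[OF hW] by simp
  also have "\<dots> = nilpotent_exp l X * nilpotent_exp l Y"
  proof -
    have "(\<Sum>n\<le>l. fps_nth (fps_nexp W) n) =
        (\<Sum>n\<le>l. fps_nth (fps_nexp (fps_const X * fps_X)) n) * (\<Sum>n\<le>l. fps_nth (fps_nexp (fps_const Y * fps_X)) n)"
      unfolding WE using fps_nexp_nth_top[OF hW, unfolded WE]
      by (intro eval_mult fps_nexp_nth_top homogeneous_linear X Y)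
    then show ?thesis
      by (simp only: eval_fps_nexp[OF homogeneous_linear[OF X]] eval_fps_nexp[OF homogeneous_linear[OF Y]]
          eval_linear[OF X] eval_linear[OF Y])
  qed
  finally show ?thesis .
qed

end

section \<open>A faithful representation of the truncated Lie algebra\<close>

declare split_paired_All [simp del] split_paired_Ex [simp del]

section \<open>Triangular matrices indexed by lattice points\<close>

definition box :: "nat \<times> nat \<Rightarrow> (nat \<times> nat) set" where
  "box k = {..fst k} \<times> {..snd k}"

lemma in_box: "m \<in> box k \<longleftrightarrow> fst m \<le> fst k \<and> snd m \<le> snd k"
  by (cases m) (auto simp: box_def)

lemma finite_box [simp]: "finite (box k)"
  by (simp add: box_def)

lemma box_trans: "i \<in> box j \<Longrightarrow> j \<in> box k \<Longrightarrow> i \<in> box k"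
  by (auto simp: in_box)

lemma box_self [simp]: "k \<in> box k"
  by (simp add: in_box)

text \<open>\<open>entry K k m\<close> is the coefficient of x^k in the image of x^m. Only the
  finitely many m below k occur in row k, so products are finite sums although the index set is
  infinite. The entries are real because the power series calculus above works over real
  algebras.\<close>

typedef kernel = "{K :: nat \<times> nat \<Rightarrow> nat \<times> nat \<Rightarrow> real. \<forall>k m. m \<notin> box k \<longrightarrow> K k m = 0}"
  morphisms entry Kernel
  by (rule exI[of _ "\<lambda>_ _. 0"]) simp

lemma entry_outside: "m \<notin> box k \<Longrightarrow> entry K k m = 0"
  using entry[of K] by blast

lemma entry_Kernel: "(\<And>k m. m \<notin> box k \<Longrightarrow> K k m = 0) \<Longrightarrow> entry (Kernel K) = K"
  by (rule Kernel_inverse) blast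

lemma kernel_eqI: "(\<And>k m. m \<in> box k \<Longrightarrow> entry A k m = entry B k m) \<Longrightarrow> A = B"
  using entry_outside by (metis entry_inject ext)

instantiation kernel :: real_algebra_1
begin

definition "0 = Kernel (\<lambda>_ _. 0)"
definition "1 = Kernel (\<lambda>k m. if k = m then 1 else 0)"
definition "A + B = Kernel (\<lambda>k m. entry A k m + entry B k m)"
definition "A - B = Kernel (\<lambda>k m. entry A k m - entry B k m)"
definition "- A = Kernel (\<lambda>k m. - entry A k m)"
definition "c *\<^sub>R A = Kernel (\<lambda>k m. c * entry A k m)"
definition "A * B = Kernel (\<lambda>k m. \<Sum>j\<in>box k. entry A k j * entry B j m)"

lemma entry_simps:
  "entry 0 k m = 0"
  "entry 1 k m = (if k = m then 1 else 0)"
  "entry (A + B) k m = entry A k m + entry B k m"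
  "entry (A - B) k m = entry A k m - entry B k m"
  "entry (- A) k m = - entry A k m"
  "entry (c *\<^sub>R A) k m = c * entry A k m"
  unfolding zero_kernel_def one_kernel_def plus_kernel_def minus_kernel_def uminus_kernel_def
      scaleR_kernel_def
  by (subst entry_Kernel; auto simp: entry_outside)+

lemma entry_mult: "entry (A * B) k m = (\<Sum>j\<in>box k. entry A k j * entry B j m)"
proof -
  have "entry A k j * entry B j m = 0" if "m \<notin> box k" "j \<in> box k" for k m j
    using box_trans that entry_outside by (metis mult_zero_right)
  then have "entry (Kernel (\<lambda>k m. \<Sum>j\<in>box k. entry A k j * entry B j m)) =
      (\<lambda>k m. \<Sum>j\<in>box k. entry A k j * entry B j m)"
    by (intro entry_Kernel sum.neutral) auto
  then show ?thesis by (simp add: times_kernel_def)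
qed

instance
proof
  fix A B C :: kernel and r :: real
  show "A * B * C = A * (B * C)"
  proof (rule kernel_eqI)
    fix k m
    have "entry (A * B * C) k m = (\<Sum>i\<in>box k. \<Sum>j\<in>box k. entry A k j * entry B j i * entry C i m)"
      by (simp add: entry_mult sum_distrib_right)
    also have "\<dots> = (\<Sum>j\<in>box k. \<Sum>i\<in>box k. entry A k j * entry B j i * entry C i m)"
      by (rule sum.swap)
    also have "\<dots> = (\<Sum>j\<in>box k. \<Sum>i\<in>box j. entry A k j * entry B j i * entry C i m)"
      by (intro sum.cong refl sum.mono_neutral_right)
         (auto simp: entry_outside intro: box_trans)
    also have "\<dots> = entry (A * (B * C)) k m"
      by (simp add: entry_mult sum_distrib_left mult.assoc)
    finally show "entry (A * B * C) k m = entry (A * (B * C)) k m" .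
  qed
  show "1 * A = A"
    by (rule kernel_eqI)
       (simp add: entry_mult entry_simps if_distrib[of "\<lambda>x. x * _"] sum.delta cong: if_cong)
  show "A * 1 = A"
    by (rule kernel_eqI)
       (simp add: entry_mult entry_simps if_distrib[of "\<lambda>x. _ * x"] sum.delta' cong: if_cong)
  show "(0::kernel) \<noteq> 1"
  proof
    assume "(0::kernel) = 1"
    then have "entry 0 0 0 = entry 1 0 0" by simp
    then show False by (simp add: entry_simps)
  qed
qed (rule kernel_eqI; simp add: entry_simps entry_mult algebra_simps sum.distrib sum_distrib_left)+

end

lemma entry_sum: "entry (sum f S) k m = (\<Sum>x\<in>S. entry (f x) k m)"
  by (induction S rule: infinite_finite_induct) (auto simp: entry_simps)

section \<open>Coordinates of the truncated Lie algebra\<close>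

lemma lookup_lie_scale [simp]: "Poly_Mapping.lookup (lie_scale c X) p = c * Poly_Mapping.lookup X p"
  by (simp add: lie_scale_def Poly_Mapping.map.rep_eq when_def)

lemma lookup_trunc: "Poly_Mapping.lookup (trunc l X) p = (if ndeg p \<le> l then Poly_Mapping.lookup X p else 0)"
  by (auto simp: trunc_def lookup_sum lookup_single when_def in_keys_iff)

lemma lookup_lie_bracket:
  "Poly_Mapping.lookup (lie_bracket X Y) r =
    (\<Sum>p\<in>box r. of_int (form p (r - p)) * Poly_Mapping.lookup X p * Poly_Mapping.lookup Y (r - p))"
proof -
  let ?X = "Poly_Mapping.lookup X" and ?Y = "Poly_Mapping.lookup Y"
  have "Poly_Mapping.lookup (lie_bracket X Y) r =
     (\<Sum>p\<in>Poly_Mapping.keys X. \<Sum>q\<in>Poly_Mapping.keys Y.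
        (if p + q = r then of_int (form p q) * ?X p * ?Y q else 0))"
    by (simp add: lie_bracket_def lookup_sum lookup_single when_def)
  also have "\<dots> = (\<Sum>p\<in>Poly_Mapping.keys X. if p \<in> box r then of_int (form p (r - p)) * ?X p * ?Y (r - p) else 0)"
  proof (rule sum.cong[OF refl])
    fix p
    have "(\<Sum>q\<in>Poly_Mapping.keys Y. (if p + q = r then of_int (form p q) * ?X p * ?Y q else 0)) =
       (\<Sum>q\<in>Poly_Mapping.keys Y. (if q = r - p then (if p \<in> box r then of_int (form p q) * ?X p * ?Y q else 0) else 0))"
      by (intro sum.cong) (auto simp: in_box prod_eq_iff)
    also have "\<dots> = (if p \<in> box r then of_int (form p (r - p)) * ?X p * ?Y (r - p) else 0)"
      by (simp add: in_keys_iff)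
    finally show "(\<Sum>q\<in>Poly_Mapping.keys Y. (if p + q = r then of_int (form p q) * ?X p * ?Y q else 0)) =
       (if p \<in> box r then of_int (form p (r - p)) * ?X p * ?Y (r - p) else 0)" .
  qed
  also have "\<dots> = (\<Sum>p\<in>Poly_Mapping.keys X \<inter> box r. of_int (form p (r - p)) * ?X p * ?Y (r - p))"
    by (simp add: sum.inter_restrict)
  also have "\<dots> = (\<Sum>p\<in>box r. of_int (form p (r - p)) * ?X p * ?Y (r - p))"
    by (rule sum.mono_neutral_left) (auto simp: in_keys_iff)
  finally show ?thesis .
qed

lemma quot_carrier_iff:
  "X \<in> quot_carrier l \<longleftrightarrow> (\<forall>p. Poly_Mapping.lookup X p \<noteq> 0 \<longrightarrow> p \<in> Nplus \<and> ndeg p \<le> l)"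
proof
  assume "X \<in> quot_carrier l"
  then show "\<forall>p. Poly_Mapping.lookup X p \<noteq> 0 \<longrightarrow> p \<in> Nplus \<and> ndeg p \<le> l"
    by (auto simp: quot_carrier_def lie_carrier_def lookup_trunc in_keys_iff subset_iff split: if_splits)
next
  assume *: "\<forall>p. Poly_Mapping.lookup X p \<noteq> 0 \<longrightarrow> p \<in> Nplus \<and> ndeg p \<le> l"
  then have "X = trunc l X" by (intro poly_mapping_eqI) (auto simp: lookup_trunc)
  moreover have "X \<in> lie_carrier" using * by (auto simp: lie_carrier_def in_keys_iff)
  ultimately show "X \<in> quot_carrier l" unfolding quot_carrier_def by blast
qed

lemma form_simps:
  "form (p + q) m = form p m + form q m"
  "form m (p + q) = form m p + form m q"
  "form 0 m = 0" "form m 0 = 0" "form p p = 0"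
  by (simp_all add: form_def algebra_simps)

lemma ndeg_add [simp]: "ndeg (p + q) = ndeg p + ndeg q"
  by (simp add: ndeg_def)

lemma ndeg_eq_0_iff: "ndeg p = 0 \<longleftrightarrow> p = 0"
  by (cases p) (auto simp: ndeg_def zero_prod_def)

lemma Nplus_iff: "p \<in> Nplus \<longleftrightarrow> p \<noteq> 0"
  by (auto simp: Nplus_def zero_prod_def)

lemma box_add_diff: "m \<in> box k \<Longrightarrow> m + (k - m) = k"
  by (auto simp: in_box prod_eq_iff)

text \<open>\<open>X\<^sub>n\<close> acts on monomials by \<open>x\<^sup>m \<mapsto> {n, m} x\<^bsup>m + n\<^esup>\<close>; only monomials of degree at most \<open>l + 1\<close> are
  kept, which suffices for faithfulness modulo degree \<open>> l\<close> and makes the action nilpotent.\<close>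

definition deriv_kernel :: "nat \<Rightarrow> lie \<Rightarrow> kernel" where
  "deriv_kernel l X = Kernel (\<lambda>k m. if m \<in> box k \<and> ndeg k \<le> Suc l
     then of_rat (Poly_Mapping.lookup X (k - m)) * of_int (form (k - m) m) else 0)"

lemma entry_deriv_kernel:
  "entry (deriv_kernel l X) k m = (if m \<in> box k \<and> ndeg k \<le> Suc l
     then of_rat (Poly_Mapping.lookup X (k - m)) * of_int (form (k - m) m) else 0)"
  by (simp add: deriv_kernel_def entry_Kernel)

text \<open>The index i bounds from below the amount by which degrees are raised. Columns of degree
  at least 1 and rows of degree at most l + 1 leave room for i \<le> l only, which is the
  nilpotency. The column m = 0 can be excluded since {n, 0} = 0.\<close>

definition kernel_filtration :: "nat \<Rightarrow> nat \<Rightarrow> kernel set" where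
  "kernel_filtration l i =
    {K. \<forall>k m. entry K k m \<noteq> 0 \<longrightarrow> 0 < ndeg m \<and> ndeg m + i \<le> ndeg k \<and> ndeg k \<le> Suc l}"

lemma ndeg_box: "m \<in> box k \<Longrightarrow> ndeg m + ndeg (k - m) = ndeg k"
  by (metis box_add_diff ndeg_add)

lemma deriv_kernel_filtration: "deriv_kernel l X \<in> kernel_filtration l 1"
proof -
  have "0 < ndeg m \<and> ndeg m + 1 \<le> ndeg k" if "m \<in> box k" "form (k - m) m \<noteq> 0" for k m
  proof -
    have "m \<noteq> 0" using that(2) form_simps(4)[of k] by (cases "m = 0") (auto simp: form_simps)
    moreover have "k - m \<noteq> 0" using that(2) form_simps(3)[of m] by (cases "k - m = 0") simp_all
    ultimately show ?thesis using ndeg_box[OF that(1)] ndeg_eq_0_iff[of m] ndeg_eq_0_iff[of "k - m"] by linarith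
  qed
  then show ?thesis by (auto simp: kernel_filtration_def entry_deriv_kernel split: if_splits)
qed

lemma kernel_filtrationD:
  assumes "K \<in> kernel_filtration l i" "entry K k m \<noteq> 0"
  shows "0 < ndeg m" "ndeg m + i \<le> ndeg k" "ndeg k \<le> Suc l"
  using assms unfolding kernel_filtration_def by blast+

lemma kernel_filtrationI:
  assumes "\<And>k m. entry K k m \<noteq> 0 \<Longrightarrow> 0 < ndeg m \<and> ndeg m + i \<le> ndeg k \<and> ndeg k \<le> Suc l"
  shows "K \<in> kernel_filtration l i"
  using assms unfolding kernel_filtration_def by blast+

lemma kernel_filtration_mult:
  assumes A: "A \<in> kernel_filtration l i" and B: "B \<in> kernel_filtration l j"
  shows "A * B \<in> kernel_filtration l (i + j)"
proof (rule kernel_filtrationI)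
  fix k m assume "entry (A * B) k m \<noteq> 0"
  then obtain n where "entry A k n \<noteq> 0" "entry B n m \<noteq> 0"
    unfolding entry_mult by (metis (no_types, lifting) mult_eq_0_iff sum.neutral)
  then show "0 < ndeg m \<and> ndeg m + (i + j) \<le> ndeg k \<and> ndeg k \<le> Suc l"
    using kernel_filtrationD[OF A, of k n] kernel_filtrationD[OF B, of n m] by linarith
qed

lemma kernel_filtration_add:
  assumes A: "A \<in> kernel_filtration l i" and B: "B \<in> kernel_filtration l i"
  shows "A + B \<in> kernel_filtration l i"
proof (rule kernel_filtrationI)
  fix k m assume "entry (A + B) k m \<noteq> 0"
  then have "entry A k m \<noteq> 0 \<or> entry B k m \<noteq> 0" by (auto simp: entry_simps)
  then show "0 < ndeg m \<and> ndeg m + i \<le> ndeg k \<and> ndeg k \<le> Suc l"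
    using kernel_filtrationD[OF A] kernel_filtrationD[OF B] by blast
qed

lemma kernel_filtration_top:
  assumes A: "A \<in> kernel_filtration l i" and "i > l"
  shows "A = 0"
proof (rule kernel_eqI)
  fix k m
  have "\<not> (0 < ndeg m \<and> ndeg m + i \<le> ndeg k \<and> ndeg k \<le> Suc l)" using assms(2) by linarith
  then have "entry A k m = 0" using kernel_filtrationD[OF A] by blast
  then show "entry A k m = entry 0 k m" by (simp add: entry_simps)
qed

interpretation kernel_filtration: nilpotent_filtration "kernel_filtration l" l for l
proof (unfold_locales, goal_cases)
  case (1 i)
  show ?case by (rule kernel_filtrationI) (simp add: entry_simps)
next
  case (2 x i y)
  then show ?case by (rule kernel_filtration_add)
next
  case (3 x i c)
  show ?case
  proof (rule kernel_filtrationI)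
    fix k m assume "entry (c *\<^sub>R x) k m \<noteq> 0"
    then show "0 < ndeg m \<and> ndeg m + i \<le> ndeg k \<and> ndeg k \<le> Suc l"
      using kernel_filtrationD[OF 3, of k m] by (simp add: entry_simps)
  qed
next
  case (4 i j x y)
  then show ?case using kernel_filtration_mult by blast
next
  case (5 x i)
  show ?case
  proof (rule kernel_filtrationI)
    fix k m assume "entry x k m \<noteq> 0"
    then show "0 < ndeg m \<and> ndeg m + i \<le> ndeg k \<and> ndeg k \<le> Suc l"
      using kernel_filtrationD[OF 5, of k m] by simp
  qed
next
  case (6 i x)
  then show ?case using kernel_filtration_top by blast
qed

lemma deriv_kernel_add: "deriv_kernel l (X + Y) = deriv_kernel l X + deriv_kernel l Y"
  by (rule kernel_eqI) (simp add: entry_deriv_kernel entry_simps lookup_add of_rat_add algebra_simps)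

lemma deriv_kernel_zero: "deriv_kernel l 0 = 0"
  by (rule kernel_eqI) (simp add: entry_deriv_kernel entry_simps)

lemma deriv_kernel_sum: "deriv_kernel l (sum f S) = (\<Sum>x\<in>S. deriv_kernel l (f x))"
  by (induction S rule: infinite_finite_induct) (auto simp: deriv_kernel_add deriv_kernel_zero)

lemma deriv_kernel_scale: "deriv_kernel l (lie_scale c X) = of_rat c *\<^sub>R deriv_kernel l X"
  by (rule kernel_eqI) (simp add: entry_deriv_kernel entry_simps of_rat_mult)

lemma box_shift_image:
  assumes "m \<in> box k"
  shows "{j \<in> box k. m \<in> box j} = (+) m ` box (k - m)"
proof
  show "{j \<in> box k. m \<in> box j} \<subseteq> (+) m ` box (k - m)"
  proof
    fix j assume "j \<in> {j \<in> box k. m \<in> box j}"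
    then have "j = m + (j - m)" "j - m \<in> box (k - m)" by (auto simp: in_box prod_eq_iff)
    then show "j \<in> (+) m ` box (k - m)" by blast
  qed
qed (use assms in \<open>auto simp: in_box\<close>)

lemma entry_mult_shift:
  assumes "m \<in> box k"
  shows "entry (A * B) k m = (\<Sum>q\<in>box (k - m). entry A k (m + q) * entry B (m + q) m)"
proof -
  have "entry (A * B) k m = (\<Sum>j\<in>{j \<in> box k. m \<in> box j}. entry A k j * entry B j m)"
    unfolding entry_mult by (rule sum.mono_neutral_right) (auto simp: entry_outside)
  also have "\<dots> = (\<Sum>q\<in>box (k - m). entry A k (m + q) * entry B (m + q) m)"
    unfolding box_shift_image[OF assms] by (subst sum.reindex) auto
  finally show ?thesis .
qed

lemma box_diff_diff: "p \<in> box r \<Longrightarrow> r - (r - p) = p"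
  by (auto simp: in_box prod_eq_iff)

lemma box_diff: "p \<in> box r \<Longrightarrow> r - p \<in> box r"
  by (auto simp: in_box)

lemma sum_box_reflect: "(\<Sum>q\<in>box r. F q) = (\<Sum>p\<in>box r. F (r - p))"
  by (rule sum.reindex_bij_witness[of _ "\<lambda>p. r - p" "\<lambda>p. r - p"]) (simp_all add: box_diff_diff box_diff)

text \<open>In {p, m + q} {q, m} - {q, m + p} {p, m} the terms {p, m} {q, m} cancel, and {p, q} {p +
  q, m} remains. Reflecting the sum by q \<mapsto> r - q pairs the two products.\<close>

lemma deriv_kernel_bracket:
  "deriv_kernel l (quot_bracket l X Y) = commutator (deriv_kernel l X) (deriv_kernel l Y)"
proof (rule kernel_eqI)
  fix k m assume m: "m \<in> box k"
  let ?X = "\<lambda>p. of_rat (Poly_Mapping.lookup X p) :: real" and ?Y = "\<lambda>p. of_rat (Poly_Mapping.lookup Y p) :: real"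
  define r where "r = k - m"
  have k: "k = m + r" using box_add_diff[OF m] by (simp add: r_def)
  show "entry (deriv_kernel l (quot_bracket l X Y)) k m = entry (commutator (deriv_kernel l X) (deriv_kernel l Y)) k m"
  proof (cases "ndeg k \<le> Suc l")
    case False
    then show ?thesis by (simp add: entry_simps commutator_def entry_mult entry_deriv_kernel)
  next
    case deg: True
    have shift: "m + q \<in> box k" "m \<in> box (m + q)" "k - (m + q) = r - q" "m + q - m = q"
       "ndeg m + ndeg q \<le> Suc l" if "q \<in> box r" for q
      using that deg ndeg_box[OF that] unfolding k by (auto simp: in_box prod_eq_iff)
    have "entry (commutator (deriv_kernel l X) (deriv_kernel l Y)) k m =
      (\<Sum>q\<in>box r. ?X (r - q) * of_int (form (r - q) (m + q)) * (?Y q * of_int (form q m))) -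
      (\<Sum>q\<in>box r. ?Y (r - q) * of_int (form (r - q) (m + q)) * (?X q * of_int (form q m)))"
      unfolding commutator_def entry_simps entry_mult_shift[OF m] r_def[symmetric]
      by (intro arg_cong2[of _ _ _ _ "(-)"] sum.cong refl) (simp_all add: entry_deriv_kernel shift deg)
    also have "(\<Sum>q\<in>box r. ?X (r - q) * of_int (form (r - q) (m + q)) * (?Y q * of_int (form q m))) =
      (\<Sum>q\<in>box r. ?X q * of_int (form q (m + (r - q))) * (?Y (r - q) * of_int (form (r - q) m)))"
      by (subst sum_box_reflect) (intro sum.cong refl, simp add: box_diff_diff)
    also have "\<dots> - (\<Sum>q\<in>box r. ?Y (r - q) * of_int (form (r - q) (m + q)) * (?X q * of_int (form q m))) =
      (\<Sum>q\<in>box r. of_int (form q (r - q)) * ?X q * ?Y (r - q)) * of_int (form r m)"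
      unfolding sum_subtractf[symmetric] sum_distrib_right
    proof (intro sum.cong refl)
      fix q assume "q \<in> box r"
      then have "form r m = form q m + form (r - q) m"
        by (metis box_add_diff form_simps(1))
      moreover have "form (r - q) q = - form q (r - q)" by (simp add: form_def)
      ultimately show "?X q * of_int (form q (m + (r - q))) * (?Y (r - q) * of_int (form (r - q) m)) -
         ?Y (r - q) * of_int (form (r - q) (m + q)) * (?X q * of_int (form q m)) =
         of_int (form q (r - q)) * ?X q * ?Y (r - q) * of_int (form r m)"
        by (simp add: form_simps algebra_simps)
    qed
    also have "\<dots> = entry (deriv_kernel l (quot_bracket l X Y)) k m"
    \<comment> \<open>Truncating the bracket at degree l could matter only in column m = 0, where
      {r, 0} = 0 makes both sides vanish; otherwise deg k \<le> l + 1 forces deg r \<le> l.\<close>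
    proof (cases "m = 0")
      case True
      then show ?thesis by (simp add: entry_deriv_kernel form_simps)
    next
      case False
      then have "ndeg r \<le> l" using deg ndeg_box[OF m] ndeg_eq_0_iff[of m] by (simp add: r_def)
      then show ?thesis using m deg
        by (simp add: entry_deriv_kernel quot_bracket_def lookup_trunc lookup_lie_bracket of_rat_sum of_rat_mult
           r_def[symmetric])
    qed
    finally show ?thesis ..
  qed
qed

lemma deriv_kernel_nested_bracket:
  "deriv_kernel l (nested_bracket l ws) = nested_commutator (map (deriv_kernel l) ws)"
  by (induction l ws rule: nested_bracket.induct) (simp_all add: deriv_kernel_zero deriv_kernel_bracket)

lemma of_rat_bch_coeff: "(of_rat (bch_coeff rs) :: real) = bch_coeff rs"
proof -
  have "(of_rat (fact_weight rs) :: real) = fact_weight rs" for rs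
    by (induction rs) (auto simp: of_rat_mult, metis of_nat_fact of_rat_of_nat_eq)
  then show ?thesis by (simp add: bch_coeff_def of_rat_mult of_rat_divide of_rat_power)
qed

lemma bch_altdef:
  "bch l X Y = (\<Sum>rs\<in>bch_index l. lie_scale (bch_coeff rs) (nested_bracket l (bch_word X Y rs)))"
  by (simp add: bch_def bch_coeff_def fact_weight_def bch_word_def)

lemma map_bch_word: "map f (bch_word X Y rs) = bch_word (f X) (f Y) rs"
  by (induction rs) (auto simp: bch_word_Cons)

lemma deriv_kernel_bch: "deriv_kernel l (bch l X Y) = nilpotent_bch l (deriv_kernel l X) (deriv_kernel l Y)"
  by (simp add: bch_altdef nilpotent_bch_def deriv_kernel_sum deriv_kernel_scale of_rat_bch_coeff
     deriv_kernel_nested_bracket map_bch_word)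

definition exp_kernel :: "nat \<Rightarrow> lie \<Rightarrow> kernel" where
  "exp_kernel l X = nilpotent_exp l (deriv_kernel l X)"

lemma exp_kernel_bch: "exp_kernel l (bch l X Y) = exp_kernel l X * exp_kernel l Y"
  unfolding exp_kernel_def deriv_kernel_bch
  by (rule kernel_filtration.exp_bch) (rule deriv_kernel_filtration)+

lemma exp_kernel_zero: "exp_kernel l 0 = 1"
  by (simp add: exp_kernel_def deriv_kernel_zero nilpotent_exp_def power_0_left if_distrib
    sum.delta cong: if_cong)

lemma exp_kernel_inj:
  assumes X: "X \<in> quot_carrier l" and Y: "Y \<in> quot_carrier l" and eq: "exp_kernel l X = exp_kernel l Y"
  shows "X = Y"
proof (rule poly_mapping_eqI)
  fix p
  have D: "deriv_kernel l X = deriv_kernel l Y"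
    using eq kernel_filtration.nilpotent_exp_inj deriv_kernel_filtration unfolding exp_kernel_def by blast
  show "Poly_Mapping.lookup X p = Poly_Mapping.lookup Y p"
  proof (cases "p \<noteq> 0 \<and> ndeg p \<le> l")
    case False
    then have "Poly_Mapping.lookup X p = 0 \<and> Poly_Mapping.lookup Y p = 0"
      using X Y unfolding quot_carrier_iff Nplus_iff by blast
    then show ?thesis by simp
  next
    case True
    \<comment> \<open>A nonzero p pairs nontrivially with (1, 0) or (0, 1). As deg m = 1, the point
      m + p still lies within the cut-off l + 1, and the coefficient of X_p can be read off
      there.\<close>
    then obtain m where m: "form p m \<noteq> 0" "ndeg m = 1"
    proof (cases "fst p = 0")
      case True
      then have "snd p \<noteq> 0" using \<open>p \<noteq> 0 \<and> _\<close> by (auto simp: prod_eq_iff)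
      then show ?thesis using that[of "(1, 0)"] by (simp add: form_def ndeg_def)
    next
      case False
      then show ?thesis using that[of "(0, 1)"] by (simp add: form_def ndeg_def)
    qed
    have "entry (deriv_kernel l X) (m + p) m = entry (deriv_kernel l Y) (m + p) m" using D by simp
    then show ?thesis using m True by (simp add: entry_deriv_kernel in_box)
  qed
qed

section \<open>Words in the dilogarithm elements\<close>

lemma lie_scale_zero [simp]: "lie_scale c 0 = 0"
  by (rule poly_mapping_eqI) simp

lemma quot_carrier_zero: "0 \<in> quot_carrier l"
  by (simp add: quot_carrier_iff)

lemma quot_carrier_add: "X \<in> quot_carrier l \<Longrightarrow> Y \<in> quot_carrier l \<Longrightarrow> X + Y \<in> quot_carrier l"
  unfolding quot_carrier_iff lookup_add by (metis add.right_neutral)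

lemma quot_carrier_scale: "X \<in> quot_carrier l \<Longrightarrow> lie_scale c X \<in> quot_carrier l"
  unfolding quot_carrier_iff lookup_lie_scale by (metis mult_zero_right)

lemma quot_carrier_sum: "(\<And>x. x \<in> S \<Longrightarrow> f x \<in> quot_carrier l) \<Longrightarrow> sum f S \<in> quot_carrier l"
  by (induction S rule: infinite_finite_induct) (auto simp: quot_carrier_zero quot_carrier_add)

lemma lookup_quot_bracket:
  "Poly_Mapping.lookup (quot_bracket l X Y) r = (if ndeg r \<le> l then
    (\<Sum>p\<in>box r. of_int (form p (r - p)) * Poly_Mapping.lookup X p * Poly_Mapping.lookup Y (r - p)) else 0)"
  by (simp add: quot_bracket_def lookup_trunc lookup_lie_bracket)

lemma quot_bracket_nonzeroE:
  assumes "Poly_Mapping.lookup (quot_bracket l X Y) r \<noteq> 0"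
  obtains p where "p \<in> box r" "Poly_Mapping.lookup X p \<noteq> 0" "Poly_Mapping.lookup Y (r - p) \<noteq> 0"
    "form p (r - p) \<noteq> 0" "ndeg r \<le> l"
proof -
  have deg: "ndeg r \<le> l" using assms by (auto simp: lookup_quot_bracket split: if_splits)
  then have "(\<Sum>p\<in>box r. of_int (form p (r - p)) * Poly_Mapping.lookup X p * Poly_Mapping.lookup Y (r - p)) \<noteq> 0"
    using assms by (simp add: lookup_quot_bracket)
  then obtain p where "p \<in> box r"
    "of_int (form p (r - p)) * Poly_Mapping.lookup X p * Poly_Mapping.lookup Y (r - p) \<noteq> 0"
    by (rule sum.not_neutral_contains_not_neutral)
  then show ?thesis using that deg by auto
qed

lemma quot_carrier_bracket: "quot_bracket l X Y \<in> quot_carrier l"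
  unfolding quot_carrier_iff
proof (intro allI impI)
  fix r assume "Poly_Mapping.lookup (quot_bracket l X Y) r \<noteq> 0"
  then show "r \<in> Nplus \<and> ndeg r \<le> l"
  proof (rule quot_bracket_nonzeroE)
    fix p assume p: "p \<in> box r" "form p (r - p) \<noteq> 0" "ndeg r \<le> l"
    then have "r \<noteq> 0" by (auto simp: in_box form_def)
    then show ?thesis using p by (simp add: Nplus_iff)
  qed
qed

lemma quot_carrier_nested_bracket: "set ws \<subseteq> quot_carrier l \<Longrightarrow> nested_bracket l ws \<in> quot_carrier l"
  by (induction l ws rule: nested_bracket.induct) (auto simp: quot_carrier_zero quot_carrier_bracket)

lemma set_bch_word: "set (bch_word X Y rs) \<subseteq> {X, Y}"
  by (auto simp: bch_word_def)

lemma quot_carrier_bch: "X \<in> quot_carrier l \<Longrightarrow> Y \<in> quot_carrier l \<Longrightarrow> bch l X Y \<in> quot_carrier l"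
  unfolding bch_altdef using set_bch_word[of X Y]
  by (intro quot_carrier_sum quot_carrier_scale quot_carrier_nested_bracket) blast

section \<open>Long brackets, homomorphisms and commuting elements under the Dynkin series\<close>

lemma nested_bracket_degree:
  assumes "set ws \<subseteq> quot_carrier l" "Poly_Mapping.lookup (nested_bracket l ws) r \<noteq> 0"
  shows "length ws \<le> ndeg r"
  using assms
proof (induction l ws arbitrary: r rule: nested_bracket.induct)
  case (2 l x)
  then show ?case using ndeg_eq_0_iff[of r] by (auto simp: quot_carrier_iff Nplus_iff Suc_le_eq)
next
  case (3 l x y xs)
  from 3(3) obtain p where p: "p \<in> box r" "Poly_Mapping.lookup x p \<noteq> 0"
      "Poly_Mapping.lookup (nested_bracket l (y # xs)) (r - p) \<noteq> 0"
    unfolding nested_bracket.simps by (rule quot_bracket_nonzeroE)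
  have "length (y # xs) \<le> ndeg (r - p)" using 3 p by auto
  moreover have "ndeg p \<noteq> 0" using 3(2) p(2) ndeg_eq_0_iff[of p] by (auto simp: quot_carrier_iff Nplus_iff)
  ultimately show ?case using ndeg_box[OF p(1)] by simp
qed simp

lemma nested_bracket_long:
  assumes "set ws \<subseteq> quot_carrier l" "length ws > l"
  shows "nested_bracket l ws = 0"
proof (rule poly_mapping_eqI, rule ccontr)
  fix r assume "Poly_Mapping.lookup (nested_bracket l ws) r \<noteq> Poly_Mapping.lookup 0 r"
  then show False
    using nested_bracket_degree[OF assms(1), of r] quot_carrier_nested_bracket[OF assms(1)] assms(2)
    by (force simp: quot_carrier_iff)
qed

text \<open>A linear map respecting brackets acts termwise on Dynkin's sum. When the target has a
  smaller level l', the words of more than l' factors are missing from its sum, but their brackets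
  vanish there by degree.\<close>

lemma bch_hom:
  assumes add: "\<And>X Y. \<phi> (X + Y) = \<phi> X + \<phi> Y" and scale: "\<And>c X. \<phi> (lie_scale c X) = lie_scale c (\<phi> X)"
    and bracket: "\<And>X Y. X \<in> quot_carrier l \<Longrightarrow> Y \<in> quot_carrier l \<Longrightarrow>
        \<phi> (quot_bracket l X Y) = quot_bracket l' (\<phi> X) (\<phi> Y)"
    and carrier: "\<And>X. X \<in> quot_carrier l \<Longrightarrow> \<phi> X \<in> quot_carrier l'"
    and l': "l' \<le> l" and X: "X \<in> quot_carrier l" and Y: "Y \<in> quot_carrier l"
  shows "\<phi> (bch l X Y) = bch l' (\<phi> X) (\<phi> Y)"
proof -
  have zero: "\<phi> 0 = 0" using add[of 0 0] by simp
  have sum: "\<phi> (sum f S) = (\<Sum>x\<in>S. \<phi> (f x))" for f :: "(nat \<times> nat) list \<Rightarrow> lie" and S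
    by (induction S rule: infinite_finite_induct) (auto simp: zero add)
  have nested: "\<phi> (nested_bracket l ws) = nested_bracket l' (map \<phi> ws)" if "set ws \<subseteq> quot_carrier l" for ws
    using that
  proof (induction ws rule: induct_list012)
    case (3 x y zs)
    then show ?case using quot_carrier_nested_bracket[of "y # zs" l] by (simp add: bracket)
  qed (simp_all add: zero)
  have w: "set (bch_word X Y rs) \<subseteq> quot_carrier l" for rs
    using set_bch_word[of X Y rs] X Y by auto
  have "\<phi> (bch l X Y) = (\<Sum>rs\<in>bch_index l. lie_scale (bch_coeff rs) (nested_bracket l' (bch_word (\<phi> X) (\<phi> Y) rs)))"
    unfolding bch_altdef sum scale nested[OF w] map_bch_word ..
  also have "\<dots> = bch l' (\<phi> X) (\<phi> Y)"
    unfolding bch_altdef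
  proof (rule sum.mono_neutral_right)
    show "bch_index l' \<subseteq> bch_index l" using l' by (auto simp: bch_index_def)
    show "\<forall>rs\<in>bch_index l - bch_index l'. lie_scale (bch_coeff rs) (nested_bracket l' (bch_word (\<phi> X) (\<phi> Y) rs)) = 0"
    proof
      fix rs assume "rs \<in> bch_index l - bch_index l'"
      then have "length (bch_word (\<phi> X) (\<phi> Y) rs) > l'" by (auto simp: bch_index_def length_bch_word)
      moreover have "set (bch_word (\<phi> X) (\<phi> Y) rs) \<subseteq> quot_carrier l'"
        using set_bch_word[of "\<phi> X" "\<phi> Y" rs] X Y carrier by auto
      ultimately have "nested_bracket l' (bch_word (\<phi> X) (\<phi> Y) rs) = 0" by (rule nested_bracket_long[rotated])
      then show "lie_scale (bch_coeff rs) (nested_bracket l' (bch_word (\<phi> X) (\<phi> Y) rs)) = 0"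
        by simp
    qed
  qed (simp add: finite_bch_index)
  finally show ?thesis .
qed

lemma quot_bracket_antisym: "quot_bracket l Y X = - quot_bracket l X Y"
proof (rule poly_mapping_eqI)
  fix r
  let ?X = "Poly_Mapping.lookup X" and ?Y = "Poly_Mapping.lookup Y"
  have "(\<Sum>p\<in>box r. of_int (form p (r - p)) * ?Y p * ?X (r - p)) =
     (\<Sum>p\<in>box r. of_int (form (r - p) (r - (r - p))) * ?Y (r - p) * ?X (r - (r - p)))"
    by (rule sum_box_reflect)
  also have "\<dots> = (\<Sum>p\<in>box r. - (of_int (form p (r - p)) * ?X p * ?Y (r - p)))"
  proof (intro sum.cong refl)
    fix p assume "p \<in> box r"
    moreover have "form (r - p) p = - form p (r - p)" by (simp add: form_def)
    ultimately show "of_int (form (r - p) (r - (r - p))) * ?Y (r - p) * ?X (r - (r - p)) =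
        - (of_int (form p (r - p)) * ?X p * ?Y (r - p))"
      by (simp add: box_diff_diff)
  qed
  finally show "Poly_Mapping.lookup (quot_bracket l Y X) r = Poly_Mapping.lookup (- quot_bracket l X Y) r"
    by (simp add: lookup_quot_bracket sum_negf)
qed

lemma quot_bracket_zero_right: "quot_bracket l X 0 = 0"
  by (rule poly_mapping_eqI) (simp add: lookup_quot_bracket)

lemma quot_bracket_self: "quot_bracket l X X = 0"
proof (rule poly_mapping_eqI)
  fix r
  have "Poly_Mapping.lookup (quot_bracket l X X) r = Poly_Mapping.lookup (- quot_bracket l X X) r"
    using quot_bracket_antisym[of l X X] by (rule arg_cong)
  then show "Poly_Mapping.lookup (quot_bracket l X X) r = Poly_Mapping.lookup 0 r" by simp
qed

lemma nested_bracket_commuting: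
  assumes "\<And>x y. x \<in> set ws \<Longrightarrow> y \<in> set ws \<Longrightarrow> quot_bracket l x y = 0" "length ws \<ge> 2"
  shows "nested_bracket l ws = 0"
  using assms
proof (induction ws rule: induct_list012)
  case (3 x y zs)
  show ?case
  proof (cases zs)
    case Nil
    then show ?thesis using 3 by simp
  next
    case (Cons z zs')
    then have "nested_bracket l (y # zs) = 0" using 3 by simp
    then show ?thesis by (simp add: quot_bracket_zero_right)
  qed
qed simp_all

text \<open>Every bracket of two or more factors vanishes, which leaves the two one-letter
  words.\<close>

lemma bch_commuting:
  assumes X: "X \<in> quot_carrier l" and Y: "Y \<in> quot_carrier l" and c: "quot_bracket l X Y = 0"
  shows "bch l X Y = X + Y"
proof (cases "l = 0")
  case True
  have "Z = 0" if "Z \<in> quot_carrier 0" for Z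
    by (rule poly_mapping_eqI) (use that in \<open>auto simp: quot_carrier_iff ndeg_eq_0_iff Nplus_iff\<close>)
  then have "X = 0" "Y = 0" "bch l X Y = 0" using X Y quot_carrier_bch[OF X Y] True by blast+
  then show ?thesis by simp
next
  case False
  let ?T = "\<lambda>rs. lie_scale (bch_coeff rs) (nested_bracket l (bch_word X Y rs))"
  have "bch l X Y = sum ?T {[(1, 0)], [(0, 1)]}"
    unfolding bch_altdef
  proof (rule sum.mono_neutral_right)
    show "{[(1, 0)], [(0, 1)]} \<subseteq> bch_index l" using False by (auto simp: bch_index_def)
    show "\<forall>rs\<in>bch_index l - {[(1, 0)], [(0, 1)]}. ?T rs = 0"
    proof
      fix rs assume rs: "rs \<in> bch_index l - {[(1, 0)], [(0, 1)]}"
      have "word_length rs \<ge> 2"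
      proof (rule ccontr)
        assume "\<not> word_length rs \<ge> 2"
        moreover obtain r s rs' where eq: "rs = (r, s) # rs'" using rs by (cases rs) (auto simp: bch_index_def)
        moreover have "length rs' \<le> word_length rs'" "r + s > 0"
          using rs eq by (auto simp: bch_index_def intro!: length_le_word_length)
        ultimately have "length rs' = 0" "r + s = 1" by (simp_all only: word_length_Cons)
        then show False using rs eq by (auto simp: add_is_1)
      qed
      then have "nested_bracket l (bch_word X Y rs) = 0"
        using set_bch_word[of X Y rs] c quot_bracket_antisym[of l Y X] quot_bracket_self[of l]
        by (intro nested_bracket_commuting) (auto simp: length_bch_word)
      then show "?T rs = 0" by simp
    qed
  qed (simp add: finite_bch_index)
  also have "\<dots> = X + Y"
    by (simp add: bch_word_Cons bch_coeff_def) (rule poly_mapping_eqI, simp add: lookup_add)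
  finally show ?thesis .
qed

section \<open>Logarithms and matrices of words in the elements [p]^u\<close>

definition letter :: "nat \<Rightarrow> (nat \<times> nat) \<times> rat \<Rightarrow> lie" where
  "letter l x = lie_scale (snd x) (dilog (fst x) l)"

definition word_value :: "nat \<Rightarrow> ((nat \<times> nat) \<times> rat) list \<Rightarrow> lie" where
  "word_value l w = foldr (bch l) (map (letter l) w) 0"

definition word_kernel :: "nat \<Rightarrow> ((nat \<times> nat) \<times> rat) list \<Rightarrow> kernel" where
  "word_kernel l w = prod_list (map (\<lambda>x. exp_kernel l (letter l x)) w)"

lemma lookup_dilog_nonzero:
  assumes "Poly_Mapping.lookup (dilog p l) r \<noteq> 0"
  obtains j where "j \<ge> 1" "r = (j * fst p, j * snd p)" "ndeg r \<le> l"
proof -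
  have "(\<Sum>j\<in>{j. 1 \<le> j \<and> j * ndeg p \<le> l}. Poly_Mapping.lookup
     (Poly_Mapping.single (j * fst p, j * snd p) ((-1) ^ (j + 1) / of_nat j ^ 2 :: rat)) r) \<noteq> 0"
    using assms by (simp add: dilog_def lookup_sum)
  then obtain j where "1 \<le> j \<and> j * ndeg p \<le> l" "Poly_Mapping.lookup
     (Poly_Mapping.single (j * fst p, j * snd p) ((-1) ^ (j + 1) / of_nat j ^ 2 :: rat)) r \<noteq> 0"
    by (rule sum.not_neutral_contains_not_neutral) blast
  then show ?thesis using that[of j]
    by (auto simp: lookup_single when_def ndeg_def algebra_simps split: if_splits)
qed

text \<open>For p = 0 the index set of the sum is infinite, and such a sum is 0 by convention. This
  lets \<open>letter\<close> lie in the quotient for every p.\<close>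

lemma dilog_zero: "dilog 0 l = 0"
proof -
  have "\<not> finite {j::nat. 1 \<le> j}" by (simp add: infinite_Ici flip: atLeast_def)
  then show ?thesis by (simp add: dilog_def ndeg_def)
qed

lemma quot_carrier_letter: "letter l x \<in> quot_carrier l"
proof -
  have "dilog p l \<in> quot_carrier l" for p
  proof (cases "p = 0")
    case True
    then show ?thesis by (simp add: dilog_zero quot_carrier_zero)
  next
    case False
    show ?thesis unfolding quot_carrier_iff
    proof (intro allI impI)
      fix r assume "Poly_Mapping.lookup (dilog p l) r \<noteq> 0"
      then obtain j where "j \<ge> 1" "r = (j * fst p, j * snd p)" "ndeg r \<le> l" by (rule lookup_dilog_nonzero)
      then show "r \<in> Nplus \<and> ndeg r \<le> l" using False by (auto simp: Nplus_iff prod_eq_iff)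
    qed
  qed
  then show ?thesis by (simp add: letter_def quot_carrier_scale)
qed

lemma word_value_Nil [simp]: "word_value l [] = 0"
  by (simp add: word_value_def)

lemma word_value_Cons [simp]: "word_value l (x # w) = bch l (letter l x) (word_value l w)"
  by (simp add: word_value_def)

lemma word_kernel_Nil [simp]: "word_kernel l [] = 1"
  by (simp add: word_kernel_def)

lemma word_kernel_Cons [simp]: "word_kernel l (x # w) = exp_kernel l (letter l x) * word_kernel l w"
  by (simp add: word_kernel_def)

lemma word_kernel_append [simp]: "word_kernel l (v @ w) = word_kernel l v * word_kernel l w"
  by (simp add: word_kernel_def)

lemma quot_carrier_word_value: "word_value l w \<in> quot_carrier l"
  by (induction w) (auto simp: quot_carrier_zero quot_carrier_bch quot_carrier_letter)

lemma exp_kernel_word_value: "exp_kernel l (word_value l w) = word_kernel l w"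
  by (induction w) (auto simp: exp_kernel_zero exp_kernel_bch)

text \<open>Faithfulness makes identities of group elements equivalent to identities of matrices,
  where associativity and cancellation of trivial factors cost nothing.\<close>

lemma word_value_eq_iff: "word_value l v = word_value l w \<longleftrightarrow> word_kernel l v = word_kernel l w"
  using exp_kernel_inj[OF quot_carrier_word_value quot_carrier_word_value] exp_kernel_word_value by metis

text \<open>Associativity of Dynkin's product is inherited from matrix multiplication.\<close>

lemma bch_assoc:
  assumes "X \<in> quot_carrier l" "Y \<in> quot_carrier l" "Z \<in> quot_carrier l"
  shows "bch l (bch l X Y) Z = bch l X (bch l Y Z)"
  by (rule exp_kernel_inj[of _ l]) (use assms in \<open>simp_all add: quot_carrier_bch exp_kernel_bch mult.assoc\<close>)

lemma bch_zero_right: "X \<in> quot_carrier l \<Longrightarrow> bch l X 0 = X"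
  by (rule exp_kernel_inj[of _ l]) (simp_all add: quot_carrier_bch quot_carrier_zero exp_kernel_bch exp_kernel_zero)

lemma bch_zero_left: "X \<in> quot_carrier l \<Longrightarrow> bch l 0 X = X"
  by (rule exp_kernel_inj[of _ l]) (simp_all add: quot_carrier_bch quot_carrier_zero exp_kernel_bch exp_kernel_zero)

lemma quot_bracket_parallel:
  assumes "form (fst x) (fst y) = 0"
  shows "quot_bracket l (letter l x) (letter l y) = 0"
proof (rule poly_mapping_eqI, rule ccontr)
  fix r assume "Poly_Mapping.lookup (quot_bracket l (letter l x) (letter l y)) r \<noteq> Poly_Mapping.lookup 0 r"
  then have "Poly_Mapping.lookup (quot_bracket l (letter l x) (letter l y)) r \<noteq> 0" by simp
  then obtain p where p: "Poly_Mapping.lookup (letter l x) p \<noteq> 0" "Poly_Mapping.lookup (letter l y) (r - p) \<noteq> 0"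
    "form p (r - p) \<noteq> 0" by (rule quot_bracket_nonzeroE)
  then have "Poly_Mapping.lookup (dilog (fst x) l) p \<noteq> 0" "Poly_Mapping.lookup (dilog (fst y) l) (r - p) \<noteq> 0"
    by (auto simp: letter_def)
  then obtain i j where "p = (i * fst (fst x), i * snd (fst x))" "r - p = (j * fst (fst y), j * snd (fst y))"
    by (metis lookup_dilog_nonzero)
  then have "form p (r - p) = int i * int j * form (fst x) (fst y)"
    by (simp add: form_def algebra_simps)
  then show False using p assms by simp
qed

lemma letter_commute:
  assumes "form p q = 0"
  shows "word_kernel l [(p, u), (q, v)] = word_kernel l [(q, v), (p, u)]"
proof -
  have "form q p = 0" using assms by (simp add: form_def mult.commute)
  then have "bch l (letter l (p, u)) (letter l (q, v)) = bch l (letter l (q, v)) (letter l (p, u))"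
    using assms by (simp add: bch_commuting quot_carrier_letter quot_bracket_parallel add.commute)
  then show ?thesis by (metis exp_kernel_bch mult.right_neutral word_kernel_Cons word_kernel_Nil)
qed

lemma letter_merge: "word_kernel l [(p, u), (p, v)] = word_kernel l [(p, u + v)]"
proof -
  have "letter l (p, u + v) = letter l (p, u) + letter l (p, v)"
    by (rule poly_mapping_eqI) (simp add: letter_def lookup_add algebra_simps)
  moreover have "bch l (letter l (p, u)) (letter l (p, v)) = letter l (p, u) + letter l (p, v)"
    by (simp add: bch_commuting quot_carrier_letter quot_bracket_parallel form_simps)
  ultimately show ?thesis by (metis exp_kernel_bch mult.right_neutral word_kernel_Cons word_kernel_Nil)
qed

lemma letter_trivial: "letter l (p, 0) = 0"
  by (rule poly_mapping_eqI) (simp add: letter_def)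

lemma letter_high:
  assumes "ndeg (fst x) > l"
  shows "letter l x = 0"
proof -
  have "{j. 1 \<le> j \<and> j * ndeg (fst x) \<le> l} = {}"
  proof -
    have "ndeg (fst x) \<le> j * ndeg (fst x)" if "1 \<le> j" for j using that by simp
    then show ?thesis using assms by (auto simp: not_le intro: order_less_le_trans)
  qed
  then have "dilog (fst x) l = 0" unfolding dilog_def by (simp only: sum.empty)
  then show ?thesis by (simp add: letter_def)
qed

lemma letter_top:
  assumes "ndeg p = l" "l > 0"
  shows "letter l (p, u) = Poly_Mapping.single p u"
proof -
  have "{j. 1 \<le> j \<and> j * ndeg p \<le> l} = {1}"
    using assms by (auto simp: le_antisym)
  then have "dilog p l = Poly_Mapping.single p 1" unfolding dilog_def by simp
  then show ?thesis by (intro poly_mapping_eqI) (simp add: letter_def lookup_single when_def)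
qed

lemma word_kernel_trivial: "(\<And>x. x \<in> set w \<Longrightarrow> letter l x = 0) \<Longrightarrow> word_kernel l w = 1"
  by (induction w) (auto simp: exp_kernel_zero)

section \<open>Compatibility with truncation\<close>

lemma trunc_add: "trunc l (X + Y) = trunc l X + trunc l Y"
  by (rule poly_mapping_eqI) (simp add: lookup_trunc lookup_add)

lemma trunc_scale: "trunc l (lie_scale c X) = lie_scale c (trunc l X)"
  by (rule poly_mapping_eqI) (simp add: lookup_trunc)

lemma quot_carrier_trunc: "X \<in> quot_carrier l \<Longrightarrow> trunc l' X \<in> quot_carrier l'"
  by (auto simp: quot_carrier_iff lookup_trunc)

lemma trunc_bracket:
  assumes "l' \<le> l"
  shows "trunc l' (quot_bracket l X Y) = quot_bracket l' (trunc l' X) (trunc l' Y)"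
proof (rule poly_mapping_eqI)
  fix r
  have "ndeg p \<le> l' \<and> ndeg (r - p) \<le> l'" if "ndeg r \<le> l'" "p \<in> box r" for p
    using that ndeg_box[of p r] by simp
  then show "Poly_Mapping.lookup (trunc l' (quot_bracket l X Y)) r =
     Poly_Mapping.lookup (quot_bracket l' (trunc l' X) (trunc l' Y)) r"
    using assms by (auto simp: lookup_trunc lookup_quot_bracket intro!: sum.cong)
qed

lemma trunc_bch:
  assumes "l' \<le> l" "X \<in> quot_carrier l" "Y \<in> quot_carrier l"
  shows "trunc l' (bch l X Y) = bch l' (trunc l' X) (trunc l' Y)"
  by (rule bch_hom) (use assms in \<open>auto simp: trunc_add trunc_scale trunc_bracket quot_carrier_trunc\<close>)

lemma trunc_sum: "trunc l (sum f S) = (\<Sum>x\<in>S. trunc l (f x))"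
  by (induction S rule: infinite_finite_induct) (auto simp: trunc_add, (rule poly_mapping_eqI, simp add: lookup_trunc)+)

lemma trunc_single: "trunc l (Poly_Mapping.single p a) = (if ndeg p \<le> l then Poly_Mapping.single p a else 0)"
  by (rule poly_mapping_eqI) (auto simp: lookup_trunc lookup_single when_def)

lemma finite_multiples: "p \<noteq> 0 \<Longrightarrow> finite {j. 1 \<le> j \<and> j * ndeg p \<le> l}"
proof (rule finite_subset)
  assume "p \<noteq> 0"
  then have "1 \<le> ndeg p" using ndeg_eq_0_iff[of p] by simp
  then have "j \<le> j * ndeg p" for j by simp
  then show "{j. 1 \<le> j \<and> j * ndeg p \<le> l} \<subseteq> {..l}"
    using le_trans by blast
qed simp

lemma trunc_letter:
  assumes "l' \<le> l"
  shows "trunc l' (letter l x) = letter l' x"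
proof (cases "fst x = 0")
  case True
  then show ?thesis by (intro poly_mapping_eqI) (simp add: letter_def dilog_zero lookup_trunc)
next
  case False
  have n: "ndeg (j * fst (fst x), j * snd (fst x)) = j * ndeg (fst x)" for j
    by (simp add: ndeg_def algebra_simps)
  have "trunc l' (dilog (fst x) l) = dilog (fst x) l'"
    unfolding dilog_def trunc_sum trunc_single n
    using assms finite_multiples[OF False, of l] by (intro sum.mono_neutral_cong_right) auto
  then show ?thesis by (simp add: letter_def trunc_scale)
qed

lemma trunc_word_value:
  assumes "l' \<le> l"
  shows "trunc l' (word_value l w) = word_value l' w"
  by (induction w)
     (auto simp: trunc_bch assms quot_carrier_letter quot_carrier_word_value trunc_letter,
       rule poly_mapping_eqI, simp add: lookup_trunc)

section \<open>Linear maps X_p \<mapsto> \<gamma>(p) X_\<theta>(p)\<close>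

definition monomial_map :: "(nat \<times> nat \<Rightarrow> rat) \<Rightarrow> (nat \<times> nat \<Rightarrow> nat \<times> nat) \<Rightarrow> lie \<Rightarrow> lie" where
  "monomial_map \<gamma> \<theta> X =
    (\<Sum>p\<in>Poly_Mapping.keys X. Poly_Mapping.single (\<theta> p) (\<gamma> p * Poly_Mapping.lookup X p))"

lemma monomial_map_superset:
  assumes "finite S" "Poly_Mapping.keys X \<subseteq> S"
  shows "monomial_map \<gamma> \<theta> X = (\<Sum>p\<in>S. Poly_Mapping.single (\<theta> p) (\<gamma> p * Poly_Mapping.lookup X p))"
  unfolding monomial_map_def by (rule sum.mono_neutral_left) (use assms in \<open>auto simp: in_keys_iff\<close>)

lemma monomial_map_add: "monomial_map \<gamma> \<theta> (X + Y) = monomial_map \<gamma> \<theta> X + monomial_map \<gamma> \<theta> Y"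
proof -
  let ?S = "Poly_Mapping.keys X \<union> Poly_Mapping.keys Y"
  show ?thesis
    using keys_add[of X Y]
    by (simp add: monomial_map_superset[of ?S] lookup_add distrib_left single_add sum.distrib)
qed

lemma monomial_map_single: "monomial_map \<gamma> \<theta> (Poly_Mapping.single p a) = Poly_Mapping.single (\<theta> p) (\<gamma> p * a)"
  by (subst monomial_map_superset[of "{p}"]) auto

lemma monomial_map_zero: "monomial_map \<gamma> \<theta> 0 = 0"
  by (simp add: monomial_map_def)

lemma monomial_map_sum: "monomial_map \<gamma> \<theta> (sum f S) = (\<Sum>x\<in>S. monomial_map \<gamma> \<theta> (f x))"
  by (induction S rule: infinite_finite_induct) (auto simp: monomial_map_add monomial_map_zero)

lemma lie_scale_single: "lie_scale c (Poly_Mapping.single p a) = Poly_Mapping.single p (c * a)"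
  by (rule poly_mapping_eqI) (simp add: lookup_single when_def)

lemma lie_scale_sum: "lie_scale c (sum f S) = (\<Sum>x\<in>S. lie_scale c (f x))"
  by (rule poly_mapping_eqI) (simp add: lookup_sum sum_distrib_left)

lemma monomial_map_scale: "monomial_map \<gamma> \<theta> (lie_scale c X) = lie_scale c (monomial_map \<gamma> \<theta> X)"
proof -
  have "Poly_Mapping.keys (lie_scale c X) \<subseteq> Poly_Mapping.keys X" by (auto simp: in_keys_iff)
  then show ?thesis
    by (simp add: monomial_map_superset[of "Poly_Mapping.keys X"] lie_scale_sum lie_scale_single mult.left_commute)
qed

lemma lie_bracket_add:
  "lie_bracket (X + X') Y = lie_bracket X Y + lie_bracket X' Y"
  "lie_bracket X (Y + Y') = lie_bracket X Y + lie_bracket X Y'"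
  by (rule poly_mapping_eqI, simp add: lookup_lie_bracket lookup_add algebra_simps sum.distrib)+

lemma lie_bracket_sum:
  "lie_bracket (sum f S) (sum g T) = (\<Sum>x\<in>S. \<Sum>y\<in>T. lie_bracket (f x) (g y))"
proof -
  have z: "lie_bracket 0 Y = 0" "lie_bracket Y 0 = 0" for Y
    by (simp_all add: lie_bracket_def)
  have "lie_bracket X (sum g T) = (\<Sum>y\<in>T. lie_bracket X (g y))" for X
    by (induction T rule: infinite_finite_induct) (auto simp: z lie_bracket_add)
  then show ?thesis
    by (induction S rule: infinite_finite_induct) (auto simp: z lie_bracket_add sum.distrib)
qed

lemma lie_bracket_single:
  "lie_bracket (Poly_Mapping.single p a) (Poly_Mapping.single q b) = Poly_Mapping.single (p + q) (of_int (form p q) * a * b)"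
  by (simp add: lie_bracket_def)

text \<open>\<open>hom\<close> is the homomorphism condition on basis elements, with c standing for
  the product of the two coefficients. It compares whole elements including truncation, so that the
  two sides may vanish for different reasons, one by a zero of \<gamma> and the other by its
  degree.\<close>

lemma monomial_map_bracket:
  assumes X: "X \<in> quot_carrier l" and Y: "Y \<in> quot_carrier l"
    and hom: "\<And>p q c. p \<noteq> 0 \<Longrightarrow> q \<noteq> 0 \<Longrightarrow>
      (if ndeg (p + q) \<le> l then Poly_Mapping.single (\<theta> (p + q)) (\<gamma> (p + q) * of_int (form p q) * c) else 0) =
      (if ndeg (\<theta> p + \<theta> q) \<le> l
       then Poly_Mapping.single (\<theta> p + \<theta> q) (of_int (form (\<theta> p) (\<theta> q)) * \<gamma> p * \<gamma> q * c) else 0)"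
  shows "monomial_map \<gamma> \<theta> (quot_bracket l X Y) = quot_bracket l (monomial_map \<gamma> \<theta> X) (monomial_map \<gamma> \<theta> Y)"
proof -
  let ?x = "Poly_Mapping.lookup X" and ?y = "Poly_Mapping.lookup Y"
  have "monomial_map \<gamma> \<theta> (quot_bracket l X Y) = (\<Sum>p\<in>Poly_Mapping.keys X. \<Sum>q\<in>Poly_Mapping.keys Y.
     (if ndeg (p + q) \<le> l then Poly_Mapping.single (\<theta> (p + q)) (\<gamma> (p + q) * of_int (form p q) * (?x p * ?y q)) else 0))"
    unfolding quot_bracket_def lie_bracket_def trunc_sum monomial_map_sum trunc_single
    by (intro sum.cong refl) (simp add: monomial_map_single monomial_map_zero mult.assoc)
  also have "\<dots> = (\<Sum>p\<in>Poly_Mapping.keys X. \<Sum>q\<in>Poly_Mapping.keys Y.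
     (if ndeg (\<theta> p + \<theta> q) \<le> l
       then Poly_Mapping.single (\<theta> p + \<theta> q) (of_int (form (\<theta> p) (\<theta> q)) * \<gamma> p * \<gamma> q * (?x p * ?y q)) else 0))"
    using X Y by (intro sum.cong refl hom) (auto simp: quot_carrier_iff Nplus_iff in_keys_iff)
  also have "\<dots> = quot_bracket l (monomial_map \<gamma> \<theta> X) (monomial_map \<gamma> \<theta> Y)"
    unfolding quot_bracket_def monomial_map_def lie_bracket_sum lie_bracket_single trunc_sum trunc_single
    by (intro sum.cong refl if_cong) (simp add: algebra_simps)
  finally show ?thesis .
qed

lemma monomial_map_word_value:
  assumes hom: "\<And>p q c. p \<noteq> 0 \<Longrightarrow> q \<noteq> 0 \<Longrightarrow>
      (if ndeg (p + q) \<le> l then Poly_Mapping.single (\<theta> (p + q)) (\<gamma> (p + q) * of_int (form p q) * c) else 0) =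
      (if ndeg (\<theta> p + \<theta> q) \<le> l
       then Poly_Mapping.single (\<theta> p + \<theta> q) (of_int (form (\<theta> p) (\<theta> q)) * \<gamma> p * \<gamma> q * c) else 0)"
    and deg: "\<And>p. p \<noteq> 0 \<Longrightarrow> \<gamma> p \<noteq> 0 \<Longrightarrow> \<theta> p \<noteq> 0 \<and> ndeg (\<theta> p) \<le> l"
    and letters: "\<And>x. x \<in> set w \<Longrightarrow> monomial_map \<gamma> \<theta> (letter l x) = letter l (f x)"
  shows "monomial_map \<gamma> \<theta> (word_value l w) = word_value l (map f w)"
proof -
  have carrier: "monomial_map \<gamma> \<theta> X \<in> quot_carrier l" if "X \<in> quot_carrier l" for X
    unfolding monomial_map_def
  proof (rule quot_carrier_sum)
    fix p assume "p \<in> Poly_Mapping.keys X"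
    then have "p \<noteq> 0" using that by (auto simp: quot_carrier_iff Nplus_iff in_keys_iff)
    then show "Poly_Mapping.single (\<theta> p) (\<gamma> p * Poly_Mapping.lookup X p) \<in> quot_carrier l"
      using deg[of p] by (cases "\<gamma> p = 0") (auto simp: quot_carrier_zero quot_carrier_iff lookup_single when_def Nplus_iff)
  qed
  have "monomial_map \<gamma> \<theta> (bch l X Y) = bch l (monomial_map \<gamma> \<theta> X) (monomial_map \<gamma> \<theta> Y)"
    if "X \<in> quot_carrier l" "Y \<in> quot_carrier l" for X Y
    by (rule bch_hom) (use that carrier monomial_map_bracket[OF _ _ hom] in \<open>auto simp: monomial_map_add monomial_map_scale\<close>)
  then show ?thesis using letters
    by (induction w) (auto simp: monomial_map_zero quot_carrier_letter quot_carrier_word_value)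
qed

section \<open>Ordered factorisations\<close>

lemma ndeg_pos: "p \<noteq> 0 \<Longrightarrow> 0 < ndeg p"
  using ndeg_eq_0_iff[of p] by simp

lemma form_antisym: "form q p = - form p q"
  by (simp add: form_def)

text \<open>The Pluecker relation \<open>{p, r} q = {p, q} r + {q, r} p\<close>, in degrees.\<close>

lemma form_plucker: "form p r * int (ndeg q) = form p q * int (ndeg r) + form q r * int (ndeg p)"
  by (simp add: form_def ndeg_def algebra_simps)

text \<open>Since deg q is positive, \<open>form_plucker\<close> exhibits a positive multiple of {p,
  r} as a nonnegative combination of {p, q} and {q, r}.\<close>

lemma form_trans:
  assumes "q \<noteq> 0" "form p q \<le> 0" "form q r \<le> 0"
  shows "form p r \<le> 0"
proof -
  have "form p r * int (ndeg q) \<le> 0"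
    using assms form_plucker[of p r q] by (simp add: mult_nonpos_nonneg add_nonpos_nonpos)
  moreover have "ndeg q > 0" using assms ndeg_eq_0_iff[of q] by simp
  ultimately show ?thesis by (simp add: mult_le_0_iff)
qed

lemma form_trans_less:
  assumes "p \<noteq> 0" "q \<noteq> 0" "r \<noteq> 0" "form p q \<le> 0" "form q r \<le> 0" "form p q < 0 \<or> form q r < 0"
  shows "form p r < 0"
proof -
  have pos: "ndeg p > 0" "ndeg q > 0" "ndeg r > 0" using assms by (simp_all add: ndeg_pos)
  have "form p q * int (ndeg r) \<le> 0" "form q r * int (ndeg p) \<le> 0"
    using assms by (simp_all add: mult_nonpos_nonneg)
  moreover have "form p q * int (ndeg r) < 0 \<or> form q r * int (ndeg p) < 0"
    using assms(6) pos by (auto simp: mult_less_0_iff)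
  ultimately have "form p r * int (ndeg q) < 0"
    using form_plucker[of p r q] by linarith
  then show ?thesis using pos by (simp add: mult_less_0_iff)
qed

lemma form_zero_proportional:
  assumes "form p q = 0"
  shows "int (ndeg p) * int (fst q) = int (ndeg q) * int (fst p)"
    "int (ndeg p) * int (snd q) = int (ndeg q) * int (snd p)"
  using assms by (simp_all add: form_def ndeg_def algebra_simps)

text \<open>For parallel points the rational factor k in \<open>nle\<close> is the ratio of the
  degrees, and parallel points of equal degree coincide.\<close>

lemma nless_iff:
  assumes "p \<noteq> 0" "q \<noteq> 0"
  shows "nless p q \<longleftrightarrow> form p q < 0 \<or> (form p q = 0 \<and> ndeg p < ndeg q)"
proof -
  have pos: "ndeg p > 0" "ndeg q > 0" using assms by (simp_all add: ndeg_pos)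
  have eq: "p = q" if "form p q = 0" "ndeg p = ndeg q"
    using form_zero_proportional[OF that(1)] that(2) pos by (simp add: prod_eq_iff)
  have scaled: "form p q = 0 \<and> ndeg p \<le> ndeg q"
    if "k \<ge> 1" "of_nat (fst q) = k * of_nat (fst p)" "of_nat (snd q) = k * of_nat (snd p)" for k :: rat
  proof -
    have "(of_int (form p q) :: rat) = 0" using that(2,3) by (simp add: form_def)
    then have "form p q = 0" by (simp only: of_int_eq_0_iff)
    moreover have "(of_nat (ndeg q) :: rat) = k * of_nat (ndeg p)"
      using that(2,3) by (simp add: ndeg_def distrib_left)
    then have "(of_nat (ndeg p) :: rat) \<le> of_nat (ndeg q)"
      using that(1) mult_right_mono[of 1 k "of_nat (ndeg p)"] by simp
    ultimately show ?thesis by simp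
  qed
  have conv: "\<exists>k::rat. k \<ge> 1 \<and> of_nat (fst q) = k * of_nat (fst p) \<and> of_nat (snd q) = k * of_nat (snd p)"
    if "form p q = 0" "ndeg p < ndeg q"
  proof (intro exI conjI)
    let ?k = "of_nat (ndeg q) / of_nat (ndeg p) :: rat"
    show "?k \<ge> 1" using that pos by (simp add: field_simps)
    have "of_int (int (ndeg p) * int (fst q)) = (of_int (int (ndeg q) * int (fst p)) :: rat)"
      "of_int (int (ndeg p) * int (snd q)) = (of_int (int (ndeg q) * int (snd p)) :: rat)"
      using form_zero_proportional[OF that(1)] by simp_all
    then show "of_nat (fst q) = ?k * of_nat (fst p)" "of_nat (snd q) = ?k * of_nat (snd p)"
      using pos by (simp_all add: field_simps)
  qed
  show ?thesis
    unfolding nless_def nle_def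
    using eq scaled conv form_simps(5)[of p] by (metis le_neq_implies_less less_irrefl)
qed

lemma nless_total: "p \<noteq> 0 \<Longrightarrow> q \<noteq> 0 \<Longrightarrow> p \<noteq> q \<Longrightarrow> nless p q \<or> nless q p"
proof -
  assume *: "p \<noteq> 0" "q \<noteq> 0" "p \<noteq> q"
  have "ndeg p \<noteq> ndeg q" if "form p q = 0"
  proof
    assume "ndeg p = ndeg q"
    then show False using form_zero_proportional[OF that] * ndeg_eq_0_iff by (auto simp: prod_eq_iff)
  qed
  then show ?thesis using * by (auto simp: nless_iff form_antisym[of q p])
qed

lemma nless_irrefl: "\<not> nless p p"
  by (simp add: nless_def)

lemma nless_asym: "p \<noteq> 0 \<Longrightarrow> q \<noteq> 0 \<Longrightarrow> nless p q \<Longrightarrow> \<not> nless q p"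
  by (auto simp: nless_iff form_antisym[of q p])

lemma nless_trans: "p \<noteq> 0 \<Longrightarrow> q \<noteq> 0 \<Longrightarrow> r \<noteq> 0 \<Longrightarrow> nless p q \<Longrightarrow> nless q r \<Longrightarrow> nless p r"
  using form_trans_less[of p q r] form_trans[of q p r] form_trans[of q r p]
  by (auto simp: nless_iff form_antisym[of r q] form_antisym[of q p] form_antisym[of r p])

lemma nless_sorted_unique:
  assumes "sorted_wrt nless xs" "sorted_wrt nless ys" "set xs = set ys" "0 \<notin> set xs"
  shows "xs = ys"
  using assms
proof (induction xs arbitrary: ys)
  case (Cons x xs)
  have "ys \<noteq> []" using Cons.prems(3) by auto
  then obtain y ys' where ys: "ys = y # ys'" using list.exhaust by blast
  have X: "\<forall>z\<in>set xs. nless x z" "sorted_wrt nless xs" using Cons.prems(1) by simp_all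
  have Y: "\<forall>z\<in>set ys'. nless y z" "sorted_wrt nless ys'" using Cons.prems(2) unfolding ys by simp_all
  have S: "insert x (set xs) = insert y (set ys')" using Cons.prems(3) unfolding ys by (simp only: list.set)
  have x: "x \<noteq> 0" and xs: "0 \<notin> set xs" using Cons.prems(4) by auto
  have "y \<in> insert x (set xs)" unfolding S by simp
  then have y: "y \<noteq> 0" using x xs by blast
  have "x = y"
  proof (rule ccontr)
    assume "x \<noteq> y"
    moreover have "x \<in> insert y (set ys')" unfolding S[symmetric] by simp
    ultimately have "x \<in> set ys'" "y \<in> set xs" using \<open>y \<in> insert x (set xs)\<close> by auto
    then have "nless x y" "nless y x" using X(1) Y(1) by simp_all
    then show False using nless_asym[OF x y] by simp
  qed
  moreover have "x \<notin> set xs" "y \<notin> set ys'" using X(1) Y(1) nless_irrefl[of x] nless_irrefl[of y] by auto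
  ultimately have "set xs = set ys'" using S insert_ident by metis
  then have "xs = ys'"
    using X(2) Y(2) xs by (intro Cons.IH)
  then show ?case using \<open>x = y\<close> ys by simp
qed simp

lemma nless_sorted_exists:
  assumes "finite S" "0 \<notin> S"
  shows "\<exists>ps. sorted_wrt nless ps \<and> set ps = S"
  using assms
proof (induction S rule: finite_induct)
  case (insert x S)
  then have "\<exists>ps. sorted_wrt nless ps \<and> set ps = S" by simp
  then obtain ps where ps: "sorted_wrt nless ps" "set ps = S" by blast
  let ?l = "filter (\<lambda>p. nless p x) ps" and ?g = "filter (\<lambda>p. nless x p) ps"
  have nz: "x \<noteq> 0" "p \<noteq> 0" if "p \<in> set ps \<or> p = x" for p using insert.prems ps(2) that by auto
  have "nless p q" if "p \<in> set ?l" "q \<in> set ?g" for p q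
    using that nz(2)[of p] nz(2)[of q] nz(2)[of x] nless_trans[of p x q] by simp
  moreover have "sorted_wrt nless ?l" "sorted_wrt nless ?g" using ps(1) by (rule sorted_wrt_filter)+
  ultimately have "sorted_wrt nless (?l @ x # ?g)"
    unfolding sorted_wrt_append sorted_wrt.simps by simp
  moreover have "set (?l @ x # ?g) = insert x S"
  proof
    show "insert x S \<subseteq> set (?l @ x # ?g)"
    proof
      fix p assume "p \<in> insert x S"
      then have "p = x \<or> (p \<in> set ps \<and> (nless x p \<or> nless p x))"
        using nless_total[of x p] nz(2)[of p] nz(2)[of x] ps(2) by blast
      then show "p \<in> set (?l @ x # ?g)" by auto
    qed
    show "set (?l @ x # ?g) \<subseteq> insert x S" using ps(2) by auto
  qed
  ultimately show ?case by (intro exI conjI)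
qed simp

lemma increasing_list:
  assumes "finite S" "0 \<notin> S"
  shows "sorted_wrt nless (increasing_list S)" "set (increasing_list S) = S"
proof -
  have "\<exists>!ps. sorted_wrt nless ps \<and> set ps = S"
    using nless_sorted_exists[OF assms] nless_sorted_unique assms(2) by (intro ex_ex1I) auto
  from theI'[OF this] show "sorted_wrt nless (increasing_list S)" "set (increasing_list S) = S"
    by (simp_all add: increasing_list_def)
qed

lemma increasing_list_eqI:
  assumes "sorted_wrt nless ps" "0 \<notin> set ps"
  shows "increasing_list (set ps) = ps"
  using increasing_list[of "set ps"] assms by (intro nless_sorted_unique) auto

lemma distinct_nless: "sorted_wrt nless ps \<Longrightarrow> distinct ps"
  by (induction ps) (auto simp: nless_irrefl)

section \<open>Ordered words in a fixed truncation\<close>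

definition degree_upto :: "nat \<Rightarrow> (nat \<times> nat) set" where
  "degree_upto l = {p \<in> Nplus. ndeg p \<le> l}"

lemma finite_degree_upto: "finite (degree_upto l)"
  by (rule finite_subset[of _ "{..l} \<times> {..l}"]) (auto simp: degree_upto_def ndeg_def)

lemma degree_upto_nonzero: "0 \<notin> degree_upto l"
  by (simp add: degree_upto_def Nplus_iff)

lemmas degree_list = increasing_list[OF finite_degree_upto degree_upto_nonzero]

definition ordered_word :: "nat \<Rightarrow> (nat \<times> nat \<Rightarrow> rat) \<Rightarrow> ((nat \<times> nat) \<times> rat) list" where
  "ordered_word l u = map (\<lambda>p. (p, u p)) (increasing_list (degree_upto l))"

lemma ordered_product_eq: "ordered_product u l = word_value l (ordered_word l u)"
  by (simp add: ordered_product_def word_value_def ordered_word_def quot_group_def degree_upto_def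
      foldr_map o_def letter_def gpow_def)

lemma increasing_list_filter:
  assumes "l' \<le> l"
  shows "filter (\<lambda>p. ndeg p \<le> l') (increasing_list (degree_upto l)) = increasing_list (degree_upto l')"
proof -
  have "sorted_wrt nless (filter (\<lambda>p. ndeg p \<le> l') (increasing_list (degree_upto l)))"
    using degree_list by (auto simp: sorted_wrt_filter)
  moreover have "set (filter (\<lambda>p. ndeg p \<le> l') (increasing_list (degree_upto l))) = degree_upto l'"
    using degree_list assms by (auto simp: degree_upto_def)
  ultimately show ?thesis using increasing_list_eqI degree_upto_nonzero by metis
qed

lemma word_value_filter:
  assumes "\<And>x. x \<in> set w \<Longrightarrow> \<not> P x \<Longrightarrow> letter l x = 0"
  shows "word_value l (filter P w) = word_value l w"
  using assms by (induction w) (auto simp: bch_zero_left quot_carrier_word_value)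

lemma word_value_ordered_word_trunc:
  assumes "l' \<le> l"
  shows "word_value l' (ordered_word l u) = word_value l' (ordered_word l' u)"
proof -
  have "ordered_word l' u = filter (\<lambda>x. ndeg (fst x) \<le> l') (ordered_word l u)"
    unfolding ordered_word_def increasing_list_filter[OF assms, symmetric] by (simp add: filter_map o_def)
  then show ?thesis using word_value_filter[of "ordered_word l u" "\<lambda>x. ndeg (fst x) \<le> l'" l'] letter_high by simp
qed

text \<open>Brackets add degrees and every basis element has degree at least 1, so degree l is
  central modulo degree > l.\<close>

lemma central_bracket:
  assumes "X \<in> quot_carrier l" "\<And>p. Poly_Mapping.lookup C p \<noteq> 0 \<Longrightarrow> ndeg p = l"
  shows "quot_bracket l X C = 0"
proof (rule poly_mapping_eqI, rule ccontr)
  fix r assume "Poly_Mapping.lookup (quot_bracket l X C) r \<noteq> Poly_Mapping.lookup 0 r"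
  then have "Poly_Mapping.lookup (quot_bracket l X C) r \<noteq> 0" by simp
  then obtain p where p: "p \<in> box r" "Poly_Mapping.lookup X p \<noteq> 0" "Poly_Mapping.lookup C (r - p) \<noteq> 0"
     "ndeg r \<le> l" by (rule quot_bracket_nonzeroE)
  then have "ndeg p = 0" using ndeg_box[OF p(1)] assms(2)[of "r - p"] by simp
  then show False using p(2) assms(1) ndeg_eq_0_iff[of p] by (auto simp: quot_carrier_iff Nplus_iff)
qed

lemma bch_central:
  assumes X: "X \<in> quot_carrier l" and Y: "Y \<in> quot_carrier l"
    and C: "C \<in> quot_carrier l" "\<And>p. Poly_Mapping.lookup C p \<noteq> 0 \<Longrightarrow> ndeg p = l"
  shows "bch l X (Y + C) = bch l X Y + C" "bch l (X + C) Y = bch l X Y + C"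
proof -
  have c: "bch l Z C = Z + C" "bch l C Z = Z + C" if "Z \<in> quot_carrier l" for Z
    using that C(1) central_bracket[OF that C(2)] quot_bracket_antisym[of l C Z]
    by (simp_all add: bch_commuting add.commute)
  show "bch l X (Y + C) = bch l X Y + C"
    using bch_assoc[OF X Y C(1)] c quot_carrier_bch[OF X Y] Y by simp
  show "bch l (X + C) Y = bch l X Y + C"
    using bch_assoc[OF C(1) X Y] c quot_carrier_bch[OF X Y] X by simp
qed

lemma single_top_carrier:
  assumes "ndeg p = l" "l > 0"
  shows "Poly_Mapping.single p a \<in> quot_carrier l"
proof -
  have "p \<noteq> 0" using assms by (auto simp: ndeg_def)
  then show ?thesis using assms by (simp add: quot_carrier_iff lookup_single when_def Nplus_iff)
qed

lemma top_sum_degree: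
  "Poly_Mapping.lookup (\<Sum>x\<leftarrow>filter (\<lambda>x. ndeg (fst x) = l) w. Poly_Mapping.single (fst x) (snd x)) p \<noteq> (0::rat)
    \<Longrightarrow> ndeg p = l"
proof (induction w)
  case (Cons y w)
  then show ?case
    by (cases "ndeg (fst y) = l"; cases "p = fst y") (simp_all add: lookup_add lookup_single when_def)
qed simp

lemma top_sum_carrier:
  "l > 0 \<Longrightarrow> (\<Sum>x\<leftarrow>filter (\<lambda>x. ndeg (fst x) = l) w. Poly_Mapping.single (fst x) (snd x)) \<in> quot_carrier l"
  by (induction w) (simp_all add: quot_carrier_zero quot_carrier_add single_top_carrier)

text \<open>A letter of degree exactly l has logarithm u X_p, as its multiples j \<ge> 2 are cut
  off. Being central, it may be pulled out of the word and adds to the logarithm.\<close>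

lemma word_value_central:
  assumes "l > 0"
  shows "word_value l w = word_value l (filter (\<lambda>x. ndeg (fst x) \<noteq> l) w) +
    (\<Sum>x\<leftarrow>filter (\<lambda>x. ndeg (fst x) = l) w. Poly_Mapping.single (fst x) (snd x))"
proof (induction w)
  case (Cons x w)
  show ?case
  proof (cases "ndeg (fst x) = l")
    case True
    let ?S = "Poly_Mapping.single (fst x) (snd x)"
    have "letter l x = ?S"
      using letter_top[of "fst x" l "snd x"] True assms by simp
    moreover have "bch l (0 + ?S) (word_value l w) = bch l 0 (word_value l w) + ?S"
    proof (rule bch_central(2)[OF quot_carrier_zero quot_carrier_word_value single_top_carrier[OF True assms]])
      fix p assume "Poly_Mapping.lookup ?S p \<noteq> 0"
      then show "ndeg p = l" using True by (cases "p = fst x") (simp_all add: lookup_single when_def)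
    qed
    ultimately have "word_value l (x # w) = word_value l w + ?S"
      by (simp add: bch_zero_left quot_carrier_word_value)
    then show ?thesis using True Cons.IH by (simp add: add_ac)
  next
    case False
    let ?C = "\<Sum>x\<leftarrow>filter (\<lambda>x. ndeg (fst x) = l) w. Poly_Mapping.single (fst x) (snd x)"
    have "bch l (letter l x) (word_value l (filter (\<lambda>x. ndeg (fst x) \<noteq> l) w) + ?C) =
        bch l (letter l x) (word_value l (filter (\<lambda>x. ndeg (fst x) \<noteq> l) w)) + ?C"
      by (rule bch_central(1)[OF quot_carrier_letter quot_carrier_word_value top_sum_carrier[OF assms]])
         (rule top_sum_degree)
    then show ?thesis using False Cons.IH by simp
  qed
qed simp

lemma lookup_top_sum:
  assumes "p \<in> degree_upto l" "ndeg p = l"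
  shows "Poly_Mapping.lookup (\<Sum>x\<leftarrow>filter (\<lambda>x. ndeg (fst x) = l) (ordered_word l u). Poly_Mapping.single (fst x) (snd x)) p = u p"
proof -
  let ?ps = "filter (\<lambda>p. ndeg p = l) (increasing_list (degree_upto l))"
  have d: "distinct ?ps" using distinct_nless[OF degree_list(1)] by simp
  have "(\<Sum>x\<leftarrow>filter (\<lambda>x. ndeg (fst x) = l) (ordered_word l u). Poly_Mapping.single (fst x) (snd x)) =
    (\<Sum>q\<in>set ?ps. Poly_Mapping.single q (u q))"
    using sum_list_distinct_conv_sum_set[OF d, of "\<lambda>q. Poly_Mapping.single q (u q)"]
    by (simp add: ordered_word_def filter_map o_def)
  moreover have "p \<in> set ?ps" using assms degree_list by simp
  ultimately show ?thesis by (simp add: lookup_sum lookup_single when_def)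
qed

lemma ordered_word_lower:
  assumes "l > 0"
  shows "filter (\<lambda>x. ndeg (fst x) \<noteq> l) (ordered_word l u) = ordered_word (l - 1) u"
proof -
  have "filter (\<lambda>p. ndeg p \<noteq> l) (increasing_list (degree_upto l)) =
     filter (\<lambda>p. ndeg p \<le> l - 1) (increasing_list (degree_upto l))"
    by (rule filter_cong) (use degree_list assms in \<open>auto simp: degree_upto_def\<close>)
  then show ?thesis
    using increasing_list_filter[of "l - 1" l]
    by (simp add: ordered_word_def filter_map o_def)
qed

lemma ordered_word_cong: "(\<And>p. p \<in> degree_upto l \<Longrightarrow> u p = v p) \<Longrightarrow> ordered_word l u = ordered_word l v"
  using degree_list by (simp add: ordered_word_def)

lemma degree_upto_0: "degree_upto 0 = {}"
  by (auto simp: degree_upto_def Nplus_iff ndeg_eq_0_iff)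

text \<open>Truncation to level l determines the exponents of degree at most l; once these agree,
  the exponents of degree l + 1 are the coefficients of the central summand.\<close>

lemma ordered_word_unique:
  assumes "word_value l (ordered_word l u) = word_value l (ordered_word l v)" "p \<in> degree_upto l"
  shows "u p = v p"
proof -
  have "word_value l (ordered_word l u) = word_value l (ordered_word l v) \<longrightarrow> (\<forall>p\<in>degree_upto l. u p = v p)"
  proof (induction l)
    case 0
    show ?case unfolding degree_upto_0 by (rule impI, rule ballI, erule emptyE)
  next
    case (Suc l)
    show ?case
    proof (intro impI ballI)
      fix p assume prem: "word_value (Suc l) (ordered_word (Suc l) u) = word_value (Suc l) (ordered_word (Suc l) v)"
        and p: "p \<in> degree_upto (Suc l)"
      have "word_value l (ordered_word l z) = trunc l (word_value (Suc l) (ordered_word (Suc l) z))" for z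
        by (simp add: trunc_word_value word_value_ordered_word_trunc[of l "Suc l"])
      then have "word_value l (ordered_word l u) = word_value l (ordered_word l v)"
        using prem by simp
      then have low: "u q = v q" if "q \<in> degree_upto l" for q using Suc.IH that by blast
      show "u p = v p"
      proof (cases "ndeg p \<le> l")
        case True
        then have "p \<in> degree_upto l" using p by (simp add: degree_upto_def)
        then show ?thesis by (rule low)
      next
        case False
        then have deg: "ndeg p = Suc l" using p by (simp add: degree_upto_def)
        have eq: "ordered_word l u = ordered_word l v" using low by (rule ordered_word_cong)
        let ?C = "\<lambda>z. \<Sum>x\<leftarrow>filter (\<lambda>x. ndeg (fst x) = Suc l) (ordered_word (Suc l) z).
          Poly_Mapping.single (fst x) (snd x)"
        have split: "word_value (Suc l) (ordered_word (Suc l) z) = word_value (Suc l) (ordered_word l z) + ?C z" for z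
          by (subst word_value_central) (simp_all only: ordered_word_lower zero_less_Suc diff_Suc_1)
        have "?C u = ?C v"
          using prem unfolding split eq by (rule add_left_imp_eq)
        then have "Poly_Mapping.lookup (?C u) p = Poly_Mapping.lookup (?C v) p" by (rule arg_cong)
        then show ?thesis unfolding lookup_top_sum[OF p deg] .
      qed
    qed
  qed
  then show ?thesis using assms by blast
qed

text \<open>An ordered product that is correct at level l fails at level l + 1 only in degree l + 1.
  This defect is central, so it is absorbed by the exponents of degree l + 1.\<close>

lemma ordered_word_exists:
  assumes "\<And>l. g l \<in> quot_carrier l" "\<And>l. trunc l (g (Suc l)) = g l"
  shows "\<exists>u. word_value l (ordered_word l u) = g l"
proof (induction l)
  case 0
  have "Z = 0" if "Z \<in> quot_carrier 0" for Z
    by (rule poly_mapping_eqI) (use that in \<open>auto simp: quot_carrier_iff ndeg_eq_0_iff Nplus_iff\<close>)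
  then show ?case using assms(1)[of 0] quot_carrier_word_value[of 0] by metis
next
  case (Suc l)
  then obtain u where u: "word_value l (ordered_word l u) = g l" by blast
  define Y where "Y = word_value (Suc l) (ordered_word l u)"
  have "trunc l Y = g l"
    unfolding Y_def using u by (simp add: trunc_word_value)
  then have low: "Poly_Mapping.lookup Y p = Poly_Mapping.lookup (g (Suc l)) p" if "ndeg p \<le> l" for p
    using that assms(2)[of l] lookup_trunc[of l Y p] lookup_trunc[of l "g (Suc l)" p] by simp
  have Y: "Y \<in> quot_carrier (Suc l)" by (simp add: Y_def quot_carrier_word_value)
  define v where "v = (\<lambda>p. if ndeg p = Suc l then Poly_Mapping.lookup (g (Suc l)) p - Poly_Mapping.lookup Y p else u p)"
  have "ordered_word l v = ordered_word l u"
    by (rule ordered_word_cong) (simp add: v_def degree_upto_def)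
  then have v: "word_value (Suc l) (ordered_word (Suc l) v) = Y +
      (\<Sum>x\<leftarrow>filter (\<lambda>x. ndeg (fst x) = Suc l) (ordered_word (Suc l) v). Poly_Mapping.single (fst x) (snd x))"
    (is "_ = Y + ?C")
    unfolding Y_def by (subst word_value_central) (simp_all only: ordered_word_lower zero_less_Suc diff_Suc_1)
  have "word_value (Suc l) (ordered_word (Suc l) v) = g (Suc l)"
  proof (rule poly_mapping_eqI)
    fix p
    consider "p = 0 \<or> ndeg p > Suc l" | "ndeg p \<le> l" "p \<noteq> 0" | "p \<in> degree_upto (Suc l)" "ndeg p = Suc l"
      by (auto simp: degree_upto_def Nplus_iff) linarith
    then show "Poly_Mapping.lookup (word_value (Suc l) (ordered_word (Suc l) v)) p = Poly_Mapping.lookup (g (Suc l)) p"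
    proof cases
      case 1
      then have "Poly_Mapping.lookup Z p = 0" if "Z \<in> quot_carrier (Suc l)" for Z
        using that unfolding quot_carrier_iff Nplus_iff by (metis not_le)
      then show ?thesis using assms(1) quot_carrier_word_value by simp
    next
      case 2
      have "Poly_Mapping.lookup (word_value (Suc l) (ordered_word (Suc l) v)) p =
          Poly_Mapping.lookup (trunc l (word_value (Suc l) (ordered_word (Suc l) v))) p"
        using 2 by (simp add: lookup_trunc)
      also have "trunc l (word_value (Suc l) (ordered_word (Suc l) v)) = word_value l (ordered_word l v)"
        by (simp add: trunc_word_value word_value_ordered_word_trunc[of l "Suc l"])
      also have "\<dots> = g l" using \<open>ordered_word l v = _\<close> u by simp
      finally show ?thesis using assms(2)[of l] 2 lookup_trunc[of l "g (Suc l)" p] by simp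
    next
      case 3
      then show ?thesis using lookup_top_sum[OF 3, of v] v by (simp add: lookup_add v_def)
    qed
  qed
  then show ?case by blast
qed

definition initial_word :: "nat \<Rightarrow> nat \<Rightarrow> ((nat \<times> nat) \<times> rat) list" where
  "initial_word m n = [((0, 1), of_nat n), ((1, 0), of_nat m)]"

text \<open>The exponents found at the individual levels agree by uniqueness and glue to one
  function, the only one meeting the description in \<open>uexp\<close>. From here on
  \<open>uexp\<close> is accessible through finite words.\<close>

theorem uexp_ordered_word:
  "word_value l (ordered_word l (\<lambda>p. uexp p m n)) = word_value l (initial_word m n)"
proof -
  define g where "g l = word_value l (initial_word m n)" for l
  have init: "g = gpow (dilog (0, 1)) (of_nat n) \<otimes>\<^bsub>structure_group\<^esub> gpow (dilog (1, 0)) (of_nat m)"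
    by (rule ext) (simp add: g_def initial_word_def structure_group_def quot_group_def gpow_def
      bch_zero_right quot_carrier_letter, simp add: letter_def)
  have "\<forall>l. \<exists>u. word_value l (ordered_word l u) = g l"
    using ordered_word_exists[of g] by (simp add: g_def quot_carrier_word_value trunc_word_value)
  then obtain U where U: "\<And>l. word_value l (ordered_word l (U l)) = g l" by metis
  have compat: "U l p = U l' p" if "l' \<le> l" "p \<in> degree_upto l'" for l l' p
  proof -
    have "word_value l' (ordered_word l' (U l)) = trunc l' (g l)"
      using that by (simp add: U[symmetric] trunc_word_value word_value_ordered_word_trunc[OF that(1)])
    also have "\<dots> = g l'" using that by (simp add: g_def trunc_word_value)
    finally have "word_value l' (ordered_word l' (U l)) = word_value l' (ordered_word l' (U l'))" using U by simp
    then show ?thesis using that(2) by (rule ordered_word_unique)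
  qed
  \<comment> \<open>\<open>ndeg p\<close> is the lowest level in which p occurs; the value 0 at p =
    0 is the normalisation in \<open>uexp\<close>.\<close>
  define u where "u p = (if p = 0 then 0 else U (ndeg p) p)" for p
  have u: "word_value l (ordered_word l u) = g l" for l
  proof -
    have "ordered_word l u = ordered_word l (U l)"
    proof (rule ordered_word_cong)
      fix p assume "p \<in> degree_upto l"
      then show "u p = U l p"
        using compat[of "ndeg p" l p] by (simp add: u_def degree_upto_def Nplus_iff)
    qed
    then show ?thesis using U by simp
  qed
  have uniq: "v = u" if "v (0, 0) = 0" "g = ordered_product v" for v
  proof
    fix p
    show "v p = u p"
    proof (cases "p = 0")
      case True
      then show ?thesis using that by (simp add: u_def zero_prod_def)
    next
      case False
      have "word_value (ndeg p) (ordered_word (ndeg p) v) = word_value (ndeg p) (ordered_word (ndeg p) u)"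
        using that(2) u[of "ndeg p"] ordered_product_eq[of v "ndeg p"] by simp
      then show ?thesis by (rule ordered_word_unique) (simp add: degree_upto_def Nplus_iff False)
    qed
  qed
  have "(THE u. u (0, 0) = 0 \<and> g = ordered_product u) = u"
  proof (rule the_equality)
    show "u (0, 0) = 0 \<and> g = ordered_product u"
      using u by (auto simp: u_def zero_prod_def ordered_product_eq)
  qed (use uniq in blast)
  then have "(\<lambda>p. uexp p m n) = u" unfolding uexp_def init[symmetric] by simp
  then show ?thesis using u by (simp add: g_def)
qed

section \<open>Action of a dilogarithm element on monomials\<close>

definition nscale :: "nat \<Rightarrow> nat \<times> nat \<Rightarrow> nat \<times> nat" where
  "nscale j p = (j * fst p, j * snd p)"

lemma nscale_simps [simp]: "fst (nscale j p) = j * fst p" "snd (nscale j p) = j * snd p" "nscale 0 p = 0"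
  by (simp_all add: nscale_def zero_prod_def)

lemma ndeg_nscale [simp]: "ndeg (nscale j p) = j * ndeg p"
  by (simp add: ndeg_def algebra_simps)

lemma nscale_add: "nscale (i + j) p = nscale i p + nscale j p"
  by (simp add: prod_eq_iff algebra_simps)

lemma nscale_inject: "p \<noteq> 0 \<Longrightarrow> nscale i p = nscale j p \<longleftrightarrow> i = j"
  by (auto simp: nscale_def prod_eq_iff)

lemma form_nscale: "form (nscale j p) m = int j * form p m" "form m (nscale j p) = int j * form m p"
  by (simp_all add: form_def algebra_simps)

lemma lookup_dilog:
  assumes "p \<noteq> 0" "1 \<le> j" "j * ndeg p \<le> l"
  shows "Poly_Mapping.lookup (dilog p l) (nscale j p) = (-1) ^ (j + 1) / of_nat j ^ 2"
proof -
  have "Poly_Mapping.lookup (dilog p l) (nscale j p) =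
     (\<Sum>i\<in>{j. 1 \<le> j \<and> j * ndeg p \<le> l}. if i = j then (-1) ^ (j + 1) / of_nat j ^ 2 else 0)"
    unfolding dilog_def lookup_sum nscale_def[symmetric]
    by (intro sum.cong) (auto simp: lookup_single when_def nscale_inject[OF assms(1)])
  then show ?thesis using assms finite_multiples[OF assms(1), of l] by simp
qed

text \<open>This is e^(c ln(1 + x)) = (1 + x)^c; both series solve (1 + x) y' = c y with constant
  term 1.\<close>

lemma fps_exp_compose_ln: "fps_exp 1 oo (fps_const c * fps_ln 1) = fps_binomial (c::real)"
proof (subst fps_binomial_ODE_unique'[symmetric], intro conjI)
  let ?a = "fps_exp 1 oo (fps_const c * fps_ln 1)"
  have "fps_deriv ?a = ?a * (fps_const c * inverse (1 + fps_X))"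
    by (subst fps_compose_deriv) (simp_all add: fps_ln_deriv)
  then show "fps_deriv ?a = fps_const c * ?a / (1 + fps_X)"
    by (simp add: fps_divide_unit mult_ac)
qed simp

context
  fixes l :: nat and p :: "nat \<times> nat" and u :: rat
  assumes p: "p \<noteq> 0"
begin

text \<open>As X_(jp) acts by {jp, m} = j {p, m}, the coefficient (-1)^(j+1)/j^2 of the dilogarithm
  becomes (-1)^(j+1)/j, that of the logarithm. Because {p, p} = 0 the series is the same at every
  point of the line m + jp, so powers of the operator become powers of one series.\<close>

definition line_series :: "nat \<times> nat \<Rightarrow> real fps" where
  "line_series m = fps_const (of_rat u * of_int (form p m)) * fps_ln 1"

lemma line_series_add: "line_series (m + nscale j p) = line_series m"
  by (simp add: line_series_def form_simps form_nscale)

lemma entry_deriv_letter: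
  assumes "ndeg (m + nscale j p) \<le> Suc l"
  shows "entry (deriv_kernel l (letter l (p, u))) (m + nscale j p) m = fps_nth (line_series m) j"
proof -
  have d: "m + nscale j p - m = nscale j p" "m \<in> box (m + nscale j p)"
    by (auto simp: prod_eq_iff in_box)
  consider "j = 0" | "m = 0" | "j \<ge> 1" "j * ndeg p \<le> l"
    using assms ndeg_pos[of m] by (cases "j = 0"; cases "m = 0") auto
  then show ?thesis
  proof cases
    case 1
    then show ?thesis by (simp add: entry_deriv_kernel line_series_def form_simps)
  next
    case 2
    then show ?thesis by (simp add: entry_deriv_kernel line_series_def form_simps)
  next
    case 3
    then have "entry (deriv_kernel l (letter l (p, u))) (m + nscale j p) m =
       of_rat (u * ((-1) ^ (j + 1) / of_nat j ^ 2)) * of_int (int j * form p m)"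
      using assms d lookup_dilog[OF p 3] by (simp add: entry_deriv_kernel letter_def form_nscale)
    also have "\<dots> = fps_nth (line_series m) j"
      using 3(1) by (cases j)
        (simp_all add: line_series_def fps_ln_nth of_rat_mult of_rat_divide of_rat_power of_rat_minus
          power2_eq_square field_simps del: of_nat_Suc)
    finally show ?thesis .
  qed
qed

lemma entry_deriv_letter_off:
  assumes "\<And>j. k \<noteq> m + nscale j p"
  shows "entry (deriv_kernel l (letter l (p, u))) k m = 0"
proof (rule ccontr)
  assume *: "entry (deriv_kernel l (letter l (p, u))) k m \<noteq> 0"
  then have m: "m \<in> box k" and "Poly_Mapping.lookup (dilog p l) (k - m) \<noteq> 0"
    by (auto simp: entry_deriv_kernel letter_def split: if_splits)
  then obtain j where "k - m = nscale j p"
    by (auto simp: nscale_def elim: lookup_dilog_nonzero)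
  then show False using box_add_diff[OF m] assms[of j] by simp
qed

lemma line_in_box: "m + nscale i p \<in> box (m + nscale j p) \<longleftrightarrow> i \<le> j"
proof -
  have "fst p > 0 \<or> snd p > 0" using p by (auto simp: prod_eq_iff)
  then show ?thesis by (auto simp: in_box)
qed

lemma entry_line_product:
  assumes A: "\<And>k m. (\<And>j. k \<noteq> m + nscale j p) \<Longrightarrow> entry A k m = 0"
    and B: "\<And>k m. (\<And>j. k \<noteq> m + nscale j p) \<Longrightarrow> entry B k m = 0"
  shows "entry (A * B) (m + nscale j p) m =
      (\<Sum>i\<le>j. entry A (m + nscale j p) (m + nscale i p) * entry B (m + nscale i p) m)"
    "(\<And>j. k \<noteq> m + nscale j p) \<Longrightarrow> entry (A * B) k m = 0"
proof -
  have inj: "inj_on (\<lambda>i. m + nscale i p) {..j}" using nscale_inject[OF p] by (auto simp: inj_on_def)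
  have "entry (A * B) (m + nscale j p) m =
     (\<Sum>n\<in>(\<lambda>i. m + nscale i p) ` {..j}. entry A (m + nscale j p) n * entry B n m)"
    unfolding entry_mult
  proof (rule sum.mono_neutral_right)
    show "\<forall>n\<in>box (m + nscale j p) - (\<lambda>i. m + nscale i p) ` {..j}. entry A (m + nscale j p) n * entry B n m = 0"
    proof
      fix n assume n: "n \<in> box (m + nscale j p) - (\<lambda>i. m + nscale i p) ` {..j}"
      have "n \<noteq> m + nscale i p" for i
        using n line_in_box[of m i j] by auto
      then show "entry A (m + nscale j p) n * entry B n m = 0" by (simp add: B)
    qed
  qed (auto simp: line_in_box)
  then show "entry (A * B) (m + nscale j p) m =
      (\<Sum>i\<le>j. entry A (m + nscale j p) (m + nscale i p) * entry B (m + nscale i p) m)"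
    by (simp add: sum.reindex[OF inj])
  show "entry (A * B) k m = 0" if off: "\<And>j. k \<noteq> m + nscale j p"
    unfolding entry_mult
  proof (rule sum.neutral, rule ballI)
    fix n
    have "(\<forall>j. k \<noteq> n + nscale j p) \<or> (\<forall>j. n \<noteq> m + nscale j p)"
      using off by (metis add.assoc nscale_add)
    then show "entry A k n * entry B n m = 0" using A[of k n] B[of n m] by (elim disjE) simp_all
  qed
qed

lemma entry_deriv_letter_power:
  "ndeg (m + nscale j p) \<le> Suc l \<Longrightarrow>
    entry (deriv_kernel l (letter l (p, u)) ^ i) (m + nscale j p) m = fps_nth (line_series m ^ i) j"
  "(\<And>j. k \<noteq> m + nscale j p) \<Longrightarrow> entry (deriv_kernel l (letter l (p, u)) ^ i) k m = 0"
proof (induction i arbitrary: j m k)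
  case 0
  { case 1
    show ?case using p by (auto simp: entry_simps nscale_def prod_eq_iff)
  next
    case 2
    from 2[of 0] show ?case by (auto simp: entry_simps) }
next
  case (Suc i)
  let ?D = "deriv_kernel l (letter l (p, u))"
  note off = entry_deriv_letter_off Suc.IH(2)
  { case 1
    have shift: "m + nscale j p = m + nscale h p + nscale (j - h) p" if "h \<le> j" for h
      using that by (simp add: add.assoc flip: nscale_add)
    have "entry (?D ^ Suc i) (m + nscale j p) m =
      (\<Sum>h\<le>j. entry ?D (m + nscale j p) (m + nscale h p) * entry (?D ^ i) (m + nscale h p) m)"
      unfolding power_Suc by (rule entry_line_product) (use off in blast)+
    also have "\<dots> = (\<Sum>h\<le>j. fps_nth (line_series m) (j - h) * fps_nth (line_series m ^ i) h)"
    proof (rule sum.cong[OF refl])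
      fix h assume "h \<in> {..j}"
      then have h: "h \<le> j" by simp
      have "ndeg (m + nscale h p) \<le> Suc l"
        using 1 mult_le_mono1[OF h, of "ndeg p"] unfolding ndeg_add ndeg_nscale by linarith
      moreover have "entry ?D (m + nscale j p) (m + nscale h p) = fps_nth (line_series m) (j - h)"
        using entry_deriv_letter[of "m + nscale h p" "j - h"] 1 shift[OF h] by (simp add: line_series_add)
      ultimately show "entry ?D (m + nscale j p) (m + nscale h p) * entry (?D ^ i) (m + nscale h p) m =
        fps_nth (line_series m) (j - h) * fps_nth (line_series m ^ i) h"
        using Suc.IH(1) by simp
    qed
    also have "\<dots> = fps_nth (line_series m ^ i * line_series m) j"
      unfolding fps_mult_nth atMost_atLeast0 by (intro sum.cong refl mult.commute)
    finally show ?case by (simp add: mult.commute)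
  next
    case 2
    show ?case unfolding power_Suc by (rule entry_line_product(2)) (use off 2 in blast)+ }
qed

text \<open>Along the line through m the exponential of the operator is multiplication by (1 + x)^c
  with c = u {p, m}, whose coefficients are binomials.\<close>

lemma entry_letter:
  assumes "ndeg (m + nscale j p) \<le> Suc l"
  shows "entry (exp_kernel l (letter l (p, u))) (m + nscale j p) m = (of_rat u * of_int (form p m)) gchoose j"
proof -
  let ?c = "of_rat u * of_int (form p m) :: real"
  have s0: "fps_nth (line_series m) 0 = 0" by (simp add: line_series_def)
  have "entry (exp_kernel l (letter l (p, u))) (m + nscale j p) m =
      (\<Sum>i\<le>l. fps_nth (line_series m ^ i) j / fact i)"
    using entry_deriv_letter_power(1)[OF assms]
    by (simp add: exp_kernel_def nilpotent_exp_def entry_sum entry_simps)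
  also have "\<dots> = (\<Sum>i\<le>j. fps_nth (line_series m ^ i) j / fact i)"
  \<comment> \<open>The exponential stops at the power l, while coefficient j only sees powers i
    \<le> j. For m \<noteq> 0 the degree bound gives j \<le> l; for m = 0 the series is zero and
    only i = 0 contributes to either sum.\<close>
  proof (cases "m = 0")
    case True
    then have "line_series m = 0" by (simp add: line_series_def form_simps)
    then have "(\<Sum>i\<le>h. fps_nth (line_series m ^ i) j / fact i) = (\<Sum>i\<le>h. if i = 0 then fps_nth 1 j else 0)" for h
      by (intro sum.cong) (auto simp: power_0_left)
    then show ?thesis by simp
  next
    case False
    have "j * ndeg p \<le> l" using assms ndeg_pos[OF False] by simp
    moreover have "j \<le> j * ndeg p" using ndeg_pos[OF p] by simp
    ultimately have "j \<le> l" by (rule order_trans[rotated])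
    then show ?thesis
      by (intro sum.mono_neutral_right) (auto simp: startsby_zero_power_prefix[OF s0])
  qed
  also have "\<dots> = fps_nth (fps_exp 1 oo line_series m) j"
    by (simp add: fps_compose_nth atMost_atLeast0)
  also have "\<dots> = ?c gchoose j"
    by (simp add: line_series_def fps_exp_compose_ln)
  finally show ?thesis .
qed

lemma entry_letter_off:
  assumes "\<And>j. k \<noteq> m + nscale j p"
  shows "entry (exp_kernel l (letter l (p, u))) k m = 0"
  using entry_deriv_letter_power(2)[OF assms]
  by (simp add: exp_kernel_def nilpotent_exp_def entry_sum entry_simps)

end

lemma (in nilpotent_filtration) nilpotent_exp_minus_1:
  assumes "z \<in> J 1"
  shows "nilpotent_exp l z - 1 \<in> J 1"
proof -
  have "z ^ Suc i \<in> J 1" for i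
  proof (induction i)
    case (Suc i)
    then have "z * z ^ Suc i \<in> J (1 + 1)" using assms by (intro J_mult) auto
    then show ?case using J_anti by simp
  qed (use assms in simp)
  moreover have "nilpotent_exp l z = 1 + (\<Sum>i<l. (1 / fact (Suc i)) *\<^sub>R z ^ Suc i)"
    unfolding nilpotent_exp_def lessThan_Suc_atMost[symmetric]
    by (simp add: sum.lessThan_Suc_shift del: sum.lessThan_Suc power_Suc fact_Suc)
  ultimately show ?thesis by (auto intro!: J_sum J_scale simp del: power_Suc)
qed

lemma exp_kernel_minus_1: "exp_kernel l X - 1 \<in> kernel_filtration l 1"
  unfolding exp_kernel_def
  by (rule kernel_filtration.nilpotent_exp_minus_1) (rule deriv_kernel_filtration)

lemma entry_exp_kernel_high:
  assumes "ndeg k > Suc l"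
  shows "entry (exp_kernel l X) k m = (if k = m then 1 else 0)"
  using kernel_filtrationD(3)[OF exp_kernel_minus_1[of l X], of k m] assms
  by (force simp: entry_simps)

lemma entry_word_kernel_high:
  assumes "ndeg k > Suc l"
  shows "entry (word_kernel l w) k m = (if k = m then 1 else 0)"
  using entry_exp_kernel_high[OF assms, of "word_value l w" m] by (simp add: exp_kernel_word_value)

text \<open>The matrix entry form of the pentagon relation, for s = - snd m and r = fst m.
  Vandermonde expands (r + j choose k) in i; trinomial revision gives (s choose i) (s - i choose j -
  i); a second Vandermonde for s - i = (k - i) + (s - k) introduces b; after exchanging the sums,
  another revision and a third Vandermonde eliminate i.\<close>

lemma pentagon_binomial:
  fixes r s :: "'a::field_char_0"
  shows "(s gchoose j) * (r + of_nat j gchoose k) =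
    (\<Sum>b\<le>k. if b \<le> j then (r gchoose (k - b)) * (r + s - of_nat k + of_nat b gchoose b) * (s - of_nat k gchoose (j - b)) else 0)"
proof -
  have "(s gchoose j) * (r + of_nat j gchoose k) =
      (\<Sum>i\<le>k. (r gchoose (k - i)) * ((s gchoose j) * (of_nat j gchoose i)))"
  proof -
    have "r + of_nat j gchoose k = (\<Sum>i\<le>k. (of_nat j gchoose i) * (r gchoose (k - i)))"
      using gbinomial_Vandermonde[of "of_nat j" r k] by (simp add: add.commute atMost_atLeast0)
    then show ?thesis by (simp add: sum_distrib_left mult_ac)
  qed
  also have "\<dots> = (\<Sum>i\<le>k. if i \<le> j then (r gchoose (k - i)) * (s gchoose i) * (s - of_nat i gchoose (j - i)) else 0)"
  proof (rule sum.cong[OF refl])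
    fix i
    show "(r gchoose (k - i)) * ((s gchoose j) * (of_nat j gchoose i)) =
       (if i \<le> j then (r gchoose (k - i)) * (s gchoose i) * (s - of_nat i gchoose (j - i)) else 0)"
    proof (cases "i \<le> j")
      case True
      then show ?thesis using gbinomial_trinomial_revision[OF True, of s] by (simp add: mult_ac)
    next
      case False
      then show ?thesis by (simp flip: binomial_gbinomial add: binomial_eq_0)
    qed
  qed
  also have "\<dots> = (\<Sum>i\<le>k. \<Sum>b\<le>k. if i \<le> b \<and> b \<le> j then
      (r gchoose (k - i)) * (s gchoose i) * ((of_nat (k - i) gchoose (b - i)) * (s - of_nat k gchoose (j - b))) else 0)"
  proof (rule sum.cong[OF refl])
    fix i assume "i \<in> {..k}"
    then have ik: "i \<le> k" by simp
    have inner: "(\<Sum>b\<le>k. if i \<le> b \<and> b \<le> j then (of_nat (k - i) gchoose (b - i)) * (s - of_nat k gchoose (j - b)) else 0) =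
        (s - of_nat i gchoose (j - i))" if ij: "i \<le> j"
    proof -
      have "(\<Sum>b\<le>k. if i \<le> b \<and> b \<le> j then (of_nat (k - i) gchoose (b - i)) * (s - of_nat k gchoose (j - b)) else 0) =
         (\<Sum>b\<in>{i..j} \<inter> {..k}. (of_nat (k - i) gchoose (b - i)) * (s - of_nat k gchoose (j - b)))"
        by (rule sum.mono_neutral_cong_right) auto
      also have "\<dots> = (\<Sum>b\<in>{i..j}. (of_nat (k - i) gchoose (b - i)) * (s - of_nat k gchoose (j - b)))"
      proof (rule sum.mono_neutral_left)
        show "\<forall>b\<in>{i..j} - {i..j} \<inter> {..k}. (of_nat (k - i) gchoose (b - i)) * (s - of_nat k gchoose (j - b)) = 0"
        proof
          fix b assume "b \<in> {i..j} - {i..j} \<inter> {..k}"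
          then have "k - i choose (b - i) = 0" using ik by (intro binomial_eq_0) auto
          then show "(of_nat (k - i) gchoose (b - i)) * (s - of_nat k gchoose (j - b)) = 0"
            by (simp only: binomial_gbinomial[symmetric] of_nat_0 mult_zero_left)
        qed
      qed auto
      also have "\<dots> = (\<Sum>c\<in>{0..j - i}. (of_nat (k - i) gchoose c) * (s - of_nat k gchoose (j - i - c)))"
        by (rule sum.reindex_bij_witness[of _ "\<lambda>c. c + i" "\<lambda>b. b - i"]) (use ij in auto)
      also have "\<dots> = (of_nat (k - i) + (s - of_nat k) gchoose (j - i))" by (rule gbinomial_Vandermonde)
      finally show ?thesis using ik by (simp add: of_nat_diff)
    qed
    show "(if i \<le> j then (r gchoose (k - i)) * (s gchoose i) * (s - of_nat i gchoose (j - i)) else 0) =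
      (\<Sum>b\<le>k. if i \<le> b \<and> b \<le> j then
      (r gchoose (k - i)) * (s gchoose i) * ((of_nat (k - i) gchoose (b - i)) * (s - of_nat k gchoose (j - b))) else 0)"
    proof (cases "i \<le> j")
      case True
      show ?thesis unfolding inner[OF True, symmetric] sum_distrib_left using True by (auto intro!: sum.cong)
    next
      case False
      then have "\<not> (i \<le> b \<and> b \<le> j)" for b by auto
      then show ?thesis using False by (simp only: if_False sum.neutral_const)
    qed
  qed
  also have "\<dots> = (\<Sum>b\<le>k. \<Sum>i\<le>k. if i \<le> b \<and> b \<le> j then
      (r gchoose (k - i)) * (s gchoose i) * ((of_nat (k - i) gchoose (b - i)) * (s - of_nat k gchoose (j - b))) else 0)"
    by (rule sum.swap)
  also have "\<dots> = (\<Sum>b\<le>k. if b \<le> j then (r gchoose (k - b)) * (r + s - of_nat k + of_nat b gchoose b) * (s - of_nat k gchoose (j - b)) else 0)"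
  proof (rule sum.cong[OF refl])
    fix b assume "b \<in> {..k}"
    then have bk: "b \<le> k" by simp
    have "(\<Sum>i\<le>k. if i \<le> b then (r gchoose (k - i)) * (s gchoose i) * (of_nat (k - i) gchoose (b - i)) else 0) =
       (\<Sum>i\<in>{0..b}. (r gchoose (k - i)) * (s gchoose i) * (of_nat (k - i) gchoose (b - i)))"
      using bk by (intro sum.mono_neutral_cong_right) auto
    also have "\<dots> = (\<Sum>i\<in>{0..b}. (r gchoose (k - b)) * ((s gchoose i) * (r - of_nat (k - b) gchoose (b - i))))"
    proof (rule sum.cong[OF refl])
      fix i assume i: "i \<in> {0..b}"
      have "k - b \<le> k - i" using i by simp
      then have "(r gchoose (k - i)) * (of_nat (k - i) gchoose (k - b)) =
          (r gchoose (k - b)) * (r - of_nat (k - b) gchoose (k - i - (k - b)))"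
        by (rule gbinomial_trinomial_revision)
      moreover have "(of_nat (k - i) gchoose (k - b) :: 'a) = (of_nat (k - i) gchoose (b - i))"
      proof -
        have "k - i choose (k - b) = k - i choose (b - i)"
          using i bk binomial_symmetric[of "b - i" "k - i"] by simp
        then show ?thesis by (simp only: binomial_gbinomial[symmetric])
      qed
      moreover have "k - i - (k - b) = b - i" using i bk by simp
      ultimately show "(r gchoose (k - i)) * (s gchoose i) * (of_nat (k - i) gchoose (b - i)) =
         (r gchoose (k - b)) * ((s gchoose i) * (r - of_nat (k - b) gchoose (b - i)))"
        by (simp add: mult_ac)
    qed
    also have "\<dots> = (r gchoose (k - b)) * (s + (r - of_nat (k - b)) gchoose b)"
      by (simp add: sum_distrib_left[symmetric] gbinomial_Vandermonde)
    also have "s + (r - of_nat (k - b)) = r + s - of_nat k + of_nat b"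
      using bk by (simp add: of_nat_diff)
    finally have sum: "(r gchoose (k - b)) * (r + s - of_nat k + of_nat b gchoose b) =
      (\<Sum>i\<le>k. if i \<le> b then (r gchoose (k - i)) * (s gchoose i) * (of_nat (k - i) gchoose (b - i)) else 0)" ..
    show "(\<Sum>i\<le>k. if i \<le> b \<and> b \<le> j then
      (r gchoose (k - i)) * (s gchoose i) * ((of_nat (k - i) gchoose (b - i)) * (s - of_nat k gchoose (j - b))) else 0) =
      (if b \<le> j then (r gchoose (k - b)) * (r + s - of_nat k + of_nat b gchoose b) * (s - of_nat k gchoose (j - b)) else 0)"
      unfolding sum sum_distrib_right by (auto intro!: sum.cong)
  qed
  finally show ?thesis .
qed

section \<open>The pentagon relation and integrality\<close>

lemma entry_mult_pair:
  assumes "m \<in> box k"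
  shows "entry (A * B) k m = (\<Sum>x\<le>fst (k - m). \<Sum>y\<le>snd (k - m). entry A k (m + (x, y)) * entry B (m + (x, y)) m)"
  unfolding entry_mult_shift[OF assms] box_def sum.cartesian_product
  by (intro sum.cong) auto

lemma entry_axis_x:
  assumes "ndeg (m + (x, y)) \<le> Suc l"
  shows "entry (exp_kernel l (letter l ((1, 0), u))) (m + (x, y)) m =
    (if y = 0 then (- of_rat u * of_nat (snd m)) gchoose x else 0)"
proof (cases "y = 0")
  case True
  then have "(x, y) = nscale x (1, 0)" by (simp add: nscale_def)
  then show ?thesis using entry_letter[of "(1, 0)" m x l u] assms True
    by (simp add: zero_prod_def form_def)
next
  case False
  then show ?thesis by (simp, intro entry_letter_off) (auto simp: zero_prod_def prod_eq_iff)
qed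

lemma entry_axis_y:
  assumes "ndeg (m + (x, y)) \<le> Suc l"
  shows "entry (exp_kernel l (letter l ((0, 1), u))) (m + (x, y)) m =
    (if x = 0 then (of_rat u * of_nat (fst m)) gchoose y else 0)"
proof (cases "x = 0")
  case True
  then have "(x, y) = nscale y (0, 1)" by (simp add: nscale_def)
  then show ?thesis using entry_letter[of "(0, 1)" m y l u] assms True
    by (simp add: zero_prod_def form_def)
next
  case False
  then show ?thesis by (simp, intro entry_letter_off) (auto simp: zero_prod_def prod_eq_iff)
qed

lemma entry_diagonal:
  assumes "ndeg (m + (x, y)) \<le> Suc l"
  shows "entry (exp_kernel l (letter l ((1, 1), u))) (m + (x, y)) m =
    (if x = y then (of_rat u * (of_nat (fst m) - of_nat (snd m))) gchoose x else 0)"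
proof (cases "x = y")
  case True
  then have "(x, y) = nscale x (1, 1)" by (simp add: nscale_def)
  then show ?thesis using entry_letter[of "(1, 1)" m x l u] assms True
    by (simp add: zero_prod_def form_def)
next
  case False
  then show ?thesis by (simp, intro entry_letter_off) (auto simp: zero_prod_def prod_eq_iff)
qed

text \<open>Entries count weighted lattice paths, the rightmost factor acting first. On the left a
  path by (x, y) makes x horizontal and then y vertical steps; on the right it makes y - b vertical,
  b diagonal and x - b horizontal ones, so only b is free and \<open>pentagon_binomial\<close>
  applies.\<close>

lemma pentagon:
  "word_kernel l [((0, 1), 1), ((1, 0), 1)] = word_kernel l [((1, 0), 1), ((1, 1), 1), ((0, 1), 1)]"
proof (rule kernel_eqI)
  fix k m assume m: "m \<in> box k"
  define x y where "x = fst (k - m)" and "y = snd (k - m)"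
  have k: "k = m + (x, y)" using m by (simp add: x_def y_def prod_eq_iff in_box)
  let ?X = "exp_kernel l (letter l ((1, 0), 1))" and ?Y = "exp_kernel l (letter l ((0, 1), 1))"
    and ?D = "exp_kernel l (letter l ((1, 1), 1))"
  show "entry (word_kernel l [((0, 1), 1), ((1, 0), 1)]) k m =
    entry (word_kernel l [((1, 0), 1), ((1, 1), 1), ((0, 1), 1)]) k m"
  proof (cases "ndeg k \<le> Suc l")
    case False
    then show ?thesis by (simp only: entry_word_kernel_high not_le)
  next
    case deg: True
    have sub: "ndeg (m + (i, j)) \<le> Suc l" if "i \<le> x" "j \<le> y" for i j
      using deg that by (simp add: k ndeg_def)
    have shift: "m + (x, y) = m + (i, j) + (x - i, y - j)" if "i \<le> x" "j \<le> y" for i j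
      using that by (simp add: prod_eq_iff)
    have "entry (?Y * ?X) k m = (\<Sum>i\<le>x. \<Sum>j\<le>y. if i = x \<and> j = 0 then
        (of_nat (fst m + x) gchoose y) * (- of_nat (snd m) gchoose x) else 0)"
      unfolding entry_mult_pair[OF m] x_def[symmetric] y_def[symmetric]
    proof (intro sum.cong refl)
      fix i j assume "i \<in> {..x}" "j \<in> {..y}"
      then have ij: "i \<le> x" "j \<le> y" by auto
      have "entry ?Y k (m + (i, j)) = (if x - i = 0 then of_nat (fst m + i) gchoose (y - j) else 0)"
        unfolding k shift[OF ij] using deg k shift[OF ij] by (subst entry_axis_y) auto
      moreover have "entry ?X (m + (i, j)) m = (if j = 0 then - of_nat (snd m) gchoose i else 0)"
        using sub[OF ij] by (subst entry_axis_x) auto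
      ultimately show "entry ?Y k (m + (i, j)) * entry ?X (m + (i, j)) m =
        (if i = x \<and> j = 0 then (of_nat (fst m + x) gchoose y) * (- of_nat (snd m) gchoose x) else 0)"
        using ij by auto
    qed
    also have "\<dots> = (\<Sum>i\<le>x. if i = x then \<Sum>j\<le>y. if j = 0 then
        (of_nat (fst m + x) gchoose y) * (- of_nat (snd m) gchoose x) else 0 else 0)"
      by (intro sum.cong) auto
    also have "\<dots> = (of_nat (fst m + x) gchoose y) * (- of_nat (snd m) gchoose x)"
      by simp
    also have "\<dots> = (- of_nat (snd m) gchoose x) * (of_nat (fst m) + of_nat x gchoose y)"
      by simp
    also have "\<dots> = (\<Sum>b\<le>y. if b \<le> x then (of_nat (fst m) gchoose (y - b)) *
      (of_nat (fst m) + - of_nat (snd m) - of_nat y + of_nat b gchoose b) * (- of_nat (snd m) - of_nat y gchoose (x - b)) else 0)"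
      by (rule pentagon_binomial)
    also have "\<dots> = (\<Sum>b\<le>x. if b \<le> y then (of_nat (fst m) gchoose (y - b)) *
      (of_nat (fst m) + - of_nat (snd m) - of_nat y + of_nat b gchoose b) * (- of_nat (snd m) - of_nat y gchoose (x - b)) else 0)"
      by (rule sum.mono_neutral_cong) auto
    also have "\<dots> = (\<Sum>b\<le>x. \<Sum>j\<le>y. if j = y then (if b \<le> y then (of_nat (fst m) gchoose (y - b)) *
      (of_nat (fst m) + - of_nat (snd m) - of_nat y + of_nat b gchoose b) * (- of_nat (snd m) - of_nat y gchoose (x - b)) else 0) else 0)"
      by simp
    also have "\<dots> = entry (?X * (?D * ?Y)) k m"
      unfolding entry_mult_pair[OF m] x_def[symmetric] y_def[symmetric]
    proof (intro sum.cong refl)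
      fix b j assume "b \<in> {..x}" "j \<in> {..y}"
      then have bj: "b \<le> x" "j \<le> y" by auto
      have X: "entry ?X k (m + (b, j)) = (if y - j = 0 then - of_nat (snd m + j) gchoose (x - b) else 0)"
        unfolding k shift[OF bj] using deg k shift[OF bj] by (subst entry_axis_x) auto
      show "(if j = y then (if b \<le> y then (of_nat (fst m) gchoose (y - b)) *
         (of_nat (fst m) + - of_nat (snd m) - of_nat y + of_nat b gchoose b) * (- of_nat (snd m) - of_nat y gchoose (x - b)) else 0) else 0) =
         entry ?X k (m + (b, j)) * entry (?D * ?Y) (m + (b, j)) m"
      proof (cases "j = y")
        case False
        then show ?thesis using X bj by simp
      next
        case True
        have mb: "m \<in> box (m + (b, y))" by (simp add: in_box)
        have "entry (?D * ?Y) (m + (b, y)) m = (\<Sum>i\<le>b. \<Sum>c\<le>y. if i = 0 \<and> c + b = y then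
            (of_nat (fst m) - of_nat (snd m + c) gchoose b) * (of_nat (fst m) gchoose c) else 0)"
          unfolding entry_mult_pair[OF mb] add_diff_cancel_left' fst_conv snd_conv
        proof (intro sum.cong refl)
          fix i c assume "i \<in> {..b}" "c \<in> {..y}"
          then have ic: "i \<le> b" "c \<le> y" by auto
          have s: "m + (b, y) = m + (i, c) + (b - i, y - c)" using ic by (simp add: prod_eq_iff)
          have "entry ?D (m + (b, y)) (m + (i, c)) =
             (if b - i = y - c then of_nat (fst m + i) - of_nat (snd m + c) gchoose (b - i) else 0)"
            unfolding s using sub[of b y] bj(1) s by (subst entry_diagonal) auto
          moreover have "entry ?Y (m + (i, c)) m = (if i = 0 then of_nat (fst m) gchoose c else 0)"
            using sub[of i c] ic bj by (subst entry_axis_y) auto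
          ultimately show "entry ?D (m + (b, y)) (m + (i, c)) * entry ?Y (m + (i, c)) m =
             (if i = 0 \<and> c + b = y then (of_nat (fst m) - of_nat (snd m + c) gchoose b) * (of_nat (fst m) gchoose c) else 0)"
            using ic by auto
        qed
        also have "\<dots> = (\<Sum>i\<le>b. if i = 0 then (\<Sum>c\<le>y. if c + b = y then
            (of_nat (fst m) - of_nat (snd m + c) gchoose b) * (of_nat (fst m) gchoose c) else 0) else 0)"
          by (intro sum.cong) auto
        also have "\<dots> = (\<Sum>c\<le>y. if c + b = y then
            (of_nat (fst m) - of_nat (snd m + c) gchoose b) * (of_nat (fst m) gchoose c) else 0)"
          by simp
        also have "\<dots> = (\<Sum>c\<le>y. if c = y - b then (if b \<le> y then
            (of_nat (fst m) - of_nat (snd m + (y - b)) gchoose b) * (of_nat (fst m) gchoose (y - b)) else 0) else 0)"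
          by (intro sum.cong) auto
        also have "\<dots> = (if b \<le> y then
            (of_nat (fst m) - of_nat (snd m + (y - b)) gchoose b) * (of_nat (fst m) gchoose (y - b)) else 0)"
          by simp
        finally have e: "entry (?D * ?Y) (m + (b, y)) m = \<dots>" .
        have eq: "of_nat (fst m) - of_nat (snd m + (y - b)) = (of_nat (fst m) + - of_nat (snd m) - of_nat y + of_nat b :: real)"
          if "b \<le> y" using that by (simp add: of_nat_diff)
        have X': "entry ?X k (m + (b, y)) = - of_nat (snd m) - of_nat y gchoose (x - b)"
        proof -
          have "- of_nat (snd m + y) = (- of_nat (snd m) - of_nat y :: real)" by simp
          from X[unfolded True this] show ?thesis by simp
        qed
        show ?thesis
        proof (cases "b \<le> y")
          case True
          show ?thesis unfolding \<open>j = y\<close> e X' eq[OF True] using True by simp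
        next
          case False
          then show ?thesis unfolding e \<open>j = y\<close> by simp
        qed
      qed
    qed
    finally show ?thesis by simp
  qed
qed

section \<open>Integrality of the exponents\<close>

definition integral_letter :: "(nat \<times> nat) \<times> rat \<Rightarrow> bool" where
  "integral_letter x \<longleftrightarrow> fst x \<noteq> 0 \<and> of_nat (gcd (fst (fst x)) (snd (fst x))) * snd x \<in> \<int>"

lemma form_gcd: "int (gcd (fst p) (snd p)) dvd form p m"
  unfolding form_def by (intro dvd_diff dvd_mult2) simp_all

lemma Ints_of_rat: "(of_rat q :: real) \<in> \<int> \<longleftrightarrow> q \<in> \<int>"
proof
  assume "(of_rat q :: real) \<in> \<int>"
  then obtain z where "of_rat q = (of_int z :: real)" by (auto elim: Ints_cases)
  then have "(of_rat q :: real) = of_rat (of_int z)" by simp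
  then show "q \<in> \<int>" by (simp only: of_rat_eq_iff Ints_of_int)
qed (auto elim!: Ints_cases)

text \<open>gcd(p) divides {p, m}, so u {p, m} is an integer and the entries are binomials with
  integer upper argument.\<close>

lemma integral_letter_entry:
  assumes "integral_letter x"
  shows "entry (exp_kernel l (letter l x)) k m \<in> \<int>"
proof -
  obtain p u where x: "x = (p, u)" by (cases x)
  have p: "p \<noteq> 0" and u: "of_nat (gcd (fst p) (snd p)) * u \<in> \<int>" using assms by (auto simp: integral_letter_def x)
  show ?thesis
  proof (cases "ndeg k \<le> Suc l \<and> (\<exists>j. k = m + nscale j p)")
    case True
    then obtain j where k: "k = m + nscale j p" "ndeg (m + nscale j p) \<le> Suc l" by auto
    obtain c where c: "form p m = int (gcd (fst p) (snd p)) * c" using form_gcd[of p m] by (elim dvdE)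
    obtain z where z: "of_nat (gcd (fst p) (snd p)) * u = of_int z" using u by (auto elim: Ints_cases)
    have "u * of_int (form p m) = of_int (z * c)" using z by (simp add: c mult_ac)
    then have "(of_rat (u * of_int (form p m)) :: real) = of_rat (of_int (z * c))" by simp
    then have "of_rat u * of_int (form p m) = (of_int (z * c) :: real)"
      by (simp only: of_rat_mult of_rat_of_int_eq)
    then have "entry (exp_kernel l (letter l x)) k m = of_int (z * c) gchoose j"
      using entry_letter[OF p k(2), of u] by (simp add: k x)
    then show ?thesis using of_int_gbinomial[of "z * c" j, where 'a = real, symmetric] by simp
  next
    case False
    then show ?thesis
      using entry_exp_kernel_high[of l k "letter l x" m] entry_letter_off[OF p, of k m l u] x by (auto simp: not_le)
  qed
qed

lemma integral_word_entry:
  "(\<And>x. x \<in> set w \<Longrightarrow> integral_letter x) \<Longrightarrow> entry (word_kernel l w) k m \<in> \<int>"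
  by (induction w arbitrary: k m)
     (auto simp: entry_simps entry_mult intro!: Ints_sum Ints_mult integral_letter_entry)

text \<open>The matrix of C raises degrees by the full level l + 1, so its product with any strictly
  raising matrix is zero; the exponential of C is 1 plus this matrix, which multiplication by that
  of Y leaves unchanged.\<close>

lemma exp_kernel_central:
  assumes "Y \<in> quot_carrier (Suc l)" "C \<in> quot_carrier (Suc l)"
    "\<And>p. Poly_Mapping.lookup C p \<noteq> 0 \<Longrightarrow> ndeg p = Suc l"
  shows "exp_kernel (Suc l) (Y + C) = exp_kernel (Suc l) Y + deriv_kernel (Suc l) C"
proof -
  let ?D = "deriv_kernel (Suc l) C"
  have D: "?D \<in> kernel_filtration (Suc l) (Suc l)"
  proof (rule kernel_filtrationI)
    fix k m assume *: "entry ?D k m \<noteq> 0"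
    then have "m \<in> box k" "Poly_Mapping.lookup C (k - m) \<noteq> 0" by (auto simp: entry_deriv_kernel split: if_splits)
    then have "ndeg m + Suc l = ndeg k" using ndeg_box[of m k] assms(3) by simp
    then show "0 < ndeg m \<and> ndeg m + Suc l \<le> ndeg k \<and> ndeg k \<le> Suc (Suc l)"
      using kernel_filtrationD[OF deriv_kernel_filtration *] by simp
  qed
  have "?D * ?D = 0"
    by (rule kernel_filtration_top[OF kernel_filtration_mult[OF D D]]) simp
  then have "?D ^ Suc (Suc i) = 0" for i by (simp flip: mult.assoc)
  then have "exp_kernel (Suc l) C = 1 + ?D"
    unfolding exp_kernel_def nilpotent_exp_def lessThan_Suc_atMost[symmetric]
    by (simp add: sum.lessThan_Suc_shift del: sum.lessThan_Suc power_Suc)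
  moreover have "(exp_kernel (Suc l) Y - 1) * ?D = 0"
    by (rule kernel_filtration_top[OF kernel_filtration_mult[OF exp_kernel_minus_1 D]]) simp
  moreover have "Y + C = bch (Suc l) Y C"
    using bch_commuting[OF assms(1,2) central_bracket[OF assms(1,3)]] by simp
  ultimately show ?thesis by (simp add: exp_kernel_bch algebra_simps)
qed

text \<open>At level l + 1 the integer matrices of w and of the ordered word of lower degree differ
  by the matrix of the top part of the logarithm. In the columns (1, 0) and (0, 1) that matrix has
  the entries \<open>u p * snd p\<close> and \<open>- u p * fst p\<close>, and Bezout combines these
  to gcd(p) u(p).\<close>

lemma ordered_word_integral:
  assumes w: "\<And>x. x \<in> set w \<Longrightarrow> integral_letter x"
    and eq: "word_value l w = word_value l (ordered_word l u)" and p: "p \<in> degree_upto l"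
  shows "of_nat (gcd (fst p) (snd p)) * u p \<in> \<int>"
proof -
  have "word_value l w = word_value l (ordered_word l u) \<longrightarrow>
    (\<forall>p\<in>degree_upto l. of_nat (gcd (fst p) (snd p)) * u p \<in> \<int>)"
  proof (induction l)
    case 0
    show ?case by (simp add: degree_upto_0)
  next
    case (Suc l)
    show ?case
    proof (intro impI ballI)
      fix p assume prem: "word_value (Suc l) w = word_value (Suc l) (ordered_word (Suc l) u)"
        and p: "p \<in> degree_upto (Suc l)"
      have "word_value l w = trunc l (word_value (Suc l) w)" by (simp add: trunc_word_value)
      also have "\<dots> = word_value l (ordered_word l u)"
        unfolding prem by (simp add: trunc_word_value word_value_ordered_word_trunc[of l "Suc l"])
      finally have low: "of_nat (gcd (fst q) (snd q)) * u q \<in> \<int>" if "q \<in> degree_upto l" for q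
        using Suc.IH that by blast
      show "of_nat (gcd (fst p) (snd p)) * u p \<in> \<int>"
      proof (cases "ndeg p \<le> l")
        case True
        then show ?thesis using low p by (simp add: degree_upto_def)
      next
        case False
        then have deg: "ndeg p = Suc l" using p by (simp add: degree_upto_def)
        let ?Y = "word_value (Suc l) (ordered_word l u)"
        let ?C = "\<Sum>x\<leftarrow>filter (\<lambda>x. ndeg (fst x) = Suc l) (ordered_word (Suc l) u). Poly_Mapping.single (fst x) (snd x)"
        have split: "word_value (Suc l) w = ?Y + ?C"
          unfolding prem
          by (subst word_value_central) (simp_all only: ordered_word_lower zero_less_Suc diff_Suc_1)
        have K: "word_kernel (Suc l) w = word_kernel (Suc l) (ordered_word l u) + deriv_kernel (Suc l) ?C"
          unfolding exp_kernel_word_value[symmetric] split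
          by (rule exp_kernel_central) (auto intro: quot_carrier_word_value top_sum_carrier top_sum_degree)
        have Y: "integral_letter x" if "x \<in> set (ordered_word l u)" for x
          using that low degree_list[of l] degree_upto_nonzero[of l] by (auto simp: ordered_word_def integral_letter_def)
        have main: "u p * of_int (form p m) \<in> \<int>" if "ndeg m = 1" for m
        proof -
          have "entry (deriv_kernel (Suc l) ?C) (m + p) m \<in> \<int>"
          proof -
            have "entry (deriv_kernel (Suc l) ?C) (m + p) m =
              entry (word_kernel (Suc l) w) (m + p) m - entry (word_kernel (Suc l) (ordered_word l u)) (m + p) m"
              by (simp add: K entry_simps)
            also have "\<dots> \<in> \<int>" using w Y by (intro Ints_diff integral_word_entry)
            finally show ?thesis .
          qed
          moreover have "entry (deriv_kernel (Suc l) ?C) (m + p) m = of_rat (u p * of_int (form p m))"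
            using deg that lookup_top_sum[OF p deg, of u]
            by (simp add: entry_deriv_kernel in_box of_rat_mult)
          ultimately show ?thesis by (simp only: Ints_of_rat)
        qed
        have "u p * of_int (int (snd p)) \<in> \<int>" using main[of "(1, 0)"] by (simp add: form_def ndeg_def)
        moreover have "u p * of_int (int (fst p)) \<in> \<int>"
          using Ints_minus[OF main[of "(0, 1)"]] by (simp add: form_def ndeg_def)
        moreover obtain s t where "s * int (fst p) + t * int (snd p) = int (gcd (fst p) (snd p))"
          using bezout_int[of "int (fst p)" "int (snd p)"] by (auto simp flip: gcd_int_int_eq)
        then have "of_int (int (gcd (fst p) (snd p))) * u p =
            of_int s * (u p * of_int (int (fst p))) + of_int t * (u p * of_int (int (snd p)))"
          by (simp add: algebra_simps flip: of_int_add of_int_mult)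
             (metis (no_types, lifting) distrib_left mult.assoc mult.commute of_int_add of_int_mult of_int_of_nat_eq)
        ultimately show ?thesis
          by (metis Ints_add Ints_mult Ints_of_int of_int_of_nat_eq)
      qed
    qed
  qed
  then show ?thesis using eq p by blast
qed

section \<open>Change of lattice and projections\<close>

definition lattice_map :: "nat \<times> nat \<Rightarrow> nat \<times> nat \<Rightarrow> nat \<times> nat \<Rightarrow> nat \<times> nat" where
  "lattice_map p q r = (fst r * fst p + snd r * fst q, fst r * snd p + snd r * snd q)"

lemma lattice_map_add: "lattice_map p q (r + s) = lattice_map p q r + lattice_map p q s"
  by (simp add: lattice_map_def prod_eq_iff algebra_simps)

lemma lattice_map_nscale: "lattice_map p q (nscale j r) = nscale j (lattice_map p q r)"
  by (simp add: lattice_map_def nscale_def algebra_simps)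

lemma form_lattice_map: "form (lattice_map p q r) (lattice_map p q s) = form q p * form r s"
  by (simp add: lattice_map_def form_def algebra_simps)

lemma ndeg_lattice_map: "ndeg (lattice_map p q r) = fst r * ndeg p + snd r * ndeg q"
  by (simp add: lattice_map_def ndeg_def algebra_simps)

lemma letter_altdef:
  "letter l (r, u) = (\<Sum>j\<in>{j. 1 \<le> j \<and> j * ndeg r \<le> l}. Poly_Mapping.single (nscale j r) (u * ((-1) ^ (j + 1) / of_nat j ^ 2)))"
  by (simp add: letter_def dilog_def lie_scale_sum lie_scale_single nscale_def)

lemma ndeg_lattice_map_ge:
  assumes "p \<noteq> 0" "q \<noteq> 0"
  shows "ndeg r \<le> ndeg (lattice_map p q r)"
proof -
  have "fst r * 1 \<le> fst r * ndeg p" "snd r * 1 \<le> snd r * ndeg q"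
    using ndeg_pos[OF assms(1)] ndeg_pos[OF assms(2)] by (auto intro!: mult_le_mono2)
  then show ?thesis unfolding ndeg_lattice_map ndeg_def[of r] by linarith
qed

text \<open>With \<theta> = \<open>lattice_map p q\<close> and \<kappa> = {q, p} one has {\<theta>
  r, \<theta> s} = \<kappa> {r, s}, so X_r \<mapsto> X_(\<theta> r)/\<kappa> preserves brackets. It
  maps jr to j \<theta>(r) and hence [r]^u to [\<theta> r]^(u/\<kappa>).\<close>

lemma scaling_word_value:
  assumes \<kappa>: "form q p > 0"
    and letters: "\<And>x. x \<in> set v \<union> set w \<Longrightarrow> fst x \<noteq> 0"
    and eq: "word_value l v = word_value l w"
  defines "F \<equiv> \<lambda>x. (lattice_map p q (fst x), snd x / of_int (form q p))"
  shows "word_value l (map F v) = word_value l (map F w)"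
proof -
  let ?\<theta> = "lattice_map p q"
  \<comment> \<open>As \<theta> can raise degrees, basis elements whose image exceeds degree l are
    sent to 0. As \<theta> never lowers degrees, nothing cut off in the source could have
    contributed to the target.\<close>
  let ?\<gamma> = "\<lambda>r. if ndeg (?\<theta> r) \<le> l then 1 / of_int (form q p) else 0 :: rat"
  have p: "p \<noteq> 0" and q: "q \<noteq> 0" using \<kappa> by (auto simp: form_simps)
  have "monomial_map ?\<gamma> ?\<theta> (word_value l z) = word_value l (map F z)" if z: "set z \<subseteq> set v \<union> set w" for z
  proof (rule monomial_map_word_value)
    fix r s :: "nat \<times> nat" and c :: rat assume rs: "r \<noteq> 0" "s \<noteq> 0"
    show "(if ndeg (r + s) \<le> l then Poly_Mapping.single (?\<theta> (r + s)) (?\<gamma> (r + s) * of_int (form r s) * c) else 0) =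
      (if ndeg (?\<theta> r + ?\<theta> s) \<le> l
       then Poly_Mapping.single (?\<theta> r + ?\<theta> s) (of_int (form (?\<theta> r) (?\<theta> s)) * ?\<gamma> r * ?\<gamma> s * c) else 0)"
    proof (cases "ndeg (?\<theta> r + ?\<theta> s) \<le> l")
      case True
      then have "ndeg (r + s) \<le> l"
        using ndeg_lattice_map_ge[OF p q, of "r + s"] unfolding lattice_map_add by simp
      moreover have "ndeg (?\<theta> r) \<le> l" "ndeg (?\<theta> s) \<le> l" using True by simp_all
      ultimately show ?thesis using True \<kappa> by (simp add: lattice_map_add form_lattice_map)
    next
      case False
      then show ?thesis by (simp add: lattice_map_add)
    qed
  next
    fix r :: "nat \<times> nat" assume r: "r \<noteq> 0" "?\<gamma> r \<noteq> 0"
    then have "ndeg (?\<theta> r) \<ge> ndeg r" using ndeg_lattice_map_ge[OF p q] by simp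
    then have "?\<theta> r \<noteq> 0" using ndeg_pos[OF r(1)] by (auto simp: ndeg_def)
    then show "?\<theta> r \<noteq> 0 \<and> ndeg (?\<theta> r) \<le> l" using r(2) by (simp split: if_splits)
  next
    fix x assume "x \<in> set z"
    then have x: "fst x \<noteq> 0" using letters z by blast
    obtain r u where ru: "x = (r, u)" by (cases x)
    have "monomial_map ?\<gamma> ?\<theta> (letter l (r, u)) = (\<Sum>j\<in>{j. 1 \<le> j \<and> j * ndeg r \<le> l}.
        Poly_Mapping.single (nscale j (?\<theta> r)) (?\<gamma> (nscale j r) * (u * ((-1) ^ (j + 1) / of_nat j ^ 2))))"
      unfolding letter_altdef monomial_map_sum monomial_map_single lattice_map_nscale ..
    also have "\<dots> = letter l (?\<theta> r, u / of_int (form q p))"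
      unfolding letter_altdef
    proof (rule sum.mono_neutral_cong_right)
      show "finite {j. 1 \<le> j \<and> j * ndeg r \<le> l}" using finite_multiples x ru by simp
      have "j * ndeg r \<le> j * ndeg (?\<theta> r)" for j
        using ndeg_lattice_map_ge[OF p q, of r] by (rule mult_le_mono2)
      then show "{j. 1 \<le> j \<and> j * ndeg (?\<theta> r) \<le> l} \<subseteq> {j. 1 \<le> j \<and> j * ndeg r \<le> l}"
        using le_trans by blast
    qed (auto simp: lattice_map_nscale)
    finally show "monomial_map ?\<gamma> ?\<theta> (letter l x) = letter l (F x)" by (simp add: ru F_def)
  qed
  from this[of v] this[of w] eq show ?thesis by simp
qed

text \<open>S is a face of the cone, so the X_r with r outside S span an ideal; discarding them is a
  homomorphism, and inside S all brackets vanish. It serves for the two coordinate axes.\<close>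

lemma projection_word_value:
  assumes S: "\<And>p q. p + q \<in> S \<longleftrightarrow> p \<in> S \<and> q \<in> S" "\<And>p q. p \<in> S \<Longrightarrow> q \<in> S \<Longrightarrow> form p q = 0"
    "\<And>j p. 1 \<le> j \<Longrightarrow> nscale j p \<in> S \<longleftrightarrow> p \<in> S"
    and eq: "word_value l v = word_value l w"
  defines "F \<equiv> \<lambda>x. (fst x, if fst x \<in> S then snd x else 0)"
  shows "word_value l (map F v) = word_value l (map F w)"
proof -
  let ?\<gamma> = "\<lambda>r. if r \<in> S \<and> ndeg r \<le> l then 1 else 0 :: rat"
  have "monomial_map ?\<gamma> (\<lambda>r. r) (word_value l z) = word_value l (map F z)" for z
  proof (rule monomial_map_word_value)
    fix r s :: "nat \<times> nat" and c :: rat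
    show "(if ndeg (r + s) \<le> l then Poly_Mapping.single (r + s) (?\<gamma> (r + s) * of_int (form r s) * c) else 0) =
      (if ndeg (r + s) \<le> l then Poly_Mapping.single (r + s) (of_int (form r s) * ?\<gamma> r * ?\<gamma> s * c) else 0)"
    proof (cases "r \<in> S \<and> s \<in> S")
      case True
      then show ?thesis using S(2)[of r s] by simp
    next
      case False
      then have "r + s \<notin> S" using S(1)[of r s] by simp
      then show ?thesis using False by auto
    qed
  next
    fix r :: "nat \<times> nat" assume r: "r \<noteq> 0" "?\<gamma> r \<noteq> 0"
    then show "r \<noteq> 0 \<and> ndeg r \<le> l" by (simp split: if_splits)
  next
    fix x :: "(nat \<times> nat) \<times> rat"
    obtain r u where ru: "x = (r, u)" by (cases x)
    have "monomial_map ?\<gamma> (\<lambda>r. r) (letter l (r, u)) = (\<Sum>j\<in>{j. 1 \<le> j \<and> j * ndeg r \<le> l}.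
        Poly_Mapping.single (nscale j r) (?\<gamma> (nscale j r) * (u * ((-1) ^ (j + 1) / of_nat j ^ 2))))"
      unfolding letter_altdef monomial_map_sum monomial_map_single ..
    also have "\<dots> = letter l (r, if r \<in> S then u else 0)"
      unfolding letter_altdef
    proof (rule sum.cong[OF refl])
      fix j assume "j \<in> {j. 1 \<le> j \<and> j * ndeg r \<le> l}"
      then have "1 \<le> j" "j * ndeg r \<le> l" by simp_all
      then show "Poly_Mapping.single (nscale j r) (?\<gamma> (nscale j r) * (u * ((-1) ^ (j + 1) / of_nat j ^ 2))) =
          Poly_Mapping.single (nscale j r) ((if r \<in> S then u else 0) * ((-1) ^ (j + 1) / of_nat j ^ 2))"
        using S(3)[of j r] by simp
    qed
    finally show "monomial_map ?\<gamma> (\<lambda>r. r) (letter l x) = letter l (F x)" by (simp add: ru F_def)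
  qed
  from this[of v] this[of w] eq show ?thesis by simp
qed

section \<open>Exponents on the coordinate axes and at m = 0 or n = 0\<close>

lemma filter_eq_singleton: "distinct xs \<Longrightarrow> p \<in> set xs \<Longrightarrow> filter (\<lambda>q. q = p) xs = [p]"
  by (induction xs) (auto simp: filter_empty_conv)

lemma ordered_word_single:
  assumes "p \<in> degree_upto l"
  shows "word_value l (ordered_word l (\<lambda>q. if q = p then c else 0)) = letter l (p, c)"
proof -
  let ?w = "ordered_word l (\<lambda>q. if q = p then c else 0)"
  have "filter (\<lambda>x. fst x = p) ?w = map (\<lambda>q. (q, if q = p then c else 0)) (filter (\<lambda>q. q = p) (increasing_list (degree_upto l)))"
    by (simp add: ordered_word_def filter_map o_def)
  also have "\<dots> = [(p, c)]"
    using filter_eq_singleton[OF distinct_nless[OF degree_list(1)], of p l] degree_list(2)[of l] assms by simp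
  finally have "word_value l (filter (\<lambda>x. fst x = p) ?w) = letter l (p, c)"
    by (simp add: bch_zero_right quot_carrier_letter)
  moreover have "word_value l (filter (\<lambda>x. fst x = p) ?w) = word_value l ?w"
    by (rule word_value_filter) (auto simp: ordered_word_def letter_trivial)
  ultimately show ?thesis by simp
qed

lemma uexp_x_axis:
  assumes "snd p = 0" "p \<noteq> 0"
  shows "uexp p m n = (if p = (1, 0) then of_nat m else 0)"
proof -
  let ?S = "{p :: nat \<times> nat. snd p = 0}" and ?l = "ndeg p"
  let ?F = "\<lambda>x :: (nat \<times> nat) \<times> rat. (fst x, if fst x \<in> ?S then snd x else 0)"
  have pos: "?l > 0" using ndeg_pos[OF assms(2)] .
  have "word_value ?l (map ?F (ordered_word ?l (\<lambda>p. uexp p m n))) = word_value ?l (map ?F (initial_word m n))"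
    by (rule projection_word_value) (auto simp: form_def uexp_ordered_word)
  also have "map ?F (ordered_word ?l (\<lambda>p. uexp p m n)) = ordered_word ?l (\<lambda>p. if snd p = 0 then uexp p m n else 0)"
    by (simp add: ordered_word_def)
  also have "word_value ?l (map ?F (initial_word m n)) = letter ?l ((1, 0), of_nat m)"
    by (simp add: initial_word_def bch_zero_right bch_zero_left letter_trivial quot_carrier_letter)
  also have "\<dots> = word_value ?l (ordered_word ?l (\<lambda>q. if q = (1, 0) then of_nat m else 0))"
    using pos by (subst ordered_word_single) (auto simp: degree_upto_def Nplus_iff ndeg_def zero_prod_def)
  finally have "(if snd p = 0 then uexp p m n else 0) = (if p = (1, 0) then of_nat m else 0)"
    by (rule ordered_word_unique) (simp add: degree_upto_def Nplus_iff assms)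
  then show ?thesis using assms by simp
qed

lemma uexp_y_axis:
  assumes "fst p = 0" "p \<noteq> 0"
  shows "uexp p m n = (if p = (0, 1) then of_nat n else 0)"
proof -
  let ?S = "{p :: nat \<times> nat. fst p = 0}" and ?l = "ndeg p"
  let ?F = "\<lambda>x :: (nat \<times> nat) \<times> rat. (fst x, if fst x \<in> ?S then snd x else 0)"
  have pos: "?l > 0" using ndeg_pos[OF assms(2)] .
  have "word_value ?l (map ?F (ordered_word ?l (\<lambda>p. uexp p m n))) = word_value ?l (map ?F (initial_word m n))"
    by (rule projection_word_value) (auto simp: form_def uexp_ordered_word)
  also have "map ?F (ordered_word ?l (\<lambda>p. uexp p m n)) = ordered_word ?l (\<lambda>p. if fst p = 0 then uexp p m n else 0)"
    by (simp add: ordered_word_def)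
  also have "word_value ?l (map ?F (initial_word m n)) = letter ?l ((0, 1), of_nat n)"
    by (simp add: initial_word_def bch_zero_right bch_zero_left letter_trivial quot_carrier_letter quot_carrier_zero)
  also have "\<dots> = word_value ?l (ordered_word ?l (\<lambda>q. if q = (0, 1) then of_nat n else 0))"
    using pos by (subst ordered_word_single) (auto simp: degree_upto_def Nplus_iff ndeg_def zero_prod_def)
  finally have "(if fst p = 0 then uexp p m n else 0) = (if p = (0, 1) then of_nat n else 0)"
    by (rule ordered_word_unique) (simp add: degree_upto_def Nplus_iff assms)
  then show ?thesis using assms by simp
qed

lemma uexp_0_left:
  assumes "fst p > 0"
  shows "uexp p 0 n = 0"
proof -
  let ?l = "ndeg p"
  have pos: "?l > 0" using assms by (simp add: ndeg_def)
  have "word_value ?l (ordered_word ?l (\<lambda>p. uexp p 0 n)) = letter ?l ((0, 1), of_nat n)"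
    by (simp add: uexp_ordered_word) (simp add: initial_word_def bch_zero_right letter_trivial quot_carrier_letter quot_carrier_zero)
  also have "\<dots> = word_value ?l (ordered_word ?l (\<lambda>q. if q = (0, 1) then of_nat n else 0))"
    using pos by (subst ordered_word_single) (auto simp: degree_upto_def Nplus_iff ndeg_def zero_prod_def)
  finally have "uexp p 0 n = (if p = (0, 1) then of_nat n else 0)"
    by (rule ordered_word_unique) (use assms in \<open>auto simp: degree_upto_def Nplus_iff\<close>)
  then show ?thesis using assms by auto
qed

lemma uexp_0_right:
  assumes "snd p > 0"
  shows "uexp p m 0 = 0"
proof -
  let ?l = "ndeg p"
  have pos: "?l > 0" using assms by (simp add: ndeg_def)
  have "word_value ?l (ordered_word ?l (\<lambda>p. uexp p m 0)) = letter ?l ((1, 0), of_nat m)"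
    by (simp add: uexp_ordered_word)
       (simp add: initial_word_def bch_zero_right bch_zero_left letter_trivial quot_carrier_letter)
  also have "\<dots> = word_value ?l (ordered_word ?l (\<lambda>q. if q = (1, 0) then of_nat m else 0))"
    using pos by (subst ordered_word_single) (auto simp: degree_upto_def Nplus_iff ndeg_def zero_prod_def)
  finally have "uexp p m 0 = (if p = (1, 0) then of_nat m else 0)"
    by (rule ordered_word_unique) (use assms in \<open>auto simp: degree_upto_def Nplus_iff\<close>)
  then show ?thesis using assms by auto
qed

section \<open>Words sorted by slope\<close>

definition merged :: "((nat \<times> nat) \<times> rat) list \<Rightarrow> nat \<times> nat \<Rightarrow> rat" where
  "merged w q = (\<Sum>x\<leftarrow>filter (\<lambda>x. fst x = q) w. snd x)"

lemma commute_prod_list: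
  fixes A :: "'a::monoid_mult"
  shows "(\<And>B. B \<in> set Bs \<Longrightarrow> A * B = B * A) \<Longrightarrow> A * prod_list Bs = prod_list Bs * A"
proof (induction Bs)
  case (Cons B Bs)
  have "A * prod_list (B # Bs) = (A * B) * prod_list Bs" by (simp add: mult.assoc)
  also have "A * B = B * A" using Cons.prems by simp
  also have "B * A * prod_list Bs = B * (A * prod_list Bs)" by (rule mult.assoc)
  also have "A * prod_list Bs = prod_list Bs * A" using Cons by simp
  finally show ?case by (simp add: mult.assoc)
qed simp

text \<open>A point q that precedes p in the ordered list is either parallel to p, and then the
  letters commute, or has {p, q} > 0, and then its exponent is 0. So the new factor travels to its
  place and merges there.\<close>

lemma ordered_word_insert:
  assumes p: "p \<noteq> 0" and u: "\<And>q. form p q > 0 \<Longrightarrow> u q = 0"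
  shows "word_kernel l ((p, e) # ordered_word l u) = word_kernel l (ordered_word l (u(p := e + u p)))"
proof (cases "ndeg p \<le> l")
  case False
  then have "ordered_word l (u(p := e + u p)) = ordered_word l u"
    by (intro ordered_word_cong) (auto simp: degree_upto_def)
  moreover have "letter l (p, e) = 0" using False by (intro letter_high) simp
  ultimately show ?thesis by (simp add: exp_kernel_zero)
next
  case True
  let ?L = "increasing_list (degree_upto l)"
  have "p \<in> set ?L" using True p degree_list(2)[of l] by (simp add: degree_upto_def Nplus_iff)
  then obtain L1 L2 where L: "?L = L1 @ p # L2" by (auto simp: in_set_conv_decomp)
  have srt: "sorted_wrt nless (L1 @ p # L2)" using degree_list(1)[of l] L by simp
  then have notin: "p \<notin> set L1" "p \<notin> set L2" using distinct_nless by fastforce+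
  let ?K = "\<lambda>q v. exp_kernel l (letter l (q, v))"
  have comm: "?K p e * ?K q (u q) = ?K q (u q) * ?K p e" if q: "q \<in> set L1" for q
  proof -
    have "nless q p" using srt q by (simp add: sorted_wrt_append)
    moreover have "q \<noteq> 0" using q degree_list(2)[of l] degree_upto_nonzero[of l] L by auto
    ultimately have "form q p < 0 \<or> form q p = 0" using p nless_iff by blast
    then show ?thesis
    proof
      assume "form q p < 0"
      then have "u q = 0" using u form_antisym[of q p] by simp
      then show ?thesis by (simp add: letter_trivial exp_kernel_zero)
    next
      assume "form q p = 0"
      then have "form p q = 0" using form_antisym[of p q] by simp
      then show ?thesis using letter_commute[of p q l e "u q"] by simp
    qed
  qed
  have "word_kernel l ((p, e) # ordered_word l u) =
     ?K p e * (prod_list (map (\<lambda>q. ?K q (u q)) L1) * (?K p (u p) * word_kernel l (map (\<lambda>q. (q, u q)) L2)))"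
    unfolding ordered_word_def L by (simp add: word_kernel_def o_def)
  also have "\<dots> = prod_list (map (\<lambda>q. ?K q (u q)) L1) * (?K p e * ?K p (u p) * word_kernel l (map (\<lambda>q. (q, u q)) L2))"
  proof -
    have "?K p e * prod_list (map (\<lambda>q. ?K q (u q)) L1) = prod_list (map (\<lambda>q. ?K q (u q)) L1) * ?K p e"
      by (rule commute_prod_list) (use comm in auto)
    then show ?thesis by (simp flip: mult.assoc)
  qed
  also have "?K p e * ?K p (u p) = ?K p (e + u p)"
    using letter_merge[of l p e "u p"] by simp
  also have "prod_list (map (\<lambda>q. ?K q (u q)) L1) * (?K p (e + u p) * word_kernel l (map (\<lambda>q. (q, u q)) L2)) =
     word_kernel l (ordered_word l (u(p := e + u p)))"
  proof -
    have "ordered_word l (u(p := e + u p)) = map (\<lambda>q. (q, u q)) L1 @ (p, e + u p) # map (\<lambda>q. (q, u q)) L2"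
      unfolding ordered_word_def L using notin by auto
    then show ?thesis by (simp add: word_kernel_def o_def)
  qed
  finally show ?thesis .
qed

text \<open>Sorting by the sign of the form leaves open repetitions and the order of parallel
  points, and parallel letters commute.\<close>

lemma merged_ordered_word:
  assumes "sorted_wrt (\<lambda>x y. form (fst x) (fst y) \<le> 0) w" "\<And>x. x \<in> set w \<Longrightarrow> fst x \<noteq> 0"
  shows "word_kernel l w = word_kernel l (ordered_word l (merged w))"
  using assms
proof (induction w)
  case Nil
  show ?case by (simp add: merged_def ordered_word_def) (rule word_kernel_trivial, auto simp: letter_trivial)
next
  case (Cons x w)
  obtain p e where x: "x = (p, e)" by (cases x)
  have p: "p \<noteq> 0" using Cons.prems(2)[of x] by (simp add: x)
  have sorted: "form p (fst y) \<le> 0" if "y \<in> set w" for y using Cons.prems(1) that by (simp add: x)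
  have "word_kernel l w = word_kernel l (ordered_word l (merged w))"
    by (rule Cons.IH) (use Cons.prems in auto)
  then have "word_kernel l (x # w) = word_kernel l ((p, e) # ordered_word l (merged w))" by (simp add: x)
  also have "\<dots> = word_kernel l (ordered_word l ((merged w)(p := e + merged w p)))"
  proof (rule ordered_word_insert[OF p])
    fix q assume "form p q > 0"
    then have "fst y \<noteq> q" if "y \<in> set w" for y using sorted[OF that] by auto
    then have "filter (\<lambda>x. fst x = q) w = []" by (simp add: filter_empty_conv)
    then show "merged w q = 0" by (simp add: merged_def)
  qed
  also have "(merged w)(p := e + merged w p) = merged (x # w)"
    by (rule ext) (simp add: merged_def x)
  finally show ?case .
qed

section \<open>Label counts and binomial expansions\<close>

text \<open>\<open>set_count A B x y f\<close>: \<open>f U\<close> is the number of labels contained in \<open>U\<close>, for a finite multiset of labels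
  \<open>S \<subseteq> A \<union> B\<close> with \<open>|S \<inter> A| \<le> x\<close> and \<open>|S \<inter> B| \<le> y\<close>.\<close>

inductive set_count :: "nat set \<Rightarrow> nat set \<Rightarrow> nat \<Rightarrow> nat \<Rightarrow> (nat set \<Rightarrow> nat) \<Rightarrow> bool" for A B x y where
  zero: "set_count A B x y (\<lambda>U. 0)"
| insert: "set_count A B x y f \<Longrightarrow> S \<subseteq> A \<union> B \<Longrightarrow> card (S \<inter> A) \<le> x \<Longrightarrow> card (S \<inter> B) \<le> y \<Longrightarrow>
    set_count A B x y (\<lambda>U. f U + of_bool (S \<subseteq> U))"

lemma set_count_add:
  assumes "set_count A B x y f" "set_count A B x y g"
  shows "set_count A B x y (\<lambda>U. f U + g U)"
  using assms(2)
proof induction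
  case (insert g S)
  from set_count.insert[OF insert.IH insert.hyps(2-4)] show ?case by (simp add: add.assoc)
qed (use assms(1) in simp)

lemma set_count_mono:
  assumes "set_count A B x y f" "x \<le> x'" "y \<le> y'"
  shows "set_count A B x' y' f"
  using assms(1) by induction (use assms(2,3) in \<open>auto intro!: set_count.intros\<close>)

lemma set_count_sum:
  assumes "\<And>i. i \<in> I \<Longrightarrow> set_count A B x y (f i)"
  shows "set_count A B x y (\<lambda>U. \<Sum>i\<in>I. f i U)"
  using assms
  by (induction I rule: infinite_finite_induct) (auto intro: set_count.zero set_count_add)

lemma set_count_indicator:
  assumes "S \<subseteq> A \<union> B" "card (S \<inter> A) \<le> x" "card (S \<inter> B) \<le> y"
  shows "set_count A B x y (\<lambda>U. of_bool (S \<subseteq> U))"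
  using set_count.insert[OF set_count.zero assms] by simp

lemma set_count_one: "set_count A B x y (\<lambda>U. 1)"
  using set_count_indicator[of "{}" A B x y] by simp

lemma set_count_const_mult:
  assumes "set_count A B x y f"
  shows "set_count A B x y (\<lambda>U. c * f U)"
proof (induction c)
  case (Suc c)
  from set_count_add[OF assms Suc] show ?case by simp
qed (simp add: set_count.zero)

lemma card_Un_Int_le: "card ((S \<union> T) \<inter> A) \<le> card (S \<inter> A) + card (T \<inter> A)"
  by (metis Int_Un_distrib2 card_Un_le)

text \<open>S \<subseteq> U and T \<subseteq> U together mean S \<union> T \<subseteq> U, so
  products of indicators are indicators and the size bounds add.\<close>

lemma set_count_mult:
  assumes f: "set_count A B x y f" and g: "set_count A B x' y' g"
  shows "set_count A B (x + x') (y + y') (\<lambda>U. f U * g U)"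
proof -
  have ind: "set_count A B (x + x') (y + y') (\<lambda>U. f U * of_bool (T \<subseteq> U))"
    if T: "T \<subseteq> A \<union> B" "card (T \<inter> A) \<le> x'" "card (T \<inter> B) \<le> y'" for T
    using f
  proof induction
    case zero
    show ?case by (simp add: set_count.zero)
  next
    case (insert f S)
    have "card ((S \<union> T) \<inter> A) \<le> x + x'" "card ((S \<union> T) \<inter> B) \<le> y + y'"
      using card_Un_Int_le[of S T A] card_Un_Int_le[of S T B] insert.hyps T by linarith+
    then have "set_count A B (x + x') (y + y') (\<lambda>U. f U * of_bool (T \<subseteq> U) + of_bool (S \<union> T \<subseteq> U))"
      using insert.hyps T insert.IH by (intro set_count.insert) auto
    moreover have "(\<lambda>U. f U * of_bool (T \<subseteq> U) + of_bool (S \<union> T \<subseteq> U)) =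
      (\<lambda>U. (f U + of_bool (S \<subseteq> U)) * of_bool (T \<subseteq> U))"
      by (auto simp: fun_eq_iff)
    ultimately show ?case by simp
  qed
  show ?thesis
    using g
  proof induction
    case (insert g S)
    from set_count_add[OF insert.IH ind[OF insert.hyps(2-4)]] show ?case by (simp add: distrib_left)
  qed (simp add: set_count.zero)
qed

text \<open>Pascal's rule: adding one label S to the count f changes (f choose h + 1) by (f choose
  h) times the indicator of S \<subseteq> U, which is again a label count.\<close>

lemma set_count_choose:
  assumes "set_count A B x y f"
  shows "set_count A B (i * x) (i * y) (\<lambda>U. f U choose i)"
  using assms
proof (induction arbitrary: i)
  case zero
  show ?case
  proof (cases "i = 0")
    case True
    then show ?thesis using set_count_one[of A B 0 0] by simp
  next
    case False
    then show ?thesis by (simp add: set_count.zero binomial_eq_0)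
  qed
next
  case (insert f S)
  show ?case
  proof (cases i)
    case 0
    then show ?thesis using set_count_one[of A B 0 0] by simp
  next
    case (Suc h)
    have "set_count A B (h * x + x) (h * y + y) (\<lambda>U. (f U choose h) * of_bool (S \<subseteq> U))"
      by (intro set_count_mult insert.IH set_count_indicator insert.hyps)
    then have "set_count A B (i * x) (i * y) (\<lambda>U. (f U choose i) + (f U choose h) * of_bool (S \<subseteq> U))"
      using insert.IH[of i] by (intro set_count_add) (simp_all add: Suc add.commute)
    moreover have "(f U choose i) + (f U choose h) * of_bool (S \<subseteq> U) = (f U + of_bool (S \<subseteq> U)) choose i" for U
      by (simp add: Suc)
    ultimately show ?thesis by (simp only:)
  qed
qed

lemma set_count_explicit:
  assumes "finite A" "finite B" "set_count A B x y f"
  shows "\<exists>c. (\<forall>U. f U = (\<Sum>S\<in>Pow (A \<union> B). c S * of_bool (S \<subseteq> U))) \<and>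
    (\<forall>S. c S \<noteq> 0 \<longrightarrow> card (S \<inter> A) \<le> x \<and> card (S \<inter> B) \<le> y)"
  using assms(3)
proof induction
  case zero
  show ?case by (rule exI[of _ "\<lambda>_. 0"]) simp
next
  case (insert f T)
  then obtain c where c: "\<And>U. f U = (\<Sum>S\<in>Pow (A \<union> B). c S * of_bool (S \<subseteq> U))"
    "\<And>S. c S \<noteq> 0 \<Longrightarrow> card (S \<inter> A) \<le> x \<and> card (S \<inter> B) \<le> y" by blast
  have "f U + of_bool (T \<subseteq> U) = (\<Sum>S\<in>Pow (A \<union> B). (c S + of_bool (S = T)) * of_bool (S \<subseteq> U))" for U
  proof -
    have "(\<Sum>S\<in>Pow (A \<union> B). (c S + of_bool (S = T)) * of_bool (S \<subseteq> U)) =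
      (\<Sum>S\<in>Pow (A \<union> B). c S * of_bool (S \<subseteq> U)) + (\<Sum>S\<in>Pow (A \<union> B). if S = T then of_bool (T \<subseteq> U) else 0)"
      unfolding sum.distrib[symmetric] by (intro sum.cong) (auto simp: distrib_right)
    also have "\<dots> = f U + of_bool (T \<subseteq> U)" using insert.hyps assms by (simp add: c(1))
    finally show ?thesis ..
  qed
  then show ?case using c(2) insert.hyps by (intro exI[of _ "\<lambda>S. c S + of_bool (S = T)"]) auto
qed

lemma set_count_of_explicit:
  assumes "\<And>S. c S \<noteq> 0 \<Longrightarrow> card (S \<inter> A) \<le> x \<and> card (S \<inter> B) \<le> y"
  shows "set_count A B x y (\<lambda>U. \<Sum>S\<in>Pow (A \<union> B). c S * of_bool (S \<subseteq> U))"
proof (rule set_count_sum)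
  fix S assume S: "S \<in> Pow (A \<union> B)"
  show "set_count A B x y (\<lambda>U. c S * of_bool (S \<subseteq> U))"
  proof (cases "c S = 0")
    case True
    then show ?thesis by (simp add: set_count.zero)
  next
    case False
    then show ?thesis using assms[OF False] S by (intro set_count_const_mult set_count_indicator) auto
  qed
qed

lemma sum_subsets_restrict:
  fixes c :: "nat set \<Rightarrow> 'a::semiring_1"
  assumes "finite I" "U \<subseteq> I"
  shows "(\<Sum>S\<in>Pow I. c S * of_bool (S \<subseteq> U)) = (\<Sum>S\<in>Pow U. c S)"
  using assms by (intro sum.mono_neutral_cong_right) auto

lemma sum_Pow_top:
  fixes c :: "nat set \<Rightarrow> 'a::comm_monoid_add"
  assumes "finite U"
  shows "(\<Sum>S\<in>Pow U. c S) = c U + (\<Sum>S\<in>Pow U - {U}. c S)"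
  using assms by (subst sum.remove[of _ U]) auto

text \<open>By inversion over subsets the multiplicities are integer combinations of the values. As
  every value is a multiple of D, so is every multiplicity, and the quotients are multiplicities for
  E with the same size bounds.\<close>

lemma set_count_divide:
  assumes fin: "finite A" "finite B" and D: "D > 0" and sc: "set_count A B x y (\<lambda>U. D * E U)"
  shows "set_count A B x y E"
proof -
  obtain c where c: "\<And>U. D * E U = (\<Sum>S\<in>Pow (A \<union> B). c S * of_bool (S \<subseteq> U))"
    "\<And>S. c S \<noteq> 0 \<Longrightarrow> card (S \<inter> A) \<le> x \<and> card (S \<inter> B) \<le> y"
    using set_count_explicit[OF fin sc] by blast
  have dvd: "D dvd c S" if "S \<subseteq> A \<union> B" "finite S" for S
    using that(2,1)
  proof (induction S rule: finite_psubset_induct)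
    case (psubset S)
    have "D * E S = (\<Sum>T\<in>Pow S. c T)"
      using sum_subsets_restrict[of "A \<union> B" S c] fin psubset.prems c(1)[of S] by simp
    then have "c S + (\<Sum>T\<in>Pow S - {S}. c T) = D * E S"
      using sum_Pow_top[OF psubset.hyps(1), of c] by simp
    then have "D dvd c S + (\<Sum>T\<in>Pow S - {S}. c T)" by (rule dvdI)
    moreover have "D dvd (\<Sum>T\<in>Pow S - {S}. c T)"
    proof (rule dvd_sum)
      fix T assume "T \<in> Pow S - {S}"
      then have "T \<subset> S" by auto
      then show "D dvd c T" using psubset.IH psubset.prems by blast
    qed
    ultimately show ?case by (simp add: dvd_add_left_iff)
  qed
  have E: "E = (\<lambda>U. \<Sum>S\<in>Pow (A \<union> B). (c S div D) * of_bool (S \<subseteq> U))"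
  proof
    fix U
    have "D * (\<Sum>S\<in>Pow (A \<union> B). (c S div D) * of_bool (S \<subseteq> U)) = (\<Sum>S\<in>Pow (A \<union> B). c S * of_bool (S \<subseteq> U))"
      unfolding sum_distrib_left
    proof (intro sum.cong refl)
      fix S assume "S \<in> Pow (A \<union> B)"
      then have "D dvd c S" using dvd fin by (meson PowD finite_UnI finite_subset)
      then show "D * (c S div D * of_bool (S \<subseteq> U)) = c S * of_bool (S \<subseteq> U)" by (simp flip: mult.assoc)
    qed
    then have "D * E U = D * (\<Sum>S\<in>Pow (A \<union> B). (c S div D) * of_bool (S \<subseteq> U))" using c(1)[of U] by simp
    then show "E U = (\<Sum>S\<in>Pow (A \<union> B). (c S div D) * of_bool (S \<subseteq> U))" using D by simp
  qed
  show ?thesis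
    unfolding E
  proof (rule set_count_of_explicit)
    fix S assume "c S div D \<noteq> 0"
    then have "c S \<noteq> 0" by (cases "c S = 0") simp_all
    then show "card (S \<inter> A) \<le> x \<and> card (S \<inter> B) \<le> y" by (rule c(2))
  qed
qed

section \<open>Newton coefficients and sums over subsets\<close>

fun newton_coeff :: "(nat \<Rightarrow> int) \<Rightarrow> nat \<Rightarrow> int" where
  "newton_coeff F m = F m - (\<Sum>i<m. int (m choose i) * newton_coeff F i)"

declare newton_coeff.simps [simp del]

lemma newton_expansion: "F m = (\<Sum>i\<le>m. int (m choose i) * newton_coeff F i)"
  using newton_coeff.simps[of F m] by (simp flip: lessThan_Suc_atMost)

lemma newton_coeff_0: "newton_coeff F 0 = F 0"
  using newton_coeff.simps[of F 0] by simp

lemma newton_coeff_zero: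
  assumes "\<And>m. F m = 0"
  shows "newton_coeff F i = 0"
proof (induction i rule: less_induct)
  case (less i)
  have "(\<Sum>k<i. int (i choose k) * newton_coeff F k) = 0" by (rule sum.neutral) (use less in simp)
  then show ?case using newton_coeff.simps[of F i] assms[of i] by simp
qed

lemma sum_Pow_card:
  fixes \<phi> :: "nat \<Rightarrow> int"
  assumes "finite A"
  shows "(\<Sum>S\<in>Pow A. \<phi> (card S)) = (\<Sum>i\<le>card A. int (card A choose i) * \<phi> i)"
proof -
  have "(\<Sum>S\<in>Pow A. \<phi> (card S)) = (\<Sum>i\<le>card A. \<Sum>S | S \<in> Pow A \<and> card S = i. \<phi> (card S))"
    by (rule sum.group[symmetric]) (use assms in \<open>auto intro: card_mono\<close>)
  also have "\<dots> = (\<Sum>i\<le>card A. int (card A choose i) * \<phi> i)"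
  proof (rule sum.cong[OF refl])
    fix i
    have "(\<Sum>S | S \<in> Pow A \<and> card S = i. \<phi> (card S)) = (\<Sum>S | S \<subseteq> A \<and> card S = i. \<phi> i)"
      by (intro sum.cong) auto
    then show "(\<Sum>S | S \<in> Pow A \<and> card S = i. \<phi> (card S)) = int (card A choose i) * \<phi> i"
      using n_subsets[OF assms, of i] by simp
  qed
  finally show ?thesis .
qed

lemma sum_Pow_card2:
  fixes \<phi> :: "nat \<Rightarrow> nat \<Rightarrow> int"
  assumes "finite A" "finite B" "A \<inter> B = {}"
  shows "(\<Sum>S\<in>Pow (A \<union> B). \<phi> (card (S \<inter> A)) (card (S \<inter> B))) =
    (\<Sum>i\<le>card A. \<Sum>j\<le>card B. int (card A choose i) * int (card B choose j) * \<phi> i j)"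
proof -
  have "(\<Sum>S\<in>Pow (A \<union> B). \<phi> (card (S \<inter> A)) (card (S \<inter> B))) =
     (\<Sum>(S, T)\<in>Pow A \<times> Pow B. \<phi> (card S) (card T))"
    using assms(3)
    by (intro sum.reindex_bij_witness[of _ "\<lambda>(S, T). S \<union> T" "\<lambda>S. (S \<inter> A, S \<inter> B)"])
       (auto intro!: arg_cong2[of _ _ _ _ \<phi>] arg_cong[of _ _ card])
  also have "\<dots> = (\<Sum>S\<in>Pow A. \<Sum>j\<le>card B. int (card B choose j) * \<phi> (card S) j)"
    by (simp add: sum.cartesian_product[symmetric] sum_Pow_card[OF assms(2)])
  also have "\<dots> = (\<Sum>i\<le>card A. int (card A choose i) * (\<Sum>j\<le>card B. int (card B choose j) * \<phi> i j))"
    by (rule sum_Pow_card[OF assms(1)])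
  finally show ?thesis by (simp add: sum_distrib_left mult.assoc)
qed

lemma set_function_unique:
  fixes c d :: "nat set \<Rightarrow> int"
  assumes "finite U" "\<And>V. V \<subseteq> U \<Longrightarrow> (\<Sum>S\<in>Pow V. c S) = (\<Sum>S\<in>Pow V. d S)"
  shows "c U = d U"
  using assms
proof (induction U rule: finite_psubset_induct)
  case (psubset U)
  have "(\<Sum>S\<in>Pow U - {U}. c S) = (\<Sum>S\<in>Pow U - {U}. d S)"
  proof (rule sum.cong[OF refl])
    fix S assume S: "S \<in> Pow U - {U}"
    show "c S = d S" by (rule psubset.IH) (use S psubset.prems in auto)
  qed
  moreover have "(\<Sum>S\<in>Pow U. c S) = (\<Sum>S\<in>Pow U. d S)" by (rule psubset.prems) simp
  ultimately show ?case unfolding sum_Pow_top[OF psubset.hyps(1)] by simp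
qed

text \<open>The coefficients of a polynomial in the basis of products of binomials are the multiplicities of the
  labels when its values are realised as label counts.\<close>

lemma binomial_expansion:
  fixes F :: "nat \<Rightarrow> nat \<Rightarrow> nat"
  assumes count: "\<And>m n. \<exists>H. set_count {..<m} {m..<m + n} a b H \<and>
      (\<forall>U. F (card (U \<inter> {..<m})) (card (U \<inter> {m..<m + n})) = H U)"
    and zero: "\<And>n. F 0 n = 0" "\<And>m. F m 0 = 0"
  shows "\<exists>\<alpha>. \<forall>m n. F m n = (\<Sum>i\<in>{1..a}. \<Sum>j\<in>{1..b}. \<alpha> i j * (m choose i) * (n choose j))"
proof -
  define \<beta> where "\<beta> i j = newton_coeff (\<lambda>m. newton_coeff (\<lambda>n. int (F m n)) j) i" for i j
  have expand: "int (F m n) = (\<Sum>i\<le>m. \<Sum>j\<le>n. int (m choose i) * int (n choose j) * \<beta> i j)" for m n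
  proof -
    have "int (F m n) = (\<Sum>j\<le>n. int (n choose j) * (\<Sum>i\<le>m. int (m choose i) * \<beta> i j))"
      unfolding \<beta>_def newton_expansion[of "\<lambda>m. newton_coeff (\<lambda>n. int (F m n)) _" m, symmetric]
      by (rule newton_expansion)
    also have "\<dots> = (\<Sum>i\<le>m. \<Sum>j\<le>n. int (m choose i) * int (n choose j) * \<beta> i j)"
      unfolding sum_distrib_left by (subst sum.swap) (simp add: mult_ac)
    finally show ?thesis .
  qed
  have beta: "\<beta> i j \<ge> 0 \<and> (\<beta> i j \<noteq> 0 \<longrightarrow> i \<le> a \<and> j \<le> b)" for i j
  proof -
    let ?A = "{..<i}" and ?B = "{i..<i + j}"
    obtain H where H: "set_count ?A ?B a b H" "\<And>U. F (card (U \<inter> ?A)) (card (U \<inter> ?B)) = H U"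
      using count by blast
    obtain c where c: "\<And>U. H U = (\<Sum>S\<in>Pow (?A \<union> ?B). c S * of_bool (S \<subseteq> U))"
      "\<And>S. c S \<noteq> 0 \<Longrightarrow> card (S \<inter> ?A) \<le> a \<and> card (S \<inter> ?B) \<le> b"
      using set_count_explicit[OF _ _ H(1)] by auto
    \<comment> \<open>For every V the sums over Pow V agree: both equal F at the sizes of V \<inter>
      A and V \<inter> B. Hence the multiplicities are the Newton coefficients, and the full set,
      with sizes i and j, isolates \<beta> i j.\<close>
    have "int (c (?A \<union> ?B)) = \<beta> (card ((?A \<union> ?B) \<inter> ?A)) (card ((?A \<union> ?B) \<inter> ?B))"
    proof (rule set_function_unique[where c = "\<lambda>S. int (c S)" and d = "\<lambda>S. \<beta> (card (S \<inter> ?A)) (card (S \<inter> ?B))"])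
      fix V assume V: "V \<subseteq> ?A \<union> ?B"
      have fin: "finite V" using V finite_subset by blast
      have "(\<Sum>S\<in>Pow V. int (c S)) = int (H V)"
        using sum_subsets_restrict[of "?A \<union> ?B" V c] V c(1)[of V] by simp
      also have "\<dots> = int (F (card (V \<inter> ?A)) (card (V \<inter> ?B)))" by (simp add: H(2))
      also have "\<dots> = (\<Sum>S\<in>Pow (V \<inter> ?A \<union> V \<inter> ?B). \<beta> (card (S \<inter> (V \<inter> ?A))) (card (S \<inter> (V \<inter> ?B))))"
        unfolding expand using fin by (subst sum_Pow_card2) auto
      also have "V \<inter> ?A \<union> V \<inter> ?B = V" using V by blast
      also have "(\<Sum>S\<in>Pow V. \<beta> (card (S \<inter> (V \<inter> ?A))) (card (S \<inter> (V \<inter> ?B)))) =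
          (\<Sum>S\<in>Pow V. \<beta> (card (S \<inter> ?A)) (card (S \<inter> ?B)))"
      proof (rule sum.cong[OF refl])
        fix S assume "S \<in> Pow V"
        then have "S \<inter> (V \<inter> ?A) = S \<inter> ?A" "S \<inter> (V \<inter> ?B) = S \<inter> ?B" by auto
        then show "\<beta> (card (S \<inter> (V \<inter> ?A))) (card (S \<inter> (V \<inter> ?B))) = \<beta> (card (S \<inter> ?A)) (card (S \<inter> ?B))"
          by simp
      qed
      finally show "(\<Sum>S\<in>Pow V. int (c S)) = (\<Sum>S\<in>Pow V. \<beta> (card (S \<inter> ?A)) (card (S \<inter> ?B)))" .
    qed simp
    moreover have card: "card ((?A \<union> ?B) \<inter> ?A) = i" "card ((?A \<union> ?B) \<inter> ?B) = j"
      by (simp_all add: Int_absorb1)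
    ultimately have top: "\<beta> i j = int (c (?A \<union> ?B))" by (simp only:)
    show ?thesis
    proof (cases "c (?A \<union> ?B) = 0")
      case True
      then show ?thesis unfolding top by simp
    next
      case False
      from c(2)[OF False] show ?thesis unfolding card top by simp
    qed
  qed
  have beta0: "\<beta> 0 j = 0" "\<beta> i 0 = 0" for i j
  proof -
    have "\<beta> 0 j = newton_coeff (\<lambda>n. int (F 0 n)) j" by (simp add: \<beta>_def newton_coeff_0)
    then show "\<beta> 0 j = 0" by (simp add: newton_coeff_zero zero)
    show "\<beta> i 0 = 0" unfolding \<beta>_def by (rule newton_coeff_zero) (simp add: newton_coeff_0 zero)
  qed
  have "F m n = (\<Sum>i\<in>{1..a}. \<Sum>j\<in>{1..b}. nat (\<beta> i j) * (m choose i) * (n choose j))" for m n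
  proof -
    let ?T = "\<lambda>i j. int (m choose i) * int (n choose j) * \<beta> i j"
    have "int (F m n) = (\<Sum>(i, j)\<in>{..m} \<times> {..n}. ?T i j)"
      unfolding expand sum.cartesian_product ..
    \<comment> \<open>The enlarged rectangle contains both the Newton range and the target range;
      the added terms have a vanishing binomial.\<close>
    also have "\<dots> = (\<Sum>(i, j)\<in>{..m + a} \<times> {..n + b}. ?T i j)"
      by (rule sum.mono_neutral_left) (auto simp: binomial_eq_0)
    also have "\<dots> = (\<Sum>(i, j)\<in>{1..a} \<times> {1..b}. ?T i j)"
    proof (rule sum.mono_neutral_right)
      show "\<forall>x\<in>{..m + a} \<times> {..n + b} - {1..a} \<times> {1..b}. (case x of (i, j) \<Rightarrow> ?T i j) = 0"
      proof
        fix x assume x: "x \<in> {..m + a} \<times> {..n + b} - {1..a} \<times> {1..b}"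
        obtain i j where ij: "x = (i, j)" by (cases x)
        have "i = 0 \<or> j = 0 \<or> \<not> (i \<le> a \<and> j \<le> b)" using x ij by auto
        then have "\<beta> i j = 0" using beta[of i j] beta0 by auto
        then show "(case x of (i, j) \<Rightarrow> ?T i j) = 0" by (simp add: ij)
      qed
    qed auto
    also have "\<dots> = (\<Sum>i\<in>{1..a}. \<Sum>j\<in>{1..b}. ?T i j)" by (simp add: sum.cartesian_product)
    also have "\<dots> = int (\<Sum>i\<in>{1..a}. \<Sum>j\<in>{1..b}. nat (\<beta> i j) * (m choose i) * (n choose j))"
      using beta by (simp add: mult_ac)
    finally show ?thesis by (simp only: of_nat_eq_iff)
  qed
  then show ?thesis by (intro exI[of _ "\<lambda>i j. nat (\<beta> i j)"] allI)
qed

section \<open>Exchanging two neighbouring factors\<close>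

type_synonym labelled_letter = "(nat \<times> nat) \<times> (nat set \<Rightarrow> nat)"

definition vgcd :: "nat \<times> nat \<Rightarrow> nat" where
  "vgcd p = gcd (fst p) (snd p)"

lemma vgcd_pos: "p \<noteq> 0 \<Longrightarrow> vgcd p > 0"
  by (auto simp: vgcd_def prod_eq_iff)

text \<open>A letter stores gcd(p) times its exponent, which is a natural number for the integral
  nonnegative exponents considered here; the label set U is then substituted.\<close>

definition specialize :: "nat set \<Rightarrow> labelled_letter \<Rightarrow> (nat \<times> nat) \<times> rat" where
  "specialize U x = (fst x, of_nat (snd x U) / of_nat (vgcd (fst x)))"

lemma fst_specialize [simp]: "fst (specialize U x) = fst x"
  by (simp add: specialize_def)

text \<open>Bounding the label sizes by the two coordinates of p is compatible with passing from p
  and q to ap + bq. Letters of degree one keep exponents 0 or 1, as the pentagon relation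
  requires.\<close>

definition admissible :: "nat set \<Rightarrow> nat set \<Rightarrow> labelled_letter \<Rightarrow> bool" where
  "admissible A B x \<longleftrightarrow> fst x \<noteq> 0 \<and> set_count A B (fst (fst x)) (snd (fst x)) (snd x) \<and>
     (ndeg (fst x) = 1 \<longrightarrow> (\<forall>U. snd x U \<le> 1))"

lemma specialize_integral: "fst x \<noteq> 0 \<Longrightarrow> integral_letter (specialize U x)"
  using vgcd_pos[of "fst x"] by (simp add: integral_letter_def specialize_def vgcd_def)

definition expansion_upto :: "nat \<Rightarrow> bool" where
  "expansion_upto l \<longleftrightarrow> (\<forall>a b. a > 0 \<longrightarrow> b > 0 \<longrightarrow> a + b < l \<longrightarrow> (\<exists>\<alpha>. \<forall>m n.
     of_nat (gcd a b) * uexp (a, b) m n =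
       of_nat (\<Sum>i\<in>{1..a}. \<Sum>j\<in>{1..b}. \<alpha> i j * (m choose i) * (n choose j))))"

lemma word_value_map_filter:
  assumes "\<And>x. x \<in> set w \<Longrightarrow> \<not> P x \<Longrightarrow> letter l (f x) = 0"
  shows "word_value l (map f (filter P w)) = word_value l (map f w)"
  using assms by (induction w) (auto simp: bch_zero_left quot_carrier_word_value)

definition interior :: "nat \<Rightarrow> nat \<times> nat \<Rightarrow> nat \<times> nat \<Rightarrow> (nat \<times> nat) set" where
  "interior l p q = {r. 0 < fst r \<and> 0 < snd r \<and> ndeg r \<le> l \<and> ndeg (lattice_map p q r) \<le> l}"

lemma finite_interior: "finite (interior l p q)"
  by (rule finite_subset[of _ "{..l} \<times> {..l}"]) (auto simp: interior_def ndeg_def)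

lemma interior_nonzero: "0 \<notin> interior l p q"
  by (simp add: interior_def)

lemmas interior_list = increasing_list[OF finite_interior interior_nonzero]

text \<open>The image of the factorisation of [0,1]^N [1,0]^M under X_r \<mapsto> X_(\<theta>
  r)/\<kappa>, where \<theta> = \<open>lattice_map p q\<close> and \<kappa> = {q, p}. The choice M =
  \<kappa>u, N = \<kappa>v turns the outer factors into [p]^u and [q]^v. All other factors on the
  axes have exponent 0, and those outside \<open>interior\<close> are trivial by degree.\<close>

lemma swap_general:
  assumes \<kappa>: "form q p > 0" and l: "l > 0"
    and M: "of_int (form q p) * u = of_nat M" and N: "of_int (form q p) * v = of_nat N"
  shows "word_kernel l [(q, v), (p, u)] =
    word_kernel l ((p, u) # map (\<lambda>r. (lattice_map p q r, uexp r M N / of_int (form q p)))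
      (increasing_list (interior l p q)) @ [(q, v)])"
proof -
  let ?\<kappa> = "of_int (form q p) :: rat" and ?I = "increasing_list (interior l p q)"
  have k0: "?\<kappa> \<noteq> 0" using \<kappa> by simp
  let ?F = "\<lambda>x :: (nat \<times> nat) \<times> rat. (lattice_map p q (fst x), snd x / ?\<kappa>)"
  let ?w = "ordered_word l (\<lambda>r. uexp r M N)"
  let ?keep = "\<lambda>r. r = (1, 0) \<or> r = (0, 1) \<or> r \<in> interior l p q"
  have nz: "fst x \<noteq> 0" if "x \<in> set ?w" for x
    using that degree_list(2)[of l] degree_upto_nonzero[of l] by (auto simp: ordered_word_def)
  have "word_value l (map ?F ?w) = word_value l (map ?F (initial_word M N))"
  proof (rule scaling_word_value[OF \<kappa>])
    fix x assume "x \<in> set ?w \<union> set (initial_word M N)"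
    then show "fst x \<noteq> 0" using nz[of x] by (auto simp: initial_word_def zero_prod_def)
  qed (rule uexp_ordered_word)
  moreover have "map ?F (initial_word M N) = [(q, v), (p, u)]"
    using k0 by (simp add: initial_word_def lattice_map_def M[symmetric] N[symmetric])
  moreover have "word_value l (map ?F (filter (\<lambda>x. ?keep (fst x)) ?w)) = word_value l (map ?F ?w)"
  proof (rule word_value_map_filter)
    fix x assume x: "x \<in> set ?w" "\<not> ?keep (fst x)"
    then obtain r where r: "x = (r, uexp r M N)" "r \<in> degree_upto l"
      using degree_list(2)[of l] by (auto simp: ordered_word_def)
    have r0: "r \<noteq> 0" "ndeg r \<le> l" using r(2) by (simp_all add: degree_upto_def Nplus_iff)
    consider "fst r = 0" | "snd r = 0" | "ndeg (lattice_map p q r) > l"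
      using x(2) r0 by (auto simp: r(1) interior_def)
    then show "letter l (?F x) = 0"
    proof cases
      case 1
      then show ?thesis using uexp_y_axis[OF 1 r0(1)] x(2) by (simp add: r(1) letter_trivial)
    next
      case 2
      then show ?thesis using uexp_x_axis[OF 2 r0(1)] x(2) by (simp add: r(1) letter_trivial)
    next
      case 3
      then show ?thesis by (intro letter_high) (simp add: r(1))
    qed
  qed
  moreover have "filter (\<lambda>x. ?keep (fst x)) ?w = map (\<lambda>r. (r, uexp r M N)) ((1, 0) # ?I @ [(0, 1)])"
  proof -
    have "filter ?keep (increasing_list (degree_upto l)) = (1, 0) # ?I @ [(0, 1)]"
    proof (rule nless_sorted_unique)
      show "sorted_wrt nless (filter ?keep (increasing_list (degree_upto l)))"
        using degree_list(1) by (rule sorted_wrt_filter)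
      have i: "0 < fst r" "0 < snd r" if "r \<in> set ?I" for r
        using that interior_list(2)[of l p q] by (simp_all add: interior_def)
      have "nless (1, 0) r" "nless r (0, 1)" if "r \<in> set ?I" for r
      proof -
        have "r \<noteq> 0" using i(1)[OF that] by auto
        then show "nless (1, 0) r" "nless r (0, 1)"
          using i[OF that] by (simp_all add: nless_iff zero_prod_def form_def)
      qed
      moreover have "nless (1, 0) (0, 1)" by (simp add: nless_iff zero_prod_def form_def)
      ultimately show "sorted_wrt nless ((1, 0) # ?I @ [(0, 1)])"
        using interior_list(1) by (simp add: sorted_wrt_append)
      have "interior l p q \<subseteq> degree_upto l" by (auto simp: interior_def degree_upto_def Nplus_iff)
      moreover have "(1, 0) \<in> degree_upto l" "(0, 1) \<in> degree_upto l"
        using l by (auto simp: degree_upto_def Nplus_iff ndeg_def zero_prod_def)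
      ultimately show "set (filter ?keep (increasing_list (degree_upto l))) = set ((1, 0) # ?I @ [(0, 1)])"
        using degree_list(2)[of l] interior_list(2)[of l p q] by auto
      show "0 \<notin> set (filter ?keep (increasing_list (degree_upto l)))"
        using degree_list(2)[of l] degree_upto_nonzero[of l] by simp
    qed
    then show ?thesis by (simp add: ordered_word_def filter_map o_def)
  qed
  moreover have "map ?F (map (\<lambda>r. (r, uexp r M N)) ((1, 0) # ?I @ [(0, 1)])) =
     (p, u) # map (\<lambda>r. (lattice_map p q r, uexp r M N / ?\<kappa>)) ?I @ [(q, v)]"
  proof -
    have "uexp (1, 0) M N = of_nat M" "uexp (0, 1) M N = of_nat N"
      using uexp_x_axis[of "(1, 0)"] uexp_y_axis[of "(0, 1)"] by (simp_all add: zero_prod_def)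
    then show ?thesis using k0 by (simp add: lattice_map_def M[symmetric] N[symmetric])
  qed
  ultimately have "word_value l [(q, v), (p, u)] =
      word_value l ((p, u) # map (\<lambda>r. (lattice_map p q r, uexp r M N / ?\<kappa>)) ?I @ [(q, v)])"
    by (simp only:)
  then show ?thesis by (simp only: word_value_eq_iff)
qed

lemma lattice_map_inj:
  assumes "form q p \<noteq> 0" "lattice_map p q r = lattice_map p q s"
  shows "r = s"
proof -
  have "form q p * form r t = form q p * form s t" for t
    using assms(2) by (metis form_lattice_map)
  then have "form r t = form s t" for t using assms(1) by simp
  from this[of "(1, 0)"] this[of "(0, 1)"] show ?thesis by (simp add: form_def prod_eq_iff)
qed

lemma merged_map_inj:
  assumes "distinct xs" "r \<in> set xs" "inj_on f (set xs)"
  shows "merged (map (\<lambda>r. (f r, g r)) xs) (f r) = g r"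
proof -
  have "filter (\<lambda>x. fst x = f r) (map (\<lambda>r. (f r, g r)) xs) = map (\<lambda>r. (f r, g r)) (filter (\<lambda>s. s = r) xs)"
    using assms(2,3) by (auto simp: filter_map o_def inj_on_def intro!: arg_cong[of _ _ "map _"] filter_cong)
  also have "\<dots> = [(f r, g r)]" using filter_eq_singleton[OF assms(1,2)] by simp
  finally show ?thesis by (simp add: merged_def)
qed

text \<open>Since {q, p} > 0, the lattice map is injective and preserves the order of slopes. So the
  exchanged word is sorted without repetitions, and its exponents are those of the ordered
  factorisation of the integral word [q]^v [p]^u, to which \<open>ordered_word_integral\<close>
  applies.\<close>

lemma swap_integral:
  assumes \<kappa>: "form q p > 0" and l: "l > 0"
    and M: "of_int (form q p) * u = of_nat M" and N: "of_int (form q p) * v = of_nat N"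
    and int: "integral_letter (q, v)" "integral_letter (p, u)" and r: "r \<in> interior l p q"
  shows "of_nat (vgcd (lattice_map p q r)) * (uexp r M N / of_int (form q p)) \<in> \<int>"
proof -
  let ?I = "increasing_list (interior l p q)"
  let ?g = "\<lambda>r. uexp r M N / of_int (form q p)" and ?f = "lattice_map p q"
  let ?w = "(p, u) # map (\<lambda>r. (?f r, ?g r)) ?I @ [(q, v)]"
  have p: "p \<noteq> 0" and q: "q \<noteq> 0" using \<kappa> by (auto simp: form_simps)
  have ends: "p = ?f (1, 0)" "q = ?f (0, 1)" by (simp_all add: lattice_map_def)
  let ?R = "(1, 0) # ?I @ [(0, 1)]"
  let ?h = "\<lambda>r. if r = (1, 0) then u else if r = (0, 1) then v else ?g r"
  have notin: "(1, 0) \<notin> set ?I" "(0, 1) \<notin> set ?I"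
    unfolding interior_list(2) by (simp_all add: interior_def)
  have w: "?w = map (\<lambda>r. (?f r, ?h r)) ?R"
    using notin ends by auto
  have pos: "0 < fst s" "0 < snd s" if "s \<in> set ?I" for s
    using that interior_list(2)[of l p q] by (simp_all add: interior_def)
  have "sorted_wrt (\<lambda>r s. form r s \<le> 0) ?R"
  proof -
    have "sorted_wrt (\<lambda>r s. form r s \<le> 0) ?I"
    proof (rule sorted_wrt_mono_rel[OF _ interior_list(1)])
      fix r s assume rs: "r \<in> set ?I" "s \<in> set ?I" "nless r s"
      have "r \<noteq> 0" "s \<noteq> 0" using pos(1)[OF rs(1)] pos(1)[OF rs(2)] by auto
      then show "form r s \<le> 0" using rs(3) by (auto simp: nless_iff)
    qed
    then show ?thesis by (auto simp: sorted_wrt_append form_def)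
  qed
  then have "sorted_wrt (\<lambda>x y. form (fst x) (fst y) \<le> 0) (map (\<lambda>r. (?f r, ?h r)) ?R)"
    unfolding sorted_wrt_map fst_conv form_lattice_map
    using \<kappa> by (rule_tac sorted_wrt_mono_rel) (auto simp: mult_le_0_iff)
  moreover have "fst x \<noteq> 0" if x: "x \<in> set (map (\<lambda>r. (?f r, ?h r)) ?R)" for x
  proof -
    obtain s where s: "s \<in> set ?R" "x = (?f s, ?h s)" using x unfolding set_map by blast
    have "0 \<notin> set ?I" using pos(1)[of 0] by auto
    then have "s \<noteq> 0" using s(1) by (auto simp: zero_prod_def)
    then have "0 < ndeg (?f s)" using ndeg_lattice_map_ge[OF p q, of s] ndeg_pos[of s] by linarith
    then show ?thesis unfolding s(2) fst_conv by (auto simp: ndeg_def)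
  qed
  ultimately have "word_kernel l ?w = word_kernel l (ordered_word l (merged ?w))"
    unfolding w by (rule merged_ordered_word)
  then have "word_value l [(q, v), (p, u)] = word_value l (ordered_word l (merged ?w))"
    unfolding word_value_eq_iff swap_general[OF \<kappa> l M N] .
  then have "of_nat (gcd (fst (?f r)) (snd (?f r))) * merged ?w (?f r) \<in> \<int>"
  proof (rule ordered_word_integral[rotated])
    have "0 < ndeg r" using r by (simp add: interior_def ndeg_def)
    then have "0 < ndeg (?f r)" using ndeg_lattice_map_ge[OF p q, of r] by linarith
    then have "?f r \<noteq> 0" by (auto simp: ndeg_def)
    then show "?f r \<in> degree_upto l" using r by (simp add: interior_def degree_upto_def Nplus_iff)
  qed (use int in auto)
  moreover have "merged ?w (?f r) = ?g r"
  proof -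
    have rI: "r \<in> set ?I" using r interior_list(2)[of l p q] by simp
    have "inj_on ?f (set ?R)" using lattice_map_inj[of q p] \<kappa> by (auto simp: inj_on_def)
    moreover have "distinct ?R" using distinct_nless[OF interior_list(1)] notin by simp
    moreover have "r \<in> set ?R" using rI by simp
    ultimately have "merged ?w (?f r) = ?h r" unfolding w by (intro merged_map_inj)
    moreover have "r \<noteq> (1, 0)" "r \<noteq> (0, 1)" using rI notin by auto
    ultimately show ?thesis by simp
  qed
  ultimately show ?thesis by (simp add: vgcd_def)
qed

lemma degree_one_cases:
  assumes "form q p > 0" "ndeg p = 1" "ndeg q = 1"
  shows "p = (1, 0)" "q = (0, 1)"
proof -
  have "p = (1, 0) \<or> p = (0, 1)" "q = (1, 0) \<or> q = (0, 1)"
    using assms(2,3) by (cases p; cases q; auto simp: ndeg_def add_is_1)+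
  then show "p = (1, 0)" "q = (0, 1)" using assms(1) by (auto simp: form_def)
qed

text \<open>If an exponent is 0 at U, one of the two letters is trivial and so is [1,1]; if both are
  1, this is the pentagon. The product g f covers all cases.\<close>

lemma swap_degree_one:
  assumes "\<And>U. f U \<le> 1" "\<And>U. g U \<le> 1"
  shows "word_kernel l (map (specialize U) [((0, 1), f), ((1, 0), g)]) =
    word_kernel l (map (specialize U) [((1, 0), g), ((1, 1), \<lambda>U. g U * f U), ((0, 1), f)])"
proof -
  have "f U = 0 \<or> f U = 1" "g U = 0 \<or> g U = 1" using assms[of U] by linarith+
  then show ?thesis using pentagon[of l]
    by (auto simp: specialize_def vgcd_def letter_trivial exp_kernel_zero)
qed

lemma set_count_binomial_sum:
  assumes M: "set_count A B x y M" and N: "set_count A B x' y' N"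
  shows "set_count A B (a * x + b * x') (a * y + b * y')
    (\<lambda>U. \<Sum>i\<in>{1..a}. \<Sum>j\<in>{1..b}. \<alpha> i j * (M U choose i) * (N U choose j))"
proof (intro set_count_sum)
  fix i j assume "i \<in> {1..a}" "j \<in> {1..b}"
  then have "i * x + j * x' \<le> a * x + b * x'" "i * y + j * y' \<le> a * y + b * y'"
    by (auto intro!: add_mono mult_le_mono1)
  moreover have "set_count A B (i * x + j * x') (i * y + j * y') (\<lambda>U. \<alpha> i j * ((M U choose i) * (N U choose j)))"
    by (intro set_count_const_mult set_count_mult set_count_choose M N)
  ultimately show "set_count A B (a * x + b * x') (a * y + b * y') (\<lambda>U. \<alpha> i j * (M U choose i) * (N U choose j))"
    by (simp add: mult.assoc set_count_mono)
qed

text \<open>The exchange carried out for all U at once. The created letters do not depend on U, only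
  their counts do, and these counts stay admissible.\<close>

lemma swap_labelled:
  assumes exp: "expansion_upto l" and l: "l > 0" and fin: "finite A" "finite B"
    and q: "admissible A B (q, f)" and p: "admissible A B (p, g)" and \<kappa>: "form q p > 0"
  shows "\<exists>Ms. (\<forall>z\<in>set Ms. admissible A B z \<and> ndeg q + ndeg p \<le> ndeg (fst z) \<and> ndeg (fst z) \<le> l) \<and>
    (\<forall>U. word_kernel l (map (specialize U) [(q, f), (p, g)]) =
         word_kernel l (map (specialize U) ((p, g) # Ms @ [(q, f)])))"
proof (cases "ndeg p = 1 \<and> ndeg q = 1")
  case True
  have pq: "p = (1, 0)" "q = (0, 1)" using degree_one_cases[OF \<kappa>] True by auto
  have le: "f U \<le> 1" "g U \<le> 1" for U using q p True by (auto simp: admissible_def)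
  let ?z = "((1, 1), \<lambda>U. g U * f U) :: labelled_letter"
  note eq = swap_degree_one[of f g, OF le]
  show ?thesis
  proof (cases "l \<ge> 2")
    case True
    have "set_count A B (1 + 0) (0 + 1) (\<lambda>U. g U * f U)"
      by (rule set_count_mult) (use p q pq in \<open>simp_all add: admissible_def\<close>)
    then have "admissible A B ?z" by (simp add: admissible_def zero_prod_def ndeg_def)
    then show ?thesis using eq True by (intro exI[of _ "[?z]"]) (simp add: pq ndeg_def)
  next
    case False
    then have "letter l (specialize U ?z) = 0" for U by (intro letter_high) (simp add: ndeg_def)
    then show ?thesis using eq by (intro exI[of _ "[]"]) (simp add: pq exp_kernel_zero)
  qed
next
  case False
  have p0: "p \<noteq> 0" and q0: "q \<noteq> 0" using p q by (auto simp: admissible_def)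
  let ?\<theta> = "lattice_map p q" and ?\<kappa> = "nat (form q p)"
  have \<kappa>_int: "int ?\<kappa> = form q p" and \<kappa>_pos: "?\<kappa> > 0" using \<kappa> by simp_all
  have \<kappa>_rat: "(of_int (form q p) :: rat) = of_nat ?\<kappa>" by (metis \<kappa>_int of_int_of_nat_eq)
  \<comment> \<open>Both gcd(p) and gcd(q) divide \<kappa>, so the rescaled exponents M and N are
    natural multiples of the counts g and f.\<close>
  have "int (vgcd q) dvd int ?\<kappa>" using form_gcd[of q p] by (simp only: \<kappa>_int vgcd_def)
  then obtain kq where kq: "?\<kappa> = vgcd q * kq" by (auto simp only: int_dvd_int_iff elim: dvdE)
  have "int (vgcd p) dvd form q p" unfolding form_antisym[of q p] vgcd_def dvd_minus_iff by (rule form_gcd)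
  then have "int (vgcd p) dvd int ?\<kappa>" by (simp only: \<kappa>_int)
  then obtain kp where kp: "?\<kappa> = vgcd p * kp" by (auto simp only: int_dvd_int_iff elim: dvdE)
  define M where "M U = kp * g U" for U
  define N where "N U = kq * f U" for U
  have M: "of_int (form q p) * (of_nat (g U) / of_nat (vgcd p)) = (of_nat (M U) :: rat)" for U
    unfolding \<kappa>_rat kp M_def using vgcd_pos[OF p0] by simp
  have N: "of_int (form q p) * (of_nat (f U) / of_nat (vgcd q)) = (of_nat (N U) :: rat)" for U
    unfolding \<kappa>_rat kq N_def using vgcd_pos[OF q0] by simp
  have scM: "set_count A B (fst p) (snd p) M" and scN: "set_count A B (fst q) (snd q) N"
    using p q unfolding M_def N_def admissible_def by (auto intro: set_count_const_mult)
  define e where "e r U = uexp r (M U) (N U) / of_int (form q p)" for r U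
  \<comment> \<open>The floor only serves to obtain a natural number; it is exact because the
    rational value is shown below to be a nonnegative integer.\<close>
  define E where "E r U = nat \<lfloor>of_nat (vgcd (?\<theta> r)) * e r U\<rfloor>" for r U
  have main: "of_nat (E r U) / of_nat (vgcd (?\<theta> r)) = e r U \<and>
      set_count A B (fst (?\<theta> r)) (snd (?\<theta> r)) (E r) \<and> ?\<theta> r \<noteq> 0 \<and> ndeg q + ndeg p \<le> ndeg (?\<theta> r) \<and> ndeg (?\<theta> r) \<le> l"
    if r: "r \<in> interior l p q" for r U
  proof -
    obtain a b where ab: "r = (a, b)" by (cases r)
    have pos: "a > 0" "b > 0" and deg: "a * ndeg p + b * ndeg q \<le> l"
      using r by (auto simp: interior_def ab ndeg_lattice_map)
    have dp: "ndeg p \<ge> 1" "ndeg q \<ge> 1" using ndeg_pos[OF p0] ndeg_pos[OF q0] by simp_all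
    have ge: "a * 1 \<le> a * ndeg p" "b * 1 \<le> b * ndeg q" "1 * ndeg p \<le> a * ndeg p" "1 * ndeg q \<le> b * ndeg q"
      using dp pos by (auto intro!: mult_le_mono1 mult_le_mono2)
    have lower: "ndeg q + ndeg p \<le> ndeg (?\<theta> r)" using ge unfolding ndeg_lattice_map ab fst_conv snd_conv by linarith
    \<comment> \<open>As p or q has degree at least 2, a + b is strictly below the degree of ap + bq
      and thus below l: the expansion of the exponent at (a, b) is available.\<close>
    have "a + b < a * ndeg p + b * ndeg q"
    proof (cases "ndeg p = 1")
      case True
      then have "b * 2 \<le> b * ndeg q" using dp \<open>\<not> (ndeg p = 1 \<and> ndeg q = 1)\<close> by (intro mult_le_mono2) linarith
      then show ?thesis using ge pos by linarith
    next
      case False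
      then have "a * 2 \<le> a * ndeg p" using dp by (intro mult_le_mono2) linarith
      then show ?thesis using ge pos by linarith
    qed
    then have "a + b < l" using deg by linarith
    then obtain \<alpha> where \<alpha>: "\<And>m n. of_nat (gcd a b) * uexp (a, b) m n =
       of_nat (\<Sum>i\<in>{1..a}. \<Sum>j\<in>{1..b}. \<alpha> i j * (m choose i) * (n choose j))"
      using exp pos unfolding expansion_upto_def by blast
    define V where "V U = (\<Sum>i\<in>{1..a}. \<Sum>j\<in>{1..b}. \<alpha> i j * (M U choose i) * (N U choose j))" for U
    have gpos: "(of_nat (gcd a b) :: rat) > 0" and kpos: "(of_int (form q p) :: rat) > 0" using pos \<kappa> by simp_all
    have e: "of_nat (gcd a b) * of_int (form q p) * e r U = of_nat (V U)" for U
      using \<alpha>[of "M U" "N U"] kpos by (simp add: e_def ab V_def)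
    have e_nonneg: "e r U \<ge> 0" for U
    proof -
      have "of_nat (gcd a b) * of_int (form q p) * e r U \<ge> 0" unfolding e by simp
      moreover have "of_nat (gcd a b) * of_int (form q p) > (0::rat)" using gpos kpos by (rule mult_pos_pos)
      ultimately show ?thesis by (simp only: zero_le_mult_iff) linarith
    qed
    have int: "integral_letter (q, of_nat (f U) / of_nat (vgcd q))" "integral_letter (p, of_nat (g U) / of_nat (vgcd p))" for U
      using specialize_integral[of "(q, f)" U] specialize_integral[of "(p, g)" U] p0 q0 by (simp_all add: specialize_def)
    have E: "of_nat (E r U) = of_nat (vgcd (?\<theta> r)) * e r U" for U
    proof -
      have "of_nat (vgcd (?\<theta> r)) * e r U \<in> \<int>"
        unfolding e_def by (rule swap_integral[OF \<kappa> l M N int r])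
      then obtain z where z: "of_nat (vgcd (?\<theta> r)) * e r U = of_int z" by (auto elim: Ints_cases)
      moreover have "of_nat (vgcd (?\<theta> r)) * e r U \<ge> 0" using e_nonneg by simp
      ultimately have "z \<ge> 0" by simp
      then show ?thesis by (simp add: E_def z)
    qed
    have \<theta>0: "?\<theta> r \<noteq> 0" using lower dp by (auto simp: ndeg_def)
    have vpos: "(of_nat (vgcd (?\<theta> r)) :: rat) > 0" using vgcd_pos[OF \<theta>0] by simp
    \<comment> \<open>V is a label count by the closure properties, with the coordinates of ap + bq
      as size bounds. E is natural valued, so the factor gcd(a, b) \<kappa> may be divided out by
      \<open>set_count_divide\<close>.\<close>
    have "gcd a b * ?\<kappa> * E r U = vgcd (?\<theta> r) * V U" for U
    proof -
      have "(of_nat (gcd a b * ?\<kappa> * E r U) :: rat) = of_nat (vgcd (?\<theta> r)) * (of_nat (gcd a b) * of_int (form q p) * e r U)"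
        by (simp only: of_nat_mult E \<kappa>_rat mult_ac)
      also have "\<dots> = of_nat (vgcd (?\<theta> r) * V U)" unfolding e by simp
      finally show ?thesis by (simp only: of_nat_eq_iff)
    qed
    then have "(\<lambda>U. (gcd a b * ?\<kappa>) * E r U) = (\<lambda>U. vgcd (?\<theta> r) * V U)" by (intro ext)
    moreover have "set_count A B (fst (?\<theta> r)) (snd (?\<theta> r)) (\<lambda>U. vgcd (?\<theta> r) * V U)"
      unfolding V_def using set_count_binomial_sum[OF scM scN, of a b \<alpha>]
      by (intro set_count_const_mult) (simp add: lattice_map_def ab)
    ultimately have "set_count A B (fst (?\<theta> r)) (snd (?\<theta> r)) (\<lambda>U. (gcd a b * ?\<kappa>) * E r U)" by simp
    then have "set_count A B (fst (?\<theta> r)) (snd (?\<theta> r)) (E r)"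
      by (rule set_count_divide[OF fin, rotated]) (use pos \<kappa>_pos in simp)
    then show ?thesis using E[of U] vpos \<theta>0 lower deg by (simp add: ndeg_lattice_map ab)
  qed
  let ?I = "increasing_list (interior l p q)"
  let ?Ms = "map (\<lambda>r. (?\<theta> r, E r)) ?I"
  have "admissible A B z \<and> ndeg q + ndeg p \<le> ndeg (fst z) \<and> ndeg (fst z) \<le> l" if z: "z \<in> set ?Ms" for z
  proof -
    obtain r where r: "r \<in> interior l p q" "z = (?\<theta> r, E r)" using z unfolding set_map interior_list(2) by blast
    have "ndeg (?\<theta> r) \<noteq> 1" using main[OF r(1)] ndeg_pos[OF p0] ndeg_pos[OF q0] by fastforce
    then show ?thesis using main[OF r(1)] by (simp add: r(2) admissible_def)
  qed
  moreover have "word_kernel l (map (specialize U) [(q, f), (p, g)]) =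
         word_kernel l (map (specialize U) ((p, g) # ?Ms @ [(q, f)]))" for U
  proof -
    have Ms: "map (specialize U) ?Ms = map (\<lambda>r. (?\<theta> r, uexp r (M U) (N U) / of_int (form q p))) ?I"
      unfolding map_map
    proof (rule map_cong[OF refl])
      fix r assume "r \<in> set ?I"
      then have "r \<in> interior l p q" by (simp only: interior_list(2))
      then show "(specialize U \<circ> (\<lambda>r. (?\<theta> r, E r))) r = (?\<theta> r, uexp r (M U) (N U) / of_int (form q p))"
        using main[of r U] by (simp add: specialize_def e_def)
    qed
    have "specialize U (q, f) = (q, of_nat (f U) / of_nat (vgcd q))"
      "specialize U (p, g) = (p, of_nat (g U) / of_nat (vgcd p))" by (simp_all add: specialize_def)
    then show ?thesis
      unfolding list.map(1,2) map_append Ms using swap_general[OF \<kappa> l M[of U] N[of U]] by (simp only:)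
  qed
  ultimately show ?thesis by blast
qed

section \<open>Sorting\<close>

text \<open>{p, q} > 0 means that p, standing before q, has to move behind it. Inversions are
  recorded by the degree sum e because an exchange creates new ones, but only with larger
  sum.\<close>

definition inverted :: "nat \<Rightarrow> nat \<times> nat \<Rightarrow> nat \<times> nat \<Rightarrow> bool" where
  "inverted e p q \<longleftrightarrow> form p q > 0 \<and> ndeg p + ndeg q = e"

definition cross_inversions :: "nat \<Rightarrow> (nat \<times> nat) list \<Rightarrow> (nat \<times> nat) list \<Rightarrow> nat" where
  "cross_inversions e ps qs = (\<Sum>p\<leftarrow>ps. length (filter (inverted e p) qs))"

fun inversions :: "nat \<Rightarrow> (nat \<times> nat) list \<Rightarrow> nat" where
  "inversions e [] = 0"
| "inversions e (p # ps) = length (filter (inverted e p) ps) + inversions e ps"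

lemma cross_inversions_simps:
  "cross_inversions e [] qs = 0"
  "cross_inversions e ps [] = 0"
  "cross_inversions e (p # ps) qs = length (filter (inverted e p) qs) + cross_inversions e ps qs"
  "cross_inversions e (ps @ ps') qs = cross_inversions e ps qs + cross_inversions e ps' qs"
  "cross_inversions e ps (qs @ qs') = cross_inversions e ps qs + cross_inversions e ps qs'"
  by (simp_all add: cross_inversions_def sum_list_addf)

lemma inversions_append: "inversions e (ps @ qs) = inversions e ps + inversions e qs + cross_inversions e ps qs"
  by (induction ps) (simp_all add: cross_inversions_simps)

lemma cross_inversions_zero:
  "(\<And>p q. p \<in> set ps \<Longrightarrow> q \<in> set qs \<Longrightarrow> \<not> inverted e p q) \<Longrightarrow> cross_inversions e ps qs = 0"
  by (induction ps) (auto simp: cross_inversions_simps filter_empty_conv)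

lemma inversions_zero:
  "(\<And>p q. p \<in> set ps \<Longrightarrow> q \<in> set ps \<Longrightarrow> \<not> inverted e p q) \<Longrightarrow> inversions e ps = 0"
  by (induction ps) (auto simp: filter_empty_conv)

text \<open>A created letter has degree at least deg p + deg q, so any pair containing it has a
  strictly larger degree sum. Up to deg p + deg q the only change is the loss of the inversion (p,
  q).\<close>

lemma inversions_swap:
  assumes pq: "form p q > 0" and e: "e \<le> ndeg p + ndeg q"
    and Ms: "\<And>r. r \<in> set Ms \<Longrightarrow> ndeg p + ndeg q \<le> ndeg r"
    and nz: "\<And>r. r \<in> set (ps @ [p, q] @ qs) \<Longrightarrow> r \<noteq> 0"
  shows "inversions e (ps @ [p, q] @ qs) =
    inversions e (ps @ ([q] @ Ms @ [p]) @ qs) + of_bool (e = ndeg p + ndeg q)"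
proof -
  have big: "\<not> inverted e r s \<and> \<not> inverted e s r" if "r \<in> set Ms" "s \<noteq> 0" for r s
    using Ms[OF that(1)] ndeg_pos[OF that(2)] e by (auto simp: inverted_def)
  have Ms0: "r \<noteq> 0" if "r \<in> set Ms" for r
    using Ms[OF that] ndeg_pos[of p] nz[of p] by (auto simp: ndeg_def)
  have "\<not> inverted e q p" using pq form_antisym[of q p] by (simp add: inverted_def)
  moreover have "inverted e p q \<longleftrightarrow> e = ndeg p + ndeg q" using pq by (auto simp: inverted_def)
  moreover have "cross_inversions e ps Ms = 0" "cross_inversions e Ms qs = 0" "cross_inversions e Ms [p] = 0"
    "cross_inversions e [q] Ms = 0"
    using big nz by (auto intro!: cross_inversions_zero)
  moreover have "inversions e Ms = 0"
    using big Ms0 by (intro inversions_zero) blast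
  moreover have "length (filter (inverted e q) Ms) = 0"
    using calculation(6) by (simp add: cross_inversions_simps)
  moreover have split: "cross_inversions e ps [p, q] = cross_inversions e ps [p] + cross_inversions e ps [q]"
    "cross_inversions e ps [q, p] = cross_inversions e ps [q] + cross_inversions e ps [p]"
    using cross_inversions_simps(5)[of e ps "[p]" "[q]"] cross_inversions_simps(5)[of e ps "[q]" "[p]"] by simp_all
  ultimately show ?thesis
    unfolding inversions_append cross_inversions_simps by (simp add: cross_inversions_simps)
qed

lemma not_successively_decomp:
  "\<not> successively P xs \<Longrightarrow> \<exists>as x y bs. xs = as @ x # y # bs \<and> \<not> P x y"
proof (induction xs rule: induct_list012)
  case (3 x y zs)
  show ?case
  proof (cases "P x y")
    case True
    then have "\<not> successively P (y # zs)" using 3 by simp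
    then obtain as a b bs where "y # zs = as @ a # b # bs" "\<not> P a b" using 3 by blast
    then have "x # y # zs = (x # as) @ a # b # bs \<and> \<not> P a b" by simp
    then show ?thesis by blast
  next
    case False
    then have "x # y # zs = [] @ x # y # zs \<and> \<not> P x y" by simp
    then show ?thesis by blast
  qed
qed simp_all

text \<open>The numbers of inversions with degree sum e = 0, ..., 2l decrease lexicographically: an
  exchange lowers the entry at its own sum and keeps all earlier ones. Letters have degree at most
  l, so no larger sums occur. The order of exchanges depends on the lattice points alone, so a
  single sorted word serves every U.\<close>

lemma sort_word:
  assumes exp: "expansion_upto l" and l: "l > 0" and fin: "finite A" "finite B"
    and w: "\<forall>x\<in>set w. admissible A B x \<and> ndeg (fst x) \<le> l"
  shows "\<exists>w'. (\<forall>x\<in>set w'. admissible A B x \<and> ndeg (fst x) \<le> l) \<and>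
    sorted_wrt (\<lambda>x y. form (fst x) (fst y) \<le> 0) w' \<and>
    (\<forall>U. word_kernel l (map (specialize U) w) = word_kernel l (map (specialize U) w'))"
  using w
proof (induction w rule: wf_induct_rule[OF wf_inv_image[OF wf_lex[OF wf_less_than],
      where f = "\<lambda>w. map (\<lambda>e. inversions e (map fst w)) [0..<Suc (2 * l)]"]])
  case (1 w)
  let ?P = "\<lambda>x y :: labelled_letter. form (fst x) (fst y) \<le> 0"
  let ?\<mu> = "\<lambda>w :: labelled_letter list. map (\<lambda>e. inversions e (map fst w)) [0..<Suc (2 * l)]"
  show ?case
  proof (cases "successively ?P w")
    case True
    \<comment> \<open>The relation {p, q} \<le> 0 is transitive across nonzero points, so comparing
      neighbours suffices.\<close>
    have "sorted_wrt ?P w \<longleftrightarrow> successively ?P w"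
    proof (rule successively_iff_sorted_wrt_strong[symmetric])
      fix x y z assume "y \<in> set w" "form (fst x) (fst y) \<le> 0" "form (fst y) (fst z) \<le> 0"
      then show "form (fst x) (fst z) \<le> 0"
        using form_trans[of "fst y" "fst x" "fst z"] 1(2) by (auto simp: admissible_def)
    qed
    then show ?thesis using True 1(2) by (intro exI[of _ w]) simp
  next
    case False
    then obtain as x y bs where dec: "w = as @ x # y # bs" "\<not> ?P x y"
      using not_successively_decomp by blast
    obtain q f p g where xy: "x = (q, f)" "y = (p, g)" by (cases x, cases y)
    have \<kappa>: "form q p > 0" using dec(2) by (simp add: xy)
    have adm: "admissible A B (q, f)" "admissible A B (p, g)" "ndeg q \<le> l" "ndeg p \<le> l"
      using 1(2) dec(1) xy by auto
    obtain Ms where Ms: "\<And>z. z \<in> set Ms \<Longrightarrow> admissible A B z \<and> ndeg q + ndeg p \<le> ndeg (fst z) \<and> ndeg (fst z) \<le> l"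
      "\<And>U. word_kernel l (map (specialize U) [(q, f), (p, g)]) =
         word_kernel l (map (specialize U) ((p, g) # Ms @ [(q, f)]))"
      using swap_labelled[OF exp l fin adm(1,2) \<kappa>] by blast
    let ?w = "as @ ((p, g) # Ms @ [(q, f)]) @ bs"
    have inv: "inversions e (map fst w) = inversions e (map fst ?w) + of_bool (e = ndeg q + ndeg p)"
      if "e \<le> ndeg q + ndeg p" for e
    proof -
      have "inversions e (map fst as @ [q, p] @ map fst bs) =
         inversions e (map fst as @ ([p] @ map fst Ms @ [q]) @ map fst bs) + of_bool (e = ndeg q + ndeg p)"
      proof (rule inversions_swap[OF \<kappa> that])
        fix r assume "r \<in> set (map fst Ms)"
        then show "ndeg q + ndeg p \<le> ndeg r" using Ms(1) by auto
      next
        fix r assume "r \<in> set (map fst as @ [q, p] @ map fst bs)"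
        then have "r \<in> fst ` set w" by (auto simp: dec(1) xy)
        then show "r \<noteq> 0" using 1(2) by (auto simp: admissible_def)
      qed
      then show ?thesis by (simp add: dec(1) xy)
    qed
    have "(?\<mu> ?w, ?\<mu> w) \<in> lex less_than"
    proof -
      let ?d = "ndeg q + ndeg p"
      have upt: "[0..<Suc (2 * l)] = [0..<?d] @ ?d # [Suc ?d..<Suc (2 * l)]"
      proof -
        have d: "?d < Suc (2 * l)" using adm(3,4) by linarith
        then have "[0..<Suc (2 * l)] = [0..<?d] @ [?d..<Suc (2 * l)]"
          using upt_add_eq_append[of 0 ?d "Suc (2 * l) - ?d"] by (simp del: upt_Suc)
        then show ?thesis using upt_conv_Cons[OF d] by (simp only:)
      qed
      have "map (\<lambda>e. inversions e (map fst ?w)) [0..<?d] = map (\<lambda>e. inversions e (map fst w)) [0..<?d]"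
        by (rule map_cong) (auto simp: inv)
      moreover have "inversions ?d (map fst ?w) < inversions ?d (map fst w)" using inv[of ?d] by simp
      ultimately show ?thesis
        unfolding upt map_append list.map lex_conv mem_Collect_eq prod.case
        by (intro conjI exI) auto
    qed
    then have "(?w, w) \<in> inv_image (lex less_than) ?\<mu>" by simp
    moreover have "\<forall>x\<in>set ?w. admissible A B x \<and> ndeg (fst x) \<le> l"
      using 1(2) Ms(1) by (auto simp: dec(1) xy)
    ultimately obtain w' where w': "\<forall>x\<in>set w'. admissible A B x \<and> ndeg (fst x) \<le> l" "sorted_wrt ?P w'"
      "\<And>U. word_kernel l (map (specialize U) ?w) = word_kernel l (map (specialize U) w')"
      using 1(1) by blast
    have "word_kernel l (map (specialize U) w) = word_kernel l (map (specialize U) w')" for U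
    proof -
      have "word_kernel l (map (specialize U) w) = word_kernel l (map (specialize U) as) *
          word_kernel l (map (specialize U) [(q, f), (p, g)]) * word_kernel l (map (specialize U) bs)"
        by (simp add: dec(1) xy mult.assoc)
      also have "\<dots> = word_kernel l (map (specialize U) ?w)"
        unfolding Ms(2) map_append word_kernel_append by (simp only: mult.assoc)
      finally show ?thesis using w'(3) by simp
    qed
    then show ?thesis using w' by blast
  qed
qed

section \<open>The labelled initial word and the induction on degree\<close>

lemma word_kernel_merge_all:
  "word_kernel l (map (\<lambda>j. (p, e j)) js) = exp_kernel l (letter l (p, \<Sum>j\<leftarrow>js. e j))"
proof (induction js)
  case (Cons j js)
  then show ?case using letter_merge[of l p "e j" "\<Sum>j\<leftarrow>js. e j"] by simp
qed (simp add: letter_trivial exp_kernel_zero)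

lemma set_count_sum_list:
  "(\<And>x. x \<in> set xs \<Longrightarrow> set_count A B a b (f x)) \<Longrightarrow> set_count A B a b (\<lambda>U. \<Sum>x\<leftarrow>xs. f x U)"
  by (induction xs) (auto intro: set_count.zero set_count_add)

text \<open>Labels below m stand for factors [1,0], the next n labels for factors [0,1]; U switches
  on exactly those it contains, so one sorted word yields the exponents for all smaller sizes too.
  In the truncation a + b the point (a, b) is still visible, while sorting uses only expansions of
  smaller coordinate sum.\<close>

lemma uexp_set_count:
  assumes a: "a > 0" and b: "b > 0" and exp: "expansion_upto (a + b)"
  shows "\<exists>H. set_count {..<m} {m..<m + n} a b H \<and>
    (\<forall>U. of_nat (gcd a b) * uexp (a, b) (card (U \<inter> {..<m})) (card (U \<inter> {m..<m + n})) = of_nat (H U))"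
proof -
  let ?A = "{..<m}" and ?B = "{m..<m + n}" and ?l = "a + b"
  let ?w = "map (\<lambda>j. ((0, 1), \<lambda>U. of_bool ({j} \<subseteq> U))) [m..<m + n] @
    map (\<lambda>i. ((1, 0), \<lambda>U. of_bool ({i} \<subseteq> U))) [0..<m] :: labelled_letter list"
  have adm: "\<forall>x\<in>set ?w. admissible ?A ?B x \<and> ndeg (fst x) \<le> ?l"
  proof
    fix x assume "x \<in> set ?w"
    then consider (y) j where "j \<in> ?B" "x = ((0, 1), \<lambda>U. of_bool ({j} \<subseteq> U))"
      | (x) i where "i \<in> ?A" "x = ((1, 0), \<lambda>U. of_bool ({i} \<subseteq> U))" by auto
    then show "admissible ?A ?B x \<and> ndeg (fst x) \<le> ?l"
    proof cases
      case y
      then have "{j} \<inter> ?A = {}" "{j} \<inter> ?B = {j}" by auto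
      then have "set_count ?A ?B 0 1 (\<lambda>U. of_bool ({j} \<subseteq> U))" using y by (intro set_count_indicator) auto
      then show ?thesis using y a b by (simp add: admissible_def zero_prod_def ndeg_def)
    next
      case x
      then have "{i} \<inter> ?A = {i}" "{i} \<inter> ?B = {}" by auto
      then have "set_count ?A ?B 1 0 (\<lambda>U. of_bool ({i} \<subseteq> U))" using x by (intro set_count_indicator) auto
      then show ?thesis using x a b by (simp add: admissible_def zero_prod_def ndeg_def)
    qed
  qed
  have "?l > 0" using a by simp
  from sort_word[OF exp this finite_lessThan finite_atLeastLessThan adm]
  obtain w' where w': "\<And>x. x \<in> set w' \<Longrightarrow> admissible ?A ?B x \<and> ndeg (fst x) \<le> ?l"
    "sorted_wrt (\<lambda>x y. form (fst x) (fst y) \<le> 0) w'"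
    "\<And>U. word_kernel ?l (map (specialize U) ?w) = word_kernel ?l (map (specialize U) w')"
    by blast
  define H where "H U = (\<Sum>x\<leftarrow>filter (\<lambda>x. fst x = (a, b)) w'. snd x U)" for U
  have "set_count ?A ?B a b H"
    unfolding H_def using w'(1) by (intro set_count_sum_list) (auto simp: admissible_def)
  moreover have "of_nat (gcd a b) * uexp (a, b) (card (U \<inter> ?A)) (card (U \<inter> ?B)) = of_nat (H U)" for U
  proof -
    let ?k = "card (U \<inter> ?A)" and ?h = "card (U \<inter> ?B)"
    \<comment> \<open>Merging the switched-on single factors makes their number, the size of U
      \<inter> A or U \<inter> B, the exponent of the initial word.\<close>
    have cnt: "(\<Sum>j\<leftarrow>[s..<t]. of_nat (of_bool ({j} \<subseteq> U))) = (of_nat (card (U \<inter> {s..<t})) :: rat)" for s t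
      by (simp add: sum_list_distinct_conv_sum_set Int_commute flip: of_nat_sum)
    have "word_kernel ?l (map (specialize U) ?w) = word_kernel ?l (initial_word ?k ?h)"
      using cnt[of m "m + n"] cnt[of 0 m]
      by (simp add: specialize_def o_def vgcd_def word_kernel_merge_all initial_word_def lessThan_atLeast0)
    then have "word_value ?l (initial_word ?k ?h) = word_value ?l (map (specialize U) w')"
      using w'(3)[of U] by (simp only: word_value_eq_iff)
    moreover have "word_kernel ?l (map (specialize U) w') =
        word_kernel ?l (ordered_word ?l (merged (map (specialize U) w')))"
      by (rule merged_ordered_word) (use w'(1,2) in \<open>auto simp: sorted_wrt_map admissible_def\<close>)
    ultimately have "word_value ?l (ordered_word ?l (\<lambda>p. uexp p ?k ?h)) =
        word_value ?l (ordered_word ?l (merged (map (specialize U) w')))"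
      unfolding uexp_ordered_word by (simp only: word_value_eq_iff)
    then have "uexp (a, b) ?k ?h = merged (map (specialize U) w') (a, b)"
      by (rule ordered_word_unique) (use a in \<open>simp add: degree_upto_def Nplus_iff ndeg_def zero_prod_def\<close>)
    also have "\<dots> = (\<Sum>x\<leftarrow>filter (\<lambda>x. fst x = (a, b)) w'. of_nat (snd x U) / of_nat (gcd a b))"
    proof -
      have "map snd (map (specialize U) (filter (\<lambda>x. fst x = (a, b)) w')) =
         map (\<lambda>x. of_nat (snd x U) / of_nat (gcd a b)) (filter (\<lambda>x. fst x = (a, b)) w')"
        by (auto simp: specialize_def vgcd_def)
      then show ?thesis by (simp only: merged_def filter_map o_def fst_specialize)
    qed
    also have "\<dots> = of_nat (H U) / of_nat (gcd a b)"
      unfolding H_def by (induction w') (auto simp: add_divide_distrib)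
    finally show ?thesis using a by simp
  qed
  ultimately show ?thesis by blast
qed

text \<open>Strong induction on a + b. Switching on all labels shows that gcd(a, b) u(m, n) is a
  natural number F m n; the other sets U realise F at all smaller sizes by one label count, which is
  what \<open>binomial_expansion\<close> asks for.\<close>

lemma uexp_expansion:
  assumes "a > 0" "b > 0"
  shows "\<exists>\<alpha> :: nat \<Rightarrow> nat \<Rightarrow> nat. \<forall>m n. of_nat (gcd a b) * uexp (a, b) m n =
    of_nat (\<Sum>i\<in>{1..a}. \<Sum>j\<in>{1..b}. \<alpha> i j * (m choose i) * (n choose j))"
  using assms
proof (induction "a + b" arbitrary: a b rule: less_induct)
  case less
  have "expansion_upto (a + b)" unfolding expansion_upto_def using less.hyps by blast
  note count = uexp_set_count[OF less.prems this]
  have "\<exists>k::nat. of_nat (gcd a b) * uexp (a, b) m n = of_nat k" for m n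
  proof -
    obtain H where "\<And>U. of_nat (gcd a b) * uexp (a, b) (card (U \<inter> {..<m})) (card (U \<inter> {m..<m + n})) = of_nat (H U)"
      using count[of m n] by blast
    from this[of "{..<m + n}"] have "of_nat (gcd a b) * uexp (a, b) m n = of_nat (H {..<m + n})"
    proof -
      have "{..<m + n} \<inter> {..<m} = {..<m}" "{..<m + n} \<inter> {m..<m + n} = {m..<m + n}" by auto
      with \<open>\<And>U. _ = of_nat (H U)\<close>[of "{..<m + n}"] show ?thesis by simp
    qed
    then show ?thesis by blast
  qed
  then obtain F :: "nat \<Rightarrow> nat \<Rightarrow> nat" where F: "\<And>m n. of_nat (gcd a b) * uexp (a, b) m n = of_nat (F m n)"
    by metis
  have "\<exists>\<alpha>. \<forall>m n. F m n = (\<Sum>i\<in>{1..a}. \<Sum>j\<in>{1..b}. \<alpha> i j * (m choose i) * (n choose j))"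
  proof (rule binomial_expansion)
    fix m n
    show "\<exists>H. set_count {..<m} {m..<m + n} a b H \<and> (\<forall>U. F (card (U \<inter> {..<m})) (card (U \<inter> {m..<m + n})) = H U)"
      using count[of m n] unfolding F of_nat_eq_iff .
  next
    fix n
    show "F 0 n = 0" using F[of 0 n] uexp_0_left[of "(a, b)" n] less.prems by simp
  next
    fix m
    show "F m 0 = 0" using F[of m 0] uexp_0_right[of "(a, b)" m] less.prems by simp
  qed
  then show ?case unfolding F of_nat_eq_iff .
qed

theorem theorem6p1:
  fixes a b :: nat
  assumes "a > 0" and "b > 0"
  shows "\<exists>\<alpha> :: nat \<Rightarrow> nat \<Rightarrow> nat. \<forall>m n :: nat.
    uexp (a, b) m n =
      1 / of_nat (gcd a b) *
        (\<Sum>i\<in>{1..a}. \<Sum>j\<in>{1..b}. of_nat (\<alpha> i j) * of_nat (m choose i) * of_nat (n choose j))"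
proof -
  obtain \<alpha> :: "nat \<Rightarrow> nat \<Rightarrow> nat" where \<alpha>: "\<And>m n. of_nat (gcd a b) * uexp (a, b) m n =
      of_nat (\<Sum>i\<in>{1..a}. \<Sum>j\<in>{1..b}. \<alpha> i j * (m choose i) * (n choose j))"
    using uexp_expansion[OF assms] by blast
  have "(of_nat (gcd a b) :: rat) \<noteq> 0" using assms by simp
  then have "uexp (a, b) m n = 1 / of_nat (gcd a b) *
      of_nat (\<Sum>i\<in>{1..a}. \<Sum>j\<in>{1..b}. \<alpha> i j * (m choose i) * (n choose j))" for m n
    unfolding \<alpha>[symmetric] by simp
  then show ?thesis by (intro exI[of _ \<alpha>]) simp
qed

end
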